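(* Let $\Omega\subset\mathbb R^d$ be bounded, connected and Lipschitz, $\nu_0=|\Omega|^{-1}dx$, $s>\max\{1,d/2\}$, $\mathcal X=H^s(\Omega)\cap L^2_0(\nu_0)$, and let $\mathcal X_{\mathrm{ad}}\subset\mathcal X$ satisfy $c\le w_h\le C$ a.e. for all $h\in\mathcal X_{\mathrm{ad}}$, for constants $0<c<C<\infty$. Let $h:[0,T]\to\mathcal X_{\mathrm{ad}}$ with $h\in C^1([0,T];\mathcal X)$, and define $\rho_t=\rho_{h(t)}$ and $v_t=\mathcal T_{h(t)}\dot h(t)$. Then $(\rho_t,v_t)$ satisfies the continuity equation $\partial_t\rho_t+\nabla\cdot(\rho_tv_t)=0$ in the weak sense on $(0,T)\times\Omega$ with zero normal flux on $\partial\Omega$; equivalently, for every $\eta\in H^1(\Omega)$ and every $t\in[0,T]$, \[ \frac{d}{dt}\int_\Omega\eta\,d\rho_t=\int_\Omega\nabla\eta\cdot v_t\,d\rho_t. \]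
   Context: $L^2_0(\nu_0)=\{h\in L^2(\nu_0):\int h\,d\nu_0=0\}$. For $h\in L^\infty(\Omega)\cap L^2_0(\nu_0)$: $\rho_h=\frac{e^h}{\int_\Omega e^hd\nu_0}\nu_0$, $w_h=d\rho_h/d\nu_0$, $\mathbb E_{\rho_h}[f]=\int f\,d\rho_h$. $H^1_\diamond(\Omega)=\{u\in H^1(\Omega):\int_\Omega u\,dx=0\}$. For $h\in\mathcal X_{\mathrm{ad}}$, $\xi\in L^2_0(\nu_0)$, $\psi_{h,\xi}$ is the unique element of $H^1_\diamond(\Omega)$ with $\int\nabla\psi_{h,\xi}\cdot\nabla\eta\,d\rho_h=\int(\xi-\mathbb E_{\rho_h}[\xi])\eta\,d\rho_h$ for all $\eta\in H^1_\diamond(\Omega)$, and $\mathcal T_h\xi=\nabla\psi_{h,\xi}$. *)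

theory Defs
  imports "HOL-Analysis.Analysis"
begin

text \<open>Strongly Lipschitz domain: bounded open set whose boundary is locally, after a rigid
  rotation, the graph of a Lipschitz function of the remaining d-1 coordinates, with the set
  lying on one side of the graph.\<close>
definition lipschitz_domain :: "(real^'n) set \<Rightarrow> bool" where
  "lipschitz_domain \<Omega> \<longleftrightarrow> open \<Omega> \<and> bounded \<Omega> \<and>
     (\<forall>x\<in>frontier \<Omega>. \<exists>r>0. \<exists>Q j (\<gamma>::real^'n \<Rightarrow> real) L.
        orthogonal_transformation Q \<and>
        L-lipschitz_on UNIV \<gamma> \<and>
        (\<forall>z. \<gamma> z = \<gamma> (\<chi> i. if i = j then 0 else z $ i)) \<and>
        \<Omega> \<inter> ball x r = {y \<in> ball x r. Q (y - x) $ j < \<gamma> (Q (y - x))})"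

definition pdiff :: "'n \<Rightarrow> (real^'n \<Rightarrow> real) \<Rightarrow> real^'n \<Rightarrow> real" where
  "pdiff i f x = deriv (\<lambda>t. f (x + t *\<^sub>R axis i 1)) 0"

fun pdiffs :: "'n list \<Rightarrow> (real^'n \<Rightarrow> real) \<Rightarrow> real^'n \<Rightarrow> real" where
  "pdiffs [] f = f"
| "pdiffs (i # is) f = pdiff i (pdiffs is f)"

definition smooth_fun :: "(real^'n \<Rightarrow> real) \<Rightarrow> bool" where
  "smooth_fun f \<longleftrightarrow> (\<forall>is. continuous_on UNIV (pdiffs is f) \<and>
       (\<forall>i x. (\<lambda>t. pdiffs is f (x + t *\<^sub>R axis i 1)) differentiable (at 0)))"

definition test_fun :: "(real^'n) set \<Rightarrow> (real^'n \<Rightarrow> real) \<Rightarrow> bool" where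
  "test_fun \<Omega> \<phi> \<longleftrightarrow> smooth_fun \<phi> \<and> compact (closure {x. \<phi> x \<noteq> 0})
       \<and> closure {x. \<phi> x \<noteq> 0} \<subseteq> \<Omega>"

definition L2_on :: "(real^'n) set \<Rightarrow> (real^'n \<Rightarrow> real) \<Rightarrow> bool" where
  "L2_on \<Omega> u \<longleftrightarrow> u \<in> borel_measurable (lebesgue_on \<Omega>) \<and>
       integrable (lebesgue_on \<Omega>) (\<lambda>x. (u x)\<^sup>2)"

definition is_weak_deriv :: "(real^'n) set \<Rightarrow> 'n list \<Rightarrow> (real^'n \<Rightarrow> real) \<Rightarrow> (real^'n \<Rightarrow> real) \<Rightarrow> bool" where
  "is_weak_deriv \<Omega> is u g \<longleftrightarrow> (\<forall>\<phi>. test_fun \<Omega> \<phi> \<longrightarrow>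
       (\<integral>x. u x * pdiffs is \<phi> x \<partial>lebesgue_on \<Omega>) =
       (-1) ^ length is * (\<integral>x. g x * \<phi> x \<partial>lebesgue_on \<Omega>))"

definition weakD :: "(real^'n) set \<Rightarrow> 'n list \<Rightarrow> (real^'n \<Rightarrow> real) \<Rightarrow> real^'n \<Rightarrow> real" where
  "weakD \<Omega> is u = (SOME g. L2_on \<Omega> g \<and> is_weak_deriv \<Omega> is u g)"

definition wgrad :: "(real^'n) set \<Rightarrow> (real^'n \<Rightarrow> real) \<Rightarrow> real^'n \<Rightarrow> real^'n" where
  "wgrad \<Omega> u x = (\<chi> i. weakD \<Omega> [i] u x)"

definition sob_int :: "real \<Rightarrow> nat" where "sob_int s = nat \<lfloor>s\<rfloor>"
definition sob_frac :: "real \<Rightarrow> real" where "sob_frac s = s - of_int \<lfloor>s\<rfloor>"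

definition gagliardo_integrand :: "real \<Rightarrow> (real^'n \<Rightarrow> real) \<Rightarrow> ((real^'n) \<times> (real^'n)) \<Rightarrow> real" where
  "gagliardo_integrand \<sigma> g p = (g (fst p) - g (snd p))\<^sup>2 /
       dist (fst p) (snd p) powr (real CARD('n) + 2 * \<sigma>)"

definition Hs_space :: "(real^'n) set \<Rightarrow> real \<Rightarrow> (real^'n \<Rightarrow> real) set" where
  "Hs_space \<Omega> s = {u. L2_on \<Omega> u \<and>
     (\<forall>is. length is \<le> sob_int s \<longrightarrow> (\<exists>g. L2_on \<Omega> g \<and> is_weak_deriv \<Omega> is u g)) \<and>
     (sob_frac s > 0 \<longrightarrow> (\<forall>is. length is = sob_int s \<longrightarrow>
         integrable (lebesgue_on \<Omega> \<Otimes>\<^sub>M lebesgue_on \<Omega>)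
           (gagliardo_integrand (sob_frac s) (weakD \<Omega> is u))))}"

definition Hs_norm :: "(real^'n) set \<Rightarrow> real \<Rightarrow> (real^'n \<Rightarrow> real) \<Rightarrow> real" where
  "Hs_norm \<Omega> s u = sqrt (
     (\<Sum>is\<in>{is. length is \<le> sob_int s}. \<integral>x. (weakD \<Omega> is u x)\<^sup>2 \<partial>lebesgue_on \<Omega>) +
     (if sob_frac s > 0 then
        (\<Sum>is\<in>{is. length is = sob_int s}.
           \<integral>p. gagliardo_integrand (sob_frac s) (weakD \<Omega> is u) p
             \<partial>(lebesgue_on \<Omega> \<Otimes>\<^sub>M lebesgue_on \<Omega>))
      else 0))"

abbreviation H1 :: "(real^'n) set \<Rightarrow> (real^'n \<Rightarrow> real) set" where
  "H1 \<Omega> \<equiv> Hs_space \<Omega> 1"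

definition H1_diamond :: "(real^'n) set \<Rightarrow> (real^'n \<Rightarrow> real) set" where
  "H1_diamond \<Omega> = {u \<in> H1 \<Omega>. (\<integral>x. u x \<partial>lebesgue_on \<Omega>) = 0}"

definition nu0_int :: "(real^'n) set \<Rightarrow> (real^'n \<Rightarrow> real) \<Rightarrow> real" where
  "nu0_int \<Omega> f = (\<integral>x. f x \<partial>lebesgue_on \<Omega>) / measure lebesgue \<Omega>"

definition L2_0 :: "(real^'n) set \<Rightarrow> (real^'n \<Rightarrow> real) set" where
  "L2_0 \<Omega> = {h. L2_on \<Omega> h \<and> nu0_int \<Omega> h = 0}"

definition wdens :: "(real^'n) set \<Rightarrow> (real^'n \<Rightarrow> real) \<Rightarrow> real^'n \<Rightarrow> real" where
  "wdens \<Omega> h x = exp (h x) / nu0_int \<Omega> (\<lambda>y. exp (h y))"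

definition rho_int :: "(real^'n) set \<Rightarrow> (real^'n \<Rightarrow> real) \<Rightarrow> (real^'n \<Rightarrow> real) \<Rightarrow> real" where
  "rho_int \<Omega> h f = nu0_int \<Omega> (\<lambda>x. f x * wdens \<Omega> h x)"

definition psi_sol :: "(real^'n) set \<Rightarrow> (real^'n \<Rightarrow> real) \<Rightarrow> (real^'n \<Rightarrow> real) \<Rightarrow> (real^'n \<Rightarrow> real) \<Rightarrow> bool" where
  "psi_sol \<Omega> h \<xi> \<psi> \<longleftrightarrow> \<psi> \<in> H1_diamond \<Omega> \<and>
     (\<forall>\<eta>\<in>H1_diamond \<Omega>.
        rho_int \<Omega> h (\<lambda>x. wgrad \<Omega> \<psi> x \<bullet> wgrad \<Omega> \<eta> x) =
        rho_int \<Omega> h (\<lambda>x. (\<xi> x - rho_int \<Omega> h \<xi>) * \<eta> x))"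

definition Tmap :: "(real^'n) set \<Rightarrow> (real^'n \<Rightarrow> real) \<Rightarrow> (real^'n \<Rightarrow> real) \<Rightarrow> real^'n \<Rightarrow> real^'n" where
  "Tmap \<Omega> h \<xi> = wgrad \<Omega> (SOME \<psi>. psi_sol \<Omega> h \<xi> \<psi>)"

end

theory Submission
  imports Defs "HOL-Computational_Algebra.Polynomial"
begin

text \<open>
  The bounds on the density, together with \<open>\<integral>h = 0\<close>, give \<open>\<bar>h\<bar> \<le> ln (C / c)\<close> almost everywhere. Hence
  \<open>L\<^sup>2\<close>-differentiability of \<open>t \<mapsto> h t\<close> suffices to differentiate \<open>\<integral>\<eta> e\<^sup>h\<close>, and the quotient rule yields
  the covariance of \<open>\<eta>\<close> and \<open>\<partial>\<^sub>t h\<close> under \<open>\<rho>\<close>; testing the equation for \<open>\<psi>\<close> with \<open>\<eta>\<close> minus its mean turns the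
  covariance into the flux.

  The substance is the existence of \<open>\<psi>\<close>, which rests on the Poincare inequality for a connected Lipschitz
  domain. For a function with weak gradient \<open>g\<close>, the identity \<open>u (x + v) - u x = \<integral>\<^sub>0\<^sup>1 v \<bullet> g (x + s v) ds\<close> holds for
  almost every \<open>x\<close> whose segment stays in the domain. Averaging over \<open>v\<close> gives the inequality on convex
  subsets; a boundary piece below a Lipschitz graph is translated along the graph axis into a convex box.
  Finitely many such pieces cover the domain, and two overlapping pieces can be merged, so connectedness
  finishes the argument. No extension operator, trace or compact embedding is needed.
\<close>

section \<open>Product bump functions\<close>

text \<open>Two gaps in regularity shape the proof. The weight \<open>\<eta>\<close> is only square
  integrable and \<open>h\<close> is differentiated only in \<open>L2\<close>, so the quadratic
  Taylor remainder of \<open>exp\<close> cannot be estimated by a supremum norm: it is split as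
  \<open>\<eta>\<close> times the increment, against the difference quotient, and
  \<open>\<eta>\<close> is truncated. Moreover \<open>weakD\<close> and \<open>Tmap\<close> are
  Hilbert choices: gradients are linear only almost everywhere, and the value of \<open>Tmap\<close>
  means nothing until a solution of the Neumann problem is known to exist. Hence the Riesz theorem
  for a set with an operation \<open>comb\<close> and a semi-inner product.

  Weak derivatives live on \<open>lebesgue_on \<Omega>\<close> and are tested by all test functions,
  while translation and Fubini are applied on \<open>lborel\<close>. The passage is made once, to
  Borel representatives vanishing outside \<open>\<Omega>\<close> and to product bumps over boxes.
  These suffice for the fundamental lemma and are stable under translation; since
  \<open>smooth_fun\<close> speaks of every list of partial derivatives, their derivatives are
  generated in closed form from \<open>flat\<close>.\<close>

definition flat :: "nat \<Rightarrow> real poly \<Rightarrow> real poly \<Rightarrow> real \<Rightarrow> real" where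
  "flat k p q t = (if poly q t > 0 then poly p t / poly q t ^ k * exp (- 1 / poly q t) else 0)"

section \<open>Smooth functions that are flat at the boundary of the set where \<open>q\<close> is
  positive\<close>

lemma power_exp_le_fact:
  fixes y :: real
  assumes "y \<ge> 0"
  shows "y ^ m * exp (- y) \<le> fact m"
proof -
  have "y ^ m / fact m \<le> exp y"
  proof -
    have "(\<lambda>n. inverse (fact n) * y ^ n) sums exp y"
      using exp_converges[of y] by simp
    then have "sum (\<lambda>n. inverse (fact n) * y ^ n) {m} \<le> exp y"
      using sum_le_suminf[OF sums_summable, of _ _ "{m}"] sums_unique assms by fastforce
    then show ?thesis by (simp add: field_simps)
  qed
  then show ?thesis by (simp add: exp_minus field_simps)
qed

text \<open>The exponential beats \<open>k + 2\<close> powers of \<open>1 / q\<close>, two more than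
  the denominator holds. The two spare powers serve the difference quotient at a zero of
  \<open>q\<close>: dividing by \<open>x - t\<close> uses up one, and the other tends to 0.\<close>

lemma flat_near_zero_bound:
  assumes "poly q t > 0"
  shows "\<bar>flat k p q t\<bar> \<le> \<bar>poly p t\<bar> * fact (k + 2) * (poly q t)^2"
proof -
  let ?x = "poly q t"
  have "(1 / ?x) ^ (k + 2) * exp (- (1 / ?x)) \<le> fact (k + 2)"
    using assms by (intro power_exp_le_fact) auto
  then have "(1 / ?x) ^ (k + 2) * exp (- (1 / ?x)) * ?x^2 \<le> fact (k + 2) * ?x^2"
    by (intro mult_right_mono) auto
  then have le: "exp (- 1 / ?x) / ?x ^ k \<le> fact (k + 2) * ?x^2"
    using assms by (simp add: field_simps power_add power2_eq_square)
  have "\<bar>flat k p q t\<bar> = \<bar>poly p t\<bar> * (exp (- 1 / ?x) / ?x ^ k)"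
    using assms by (simp add: flat_def abs_mult)
  also have "\<dots> \<le> \<bar>poly p t\<bar> * (fact (k + 2) * ?x^2)"
    by (intro mult_left_mono le) auto
  finally show ?thesis by (simp add: mult.assoc)
qed

text \<open>The family is closed under differentiation, which is why numerator and exponent are
  parameters. Where \<open>q\<close> is positive this is the quotient and chain rule over the common
  denominator \<open>q ^ (k + 2)\<close>, where it is negative both sides vanish locally, and at a
  zero the quadratic bound gives derivative 0.\<close>

lemma flat_has_derivative:
  "(flat k p q has_real_derivative
     flat (k + 2) (pderiv p * q^2 - smult (of_nat k) (p * pderiv q * q) + p * pderiv q) q t) (at t)"
proof (cases "poly q t" "0::real" rule: linorder_cases)
  case greater
  then have ne: "poly q t \<noteq> 0" by simp
  have ev: "eventually (\<lambda>x. poly q x > 0) (nhds t)"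
    using greater poly_isCont[of t q]
    by (intro order_tendstoD(1)[of "poly q" "poly q t"]) (auto simp: isCont_def tendsto_at_iff_tendsto_nhds)
  have "((\<lambda>x. poly p x / poly q x ^ k * exp (- 1 / poly q x)) has_real_derivative
     (poly (pderiv p) t * poly q t ^ k - poly p t * (of_nat k * poly q t ^ (k - 1) * poly (pderiv q) t)) / (poly q t ^ k)^2
       * exp (- 1 / poly q t) + poly p t / poly q t ^ k * (exp (- 1 / poly q t) * (poly (pderiv q) t / (poly q t)^2))) (at t)"
    using ne
    by (auto intro!: derivative_eq_intros poly_DERIV simp: power2_eq_square field_simps)
  also have "(poly (pderiv p) t * poly q t ^ k - poly p t * (of_nat k * poly q t ^ (k - 1) * poly (pderiv q) t)) / (poly q t ^ k)^2
       * exp (- 1 / poly q t) + poly p t / poly q t ^ k * (exp (- 1 / poly q t) * (poly (pderiv q) t / (poly q t)^2))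
     = flat (k + 2) (pderiv p * q^2 - smult (of_nat k) (p * pderiv q * q) + p * pderiv q) q t"
    using ne greater
    by (cases k) (simp_all add: flat_def field_simps power2_eq_square)
  finally show ?thesis
    by (subst DERIV_cong_ev[OF refl _ refl]) (use ev in \<open>auto elim!: eventually_mono simp: flat_def\<close>)
next
  case less
  have ev: "eventually (\<lambda>x. poly q x < 0) (nhds t)"
    using less poly_isCont[of t q]
    by (intro order_tendstoD(2)[of "poly q" "poly q t"]) (auto simp: isCont_def tendsto_at_iff_tendsto_nhds)
  have "flat (k + 2) (pderiv p * q^2 - smult (of_nat k) (p * pderiv q * q) + p * pderiv q) q t = 0"
    using less by (simp add: flat_def)
  moreover have "((\<lambda>x. 0) has_real_derivative 0) (at t)" by simp
  ultimately show ?thesis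
    by (subst DERIV_cong_ev[OF refl _ refl, where g = "\<lambda>_. 0"])
      (use ev in \<open>auto elim!: eventually_mono simp: flat_def\<close>)
next
  case equal
  have z: "flat (k + 2) (pderiv p * q^2 - smult (of_nat k) (p * pderiv q * q) + p * pderiv q) q t = 0"
    using equal by (simp add: flat_def)
  have ft: "flat k p q t = 0" using equal by (simp add: flat_def)
  have qd: "((\<lambda>x. (poly q x - poly q t) / (x - t)) \<longlongrightarrow> poly (pderiv q) t) (at t)"
    using poly_DERIV[of q t] by (simp add: has_field_derivative_iff)
  have "((\<lambda>x. \<bar>poly p x\<bar> * fact (k + 2) * \<bar>(poly q x - poly q t) / (x - t)\<bar> * \<bar>poly q x\<bar>) \<longlongrightarrow>
     \<bar>poly p t\<bar> * fact (k + 2) * \<bar>poly (pderiv q) t\<bar> * \<bar>poly q t\<bar>) (at t)"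
    by (intro tendsto_intros qd)
  then have lim: "((\<lambda>x. \<bar>poly p x\<bar> * fact (k + 2) * \<bar>(poly q x - poly q t) / (x - t)\<bar> * \<bar>poly q x\<bar>) \<longlongrightarrow> 0) (at t)"
    using equal by simp
  have "((\<lambda>x. (flat k p q x - flat k p q t) / (x - t)) \<longlongrightarrow> 0) (at t)"
  proof (rule Lim_null_comparison[OF _ lim])
    show "\<forall>\<^sub>F x in at t. norm ((flat k p q x - flat k p q t) / (x - t))
       \<le> \<bar>poly p x\<bar> * fact (k + 2) * \<bar>(poly q x - poly q t) / (x - t)\<bar> * \<bar>poly q x\<bar>"
    proof (rule always_eventually, rule allI)
      fix x
      have "\<bar>flat k p q x\<bar> \<le> \<bar>poly p x\<bar> * fact (k + 2) * (poly q x)^2"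
        using flat_near_zero_bound[of q x k p] by (cases "poly q x > 0") (auto simp: flat_def)
      then have "\<bar>flat k p q x\<bar> / \<bar>x - t\<bar> \<le> \<bar>poly p x\<bar> * fact (k + 2) * (poly q x)^2 / \<bar>x - t\<bar>"
        by (rule divide_right_mono) auto
      also have "\<dots> = \<bar>poly p x\<bar> * fact (k + 2) * \<bar>(poly q x - poly q t) / (x - t)\<bar> * \<bar>poly q x\<bar>"
      proof -
        have "(poly q x)^2 = \<bar>poly q x\<bar> * \<bar>poly q x\<bar>" by (simp add: power2_eq_square)
        then show ?thesis by (simp only: equal) simp
      qed
      finally show "norm ((flat k p q x - flat k p q t) / (x - t))
       \<le> \<bar>poly p x\<bar> * fact (k + 2) * \<bar>(poly q x - poly q t) / (x - t)\<bar> * \<bar>poly q x\<bar>"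
        by (simp del: fact_Suc add: ft)
    qed
  qed
  then show ?thesis unfolding z by (simp add: has_field_derivative_iff)
qed

text \<open>The numerator of the m-th derivative of \<open>exp (- 1 / q)\<close>, over the denominator \<open>q ^ (2 * m)\<close>.\<close>
primrec flat_num :: "real poly \<Rightarrow> nat \<Rightarrow> real poly" where
  "flat_num q 0 = 1"
| "flat_num q (Suc m) = pderiv (flat_num q m) * q^2
     - smult (of_nat (2 * m)) (flat_num q m * pderiv q * q) + flat_num q m * pderiv q"

text \<open>The factor \<open>n\<close> steepens the bump: \<open>exp (- 1 / (n * y))\<close> tends
  to 1 for every \<open>y > 0\<close>, so the bumps approach the indicator of the open
  interval.\<close>

definition bump_poly :: "real \<Rightarrow> real \<Rightarrow> nat \<Rightarrow> real poly" where
  "bump_poly a b n = smult (real n) ([:- a, 1:] * [:b, - 1:])"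

text \<open>The last index is the order of the derivative, so that derivatives of all orders are
  explicit functions.\<close>

definition bump1 :: "real \<Rightarrow> real \<Rightarrow> nat \<Rightarrow> nat \<Rightarrow> real \<Rightarrow> real" where
  "bump1 a b n m = flat (2 * m) (flat_num (bump_poly a b n) m) (bump_poly a b n)"

lemma poly_bump_poly: "poly (bump_poly a b n) t = real n * ((t - a) * (b - t))"
  by (simp add: bump_poly_def algebra_simps)

lemma bump1_has_derivative: "(bump1 a b n m has_real_derivative bump1 a b n (Suc m) t) (at t)"
  using flat_has_derivative[of "2 * m" "flat_num (bump_poly a b n) m" "bump_poly a b n" t]
  by (simp add: bump1_def)

lemma bump1_continuous: "isCont (bump1 a b n m) t"
  using bump1_has_derivative DERIV_isCont by blast

lemma bump1_eq_0: "t \<notin> {a<..<b} \<Longrightarrow> a \<le> b \<Longrightarrow> bump1 a b n m t = 0"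
  by (auto simp: bump1_def flat_def poly_bump_poly zero_less_mult_iff)

lemma bump1_0_eq:
  "bump1 a b n 0 t = (if real n * ((t - a) * (b - t)) > 0 then exp (- 1 / (real n * ((t - a) * (b - t)))) else 0)"
  by (simp add: bump1_def flat_def poly_bump_poly)

lemma bump1_0_bounds: "0 \<le> bump1 a b n 0 t" "bump1 a b n 0 t \<le> 1"
  by (auto simp: bump1_0_eq)

lemma bump1_0_tendsto:
  assumes "a \<le> b"
  shows "(\<lambda>n. bump1 a b n 0 t) \<longlonglongrightarrow> indicator {a<..<b} t"
proof (cases "t \<in> {a<..<b}")
  case True
  let ?y = "(t - a) * (b - t)"
  have y: "?y > 0" using True by auto
  have "(\<lambda>n. exp (- (inverse ?y * inverse (real n)))) \<longlonglongrightarrow> exp (- (inverse ?y * 0))"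
    by (intro tendsto_intros lim_inverse_n)
  then have "(\<lambda>n. exp (- (inverse ?y * inverse (real n)))) \<longlonglongrightarrow> 1" by simp
  moreover have "\<forall>\<^sub>F n in sequentially. exp (- (inverse ?y * inverse (real n))) = bump1 a b n 0 t"
    using eventually_gt_at_top[of 0]
  proof eventually_elim
    case (elim n)
    have "real n > 0" using elim by simp
    then have "real n * ?y > 0" using y mult_pos_pos[of "real n" ?y] by linarith
    then show ?case using True by (simp add: bump1_0_eq divide_inverse)
  qed
  ultimately have "(\<lambda>n. bump1 a b n 0 t) \<longlonglongrightarrow> 1" by (rule Lim_transform_eventually)
  then show ?thesis using True by simp
next
  case False
  then show ?thesis using bump1_eq_0[OF False assms] by simp
qed

text \<open>The numerators of the two sides are never compared. At order 0 the closed forms agree,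
  and equality of two functions passes to their derivatives by uniqueness.\<close>

lemma bump1_shift: "bump1 a b n m (t - w) = bump1 (a + w) (b + w) n m t"
proof -
  have "bump1 (a + w) (b + w) n m = (\<lambda>t. bump1 a b n m (t - w))"
  proof (induction m)
    case 0
    then show ?case by (auto simp: bump1_0_eq fun_eq_iff algebra_simps)
  next
    case (Suc m)
    show ?case
    proof
      fix t
      have "(bump1 (a + w) (b + w) n m has_real_derivative bump1 a b n (Suc m) (t - w)) (at t)"
        unfolding Suc.IH using DERIV_shift[of "bump1 a b n m" "bump1 a b n (Suc m) (t - w)" t "- w"]
          bump1_has_derivative[of a b n m "t - w"] by simp
      then show "bump1 (a + w) (b + w) n (Suc m) t = bump1 a b n (Suc m) (t - w)"
        using bump1_has_derivative DERIV_unique by blast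
    qed
  qed
  then show ?thesis by simp
qed

text \<open>The multi-index \<open>c\<close> records the order of differentiation in each
  coordinate; every partial derivative of a bump is again of this form.\<close>

definition bumpD :: "(real^'n) \<Rightarrow> (real^'n) \<Rightarrow> nat \<Rightarrow> ('n \<Rightarrow> nat) \<Rightarrow> real^'n \<Rightarrow> real" where
  "bumpD a b n c x = (\<Prod>i\<in>UNIV. bump1 (a $ i) (b $ i) n (c i) (x $ i))"

abbreviation bump :: "(real^'n) \<Rightarrow> (real^'n) \<Rightarrow> nat \<Rightarrow> real^'n \<Rightarrow> real" where
  "bump a b n \<equiv> bumpD a b n (\<lambda>_. 0)"

lemma bumpD_continuous: "continuous_on S (bumpD a b n c)"
  unfolding bumpD_def
  by (intro continuous_on_prod continuous_on_compose2[OF _ continuous_on_component[OF continuous_on_id]])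
    (auto intro!: continuous_at_imp_continuous_on bump1_continuous)

text \<open>Arbitrary directions are covered because bumps are later differentiated along arbitrary
  segments, not only along the axes.\<close>

lemma bumpD_directional_derivative:
  "((\<lambda>t. bumpD a b n c (x + t *\<^sub>R v)) has_real_derivative
      (\<Sum>i\<in>UNIV. v $ i * bumpD a b n (c(i := Suc (c i))) (x + s *\<^sub>R v))) (at s)"
proof -
  have d: "((\<lambda>t. bump1 (a $ i) (b $ i) n (c i) ((x + t *\<^sub>R v) $ i)) has_real_derivative
      v $ i * bump1 (a $ i) (b $ i) n (Suc (c i)) ((x + s *\<^sub>R v) $ i)) (at s)" for i
  proof -
    have "((\<lambda>t. x $ i + t * v $ i) has_real_derivative v $ i) (at s)"
      by (auto intro!: derivative_eq_intros)
    from DERIV_chain2[OF bump1_has_derivative this, of "a $ i" "b $ i" n "c i"]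
    show ?thesis by (simp add: mult.commute)
  qed
  have "((\<lambda>t. bumpD a b n c (x + t *\<^sub>R v)) has_real_derivative
     (\<Sum>i\<in>UNIV. v $ i * bump1 (a $ i) (b $ i) n (Suc (c i)) ((x + s *\<^sub>R v) $ i) *
        (\<Prod>j\<in>UNIV - {i}. bump1 (a $ j) (b $ j) n (c j) ((x + s *\<^sub>R v) $ j)))) (at s)"
    unfolding bumpD_def by (rule has_field_derivative_prod[OF d])
  also have "(\<Sum>i\<in>UNIV. v $ i * bump1 (a $ i) (b $ i) n (Suc (c i)) ((x + s *\<^sub>R v) $ i) *
        (\<Prod>j\<in>UNIV - {i}. bump1 (a $ j) (b $ j) n (c j) ((x + s *\<^sub>R v) $ j)))
     = (\<Sum>i\<in>UNIV. v $ i * bumpD a b n (c(i := Suc (c i))) (x + s *\<^sub>R v))"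
  proof (rule sum.cong[OF refl])
    fix i
    have "bumpD a b n (c(i := Suc (c i))) (x + s *\<^sub>R v) =
       bump1 (a $ i) (b $ i) n (Suc (c i)) ((x + s *\<^sub>R v) $ i) *
       (\<Prod>j\<in>UNIV - {i}. bump1 (a $ j) (b $ j) n (c j) ((x + s *\<^sub>R v) $ j))"
      unfolding bumpD_def by (subst prod.remove[of _ i]) (auto intro!: prod.cong)
    then show "v $ i * bump1 (a $ i) (b $ i) n (Suc (c i)) ((x + s *\<^sub>R v) $ i) *
        (\<Prod>j\<in>UNIV - {i}. bump1 (a $ j) (b $ j) n (c j) ((x + s *\<^sub>R v) $ j)) =
       v $ i * bumpD a b n (c(i := Suc (c i))) (x + s *\<^sub>R v)" by simp
  qed
  finally show ?thesis .
qed

lemma bumpD_axis_derivative: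
  "((\<lambda>t. bumpD a b n c (x + t *\<^sub>R axis i 1)) has_real_derivative bumpD a b n (c(i := Suc (c i))) x) (at 0)"
  using bumpD_directional_derivative[of a b n c x "axis i 1" 0]
  by (simp add: axis_def if_distrib[where f = "\<lambda>z. z * _"] sum.If_cases cong: if_cong)

text \<open>For a product of functions of one variable only the multiplicity of each index in the
  list matters, hence \<open>count_list\<close>.\<close>

lemma pdiffs_bumpD: "pdiffs is (bumpD a b n c) = bumpD a b n (\<lambda>i. c i + count_list is i)"
proof (induction "is")
  case (Cons i js)
  have "(\<lambda>k. c k + count_list (i # js) k) = (\<lambda>k. c k + count_list js k)(i := Suc (c i + count_list js i))"
    by auto
  then show ?case
    using DERIV_imp_deriv[OF bumpD_axis_derivative[of a b n "\<lambda>k. c k + count_list js k" _ i]]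
    by (simp only: pdiffs.simps Cons pdiff_def fun_eq_iff) simp
qed auto

lemma bumpD_eq_0:
  assumes "\<forall>i. a $ i \<le> b $ i" "x \<notin> box a b"
  shows "bumpD a b n c x = 0"
proof -
  from assms(2) obtain i where "x $ i \<notin> {a $ i<..<b $ i}" by (auto simp: mem_box_cart)
  then show ?thesis unfolding bumpD_def
    using assms(1) by (intro prod_zero) (auto intro!: exI[of _ i] bump1_eq_0)
qed

lemma smooth_fun_bumpD: "smooth_fun (bumpD a b n c)"
  unfolding smooth_fun_def pdiffs_bumpD
  using bumpD_continuous bumpD_axis_derivative real_differentiable_def by blast

lemma test_fun_bumpD:
  assumes "\<forall>i. a $ i \<le> b $ i" "cbox a b \<subseteq> \<Omega>"
  shows "test_fun \<Omega> (bumpD a b n c)"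
proof -
  have "{x. bumpD a b n c x \<noteq> 0} \<subseteq> cbox a b"
    using bumpD_eq_0[OF assms(1)] box_subset_cbox by blast
  then have "closure {x. bumpD a b n c x \<noteq> 0} \<subseteq> cbox a b"
    by (simp add: closure_minimal closed_cbox)
  then show ?thesis unfolding test_fun_def
    using assms(2) smooth_fun_bumpD[of a b n c] bounded_subset[OF bounded_cbox]
    by (auto simp: compact_eq_bounded_closed)
qed

lemma bump_bounds: "0 \<le> bump a b n x" "bump a b n x \<le> 1"
  unfolding bumpD_def by (auto intro!: prod_nonneg prod_le_1 simp: bump1_0_bounds)

lemma bump_tendsto:
  assumes "\<forall>i. a $ i \<le> b $ i"
  shows "(\<lambda>n. bump a b n x) \<longlonglongrightarrow> indicator (box a b) x"
proof -
  have "(\<lambda>n. bump a b n x) \<longlonglongrightarrow> (\<Prod>i\<in>UNIV. indicator {a $ i<..<b $ i} (x $ i))"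
    unfolding bumpD_def using assms by (intro tendsto_prod bump1_0_tendsto) auto
  moreover have "(\<Prod>i\<in>UNIV. indicator {a $ i<..<b $ i} (x $ i)) = (indicator (box a b) x :: real)"
    by (auto simp: indicator_def mem_box_cart prod.If_cases intro!: prod_zero)
  ultimately show ?thesis by simp
qed

lemma bumpD_shift: "bumpD a b n c (x - w) = bumpD (a + w) (b + w) n c x"
  by (simp add: bumpD_def bump1_shift)

lemma bumpD_bounded:
  assumes "\<forall>i. a $ i \<le> b $ i"
  shows "\<exists>M. \<forall>x. \<bar>bumpD a b n c x\<bar> \<le> M"
proof -
  have "compact (bumpD a b n c ` cbox a b)"
    by (intro compact_continuous_image bumpD_continuous compact_cbox)
  then obtain M where M: "\<forall>x\<in>cbox a b. \<bar>bumpD a b n c x\<bar> \<le> M"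
    using compact_imp_bounded bounded_iff by (metis image_eqI real_norm_def)
  have "\<bar>bumpD a b n c x\<bar> \<le> max M 0" for x
  proof (cases "x \<in> cbox a b")
    case True
    then show ?thesis using M by (simp add: le_max_iff_disj)
  next
    case False
    then have "x \<notin> box a b" using box_subset_cbox[of a b] by blast
    then show ?thesis using bumpD_eq_0[OF assms, of x n c] by simp
  qed
  then show ?thesis by blast
qed

section \<open>The fundamental lemma of the calculus of variations\<close>

text \<open>Open boxes form an intersection-stable generator of the Borel sets, and the sets over
  which \<open>f\<close> integrates to 0 form a Dynkin system.\<close>

lemma AE_zero_if_box_integrals_zero:
  fixes f :: "'a::euclidean_space \<Rightarrow> real"
  assumes f: "integrable lborel f"
    and zero: "\<And>a b. (LINT x:box a b|lborel. f x) = 0"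
  shows "AE x in lborel. f x = 0"
proof (rule sigma_finite_measure.density_zero[OF sigma_finite_lborel f])
  have int: "set_integrable lborel A f" if "A \<in> sets borel" for A
    unfolding set_integrable_def using f that by (intro integrable_mult_indicator) auto
  \<comment> \<open>Closure under complements needs the whole space, which is exhausted by growing
    boxes.\<close>
  have all: "(\<integral>x. f x \<partial>lborel) = 0"
  proof -
    have "(\<lambda>n::nat. LINT x:box (- real n *\<^sub>R One) (real n *\<^sub>R One)|lborel. f x) \<longlonglongrightarrow> (\<integral>x. f x \<partial>lborel)"
      unfolding set_lebesgue_integral_def
    proof (rule integral_dominated_convergence[where w = "\<lambda>x. \<bar>f x\<bar>"])
      show "AE x in lborel. (\<lambda>n. indicat_real (box (- real n *\<^sub>R One) (real n *\<^sub>R One)) x *\<^sub>R f x) \<longlonglongrightarrow> f x"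
      proof (intro AE_I2)
        fix x :: 'a
        obtain N :: nat where N: "norm x < real N" using reals_Archimedean2 by blast
        have "x \<in> box (- real n *\<^sub>R One) (real n *\<^sub>R One)" if "n \<ge> N" for n
        proof -
          have "\<bar>x \<bullet> i\<bar> < real n" if "i \<in> Basis" for i
            using Basis_le_norm[OF that, of x] N \<open>n \<ge> N\<close> by simp
          then show ?thesis by (auto simp: mem_box abs_less_iff minus_less_iff)
        qed
        then have "\<forall>\<^sub>F n in sequentially. f x = indicat_real (box (- real n *\<^sub>R One) (real n *\<^sub>R One)) x *\<^sub>R f x"
          by (auto intro!: eventually_sequentiallyI[of N])
        then show "(\<lambda>n. indicat_real (box (- real n *\<^sub>R One) (real n *\<^sub>R One)) x *\<^sub>R f x) \<longlonglongrightarrow> f x"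
          by (rule Lim_transform_eventually[OF tendsto_const])
      qed
    qed (use f in \<open>auto simp: indicator_def\<close>)
    then show ?thesis using zero by (simp add: LIMSEQ_const_iff)
  qed
  fix A :: "'a set"
  assume "A \<in> sets lborel"
  then have A: "A \<in> sigma_sets UNIV (range (\<lambda>(a, b). box a b))"
    by (simp add: borel_eq_box)
  have stable: "Int_stable (range (\<lambda>(a, b). box a b :: 'a set))"
    by (auto simp: Int_stable_def box_Int_box)
  have sub: "range (\<lambda>(a, b). box a b :: 'a set) \<subseteq> Pow UNIV" by auto
  show "(LINT x:A|lborel. f x) = 0"
    using stable sub A
  proof (induction rule: sigma_sets_induct_disjoint)
    case (basic A)
    then show ?case using zero by auto
  next
    case empty
    then show ?case by (simp add: set_lebesgue_integral_def)
  next
    case (compl A)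
    then have A: "A \<in> sets borel" by (simp add: borel_eq_box)
    have "(LINT x:A|lborel. f x) + (LINT x:UNIV - A|lborel. f x) = (LINT x:A \<union> (UNIV - A)|lborel. f x)"
      using A by (intro set_integral_Un[symmetric] int) auto
    then show ?case using compl all by (simp add: set_lebesgue_integral_def)
  next
    case (union A)
    have A: "A i \<in> sets lborel" for i using union.hyps(2) by (auto simp: borel_eq_box)
    have "(LINT x:(\<Union>i. A i)|lborel. f x) = (\<Sum>i. LINT x:A i|lborel. f x)"
    proof (rule lebesgue_integral_countable_add[OF A _ int])
      show "A i \<inter> A j = {}" if "i \<noteq> j" for i j
        using union.hyps(1) that by (auto simp: disjoint_family_on_def)
      show "\<Union> (range A) \<in> sets borel" using A by auto
    qed
    then show ?case using union.IH by simp
  qed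
qed

lemma AE_not_in_cbox_minus_box: "AE x in lborel. x \<notin> cbox a b - box (a :: 'a::euclidean_space) b"
proof (rule AE_not_in)
  have "emeasure lborel (cbox a b - box a b) = emeasure lborel (cbox a b) - emeasure lborel (box a b)"
    by (intro emeasure_Diff) (auto simp: box_subset_cbox emeasure_lborel_box_eq)
  then show "cbox a b - box a b \<in> null_sets lborel"
    by (auto simp: null_sets_def emeasure_lborel_box_eq emeasure_lborel_cbox_eq)
qed

text \<open>Letting \<open>n\<close> grow turns integrals against bumps into integrals over boxes.
  The previous lemma is applied inside one closed box at a time, and an open set is a countable
  union of closed boxes, so the exceptional null sets add up to a null set.\<close>

lemma fundamental_lemma:
  fixes g :: "real^'n \<Rightarrow> real"
  assumes A: "open A" and g[measurable]: "g \<in> borel_measurable borel"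
    and int: "\<And>a b. cbox a b \<subseteq> A \<Longrightarrow> set_integrable lborel (cbox a b) g"
    and zero: "\<And>a b n. (\<forall>i. a $ i \<le> b $ i) \<Longrightarrow> cbox a b \<subseteq> A \<Longrightarrow> (\<integral>x. g x * bump a b n x \<partial>lborel) = 0"
  shows "AE x in lborel. x \<in> A \<longrightarrow> g x = 0"
proof -
  have box0: "(LINT x:box a b|lborel. g x) = 0" if ab: "cbox a b \<subseteq> A" for a b
  proof (cases "\<forall>i. a $ i \<le> b $ i")
    case False
    then have "box a b = {}" by (auto simp: interval_eq_empty_cart not_le intro: less_imp_le)
    then show ?thesis by (simp add: set_lebesgue_integral_def)
  next
    case True
    have "(\<lambda>n. \<integral>x. g x * bump a b n x \<partial>lborel) \<longlonglongrightarrow> (LINT x:box a b|lborel. g x)"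
      unfolding set_lebesgue_integral_def
    proof (rule integral_dominated_convergence[where w = "\<lambda>x. \<bar>indicator (cbox a b) x *\<^sub>R g x\<bar>"])
      show "AE x in lborel. (\<lambda>n. g x * bump a b n x) \<longlonglongrightarrow> indicat_real (box a b) x *\<^sub>R g x"
        using tendsto_mult[OF tendsto_const bump_tendsto[OF True]]
        by (auto simp: mult.commute)
      show "AE x in lborel. norm (g x * bump a b n x) \<le> \<bar>indicat_real (cbox a b) x *\<^sub>R g x\<bar>" for n
      proof (intro AE_I2)
        fix x
        show "norm (g x * bump a b n x) \<le> \<bar>indicat_real (cbox a b) x *\<^sub>R g x\<bar>"
        proof (cases "x \<in> cbox a b")
          case t: True
          then show ?thesis using bump_bounds[of a b n x] by (simp add: abs_mult mult_left_le)
        next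
          case False
          then have "x \<notin> box a b" using box_subset_cbox[of a b] by blast
          then show ?thesis using bumpD_eq_0[OF True] by simp
        qed
      qed
      show "integrable lborel (\<lambda>x. \<bar>indicat_real (cbox a b) x *\<^sub>R g x\<bar>)"
        using int[OF ab] by (simp add: set_integrable_def)
      show "(\<lambda>x. g x * bump a b n x) \<in> borel_measurable lborel" for n
        using borel_measurable_continuous_onI[OF bumpD_continuous] by measurable
    qed measurable
    then show ?thesis using zero[OF True ab] by (simp add: LIMSEQ_const_iff)
  qed
  have on_box: "AE x in lborel. x \<in> cbox a b \<longrightarrow> g x = 0" if ab: "cbox a b \<subseteq> A" for a b
  proof -
    have "set_integrable lborel (box a b) g"
      by (rule set_integrable_subset[OF int[OF ab]]) (auto simp: box_subset_cbox)
    moreover have "(LINT x:box c d|lborel. indicator (box a b) x *\<^sub>R g x) = 0" for c d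
    proof -
      obtain p q where pq: "box c d \<inter> box a b = box p q" by (simp add: box_Int_box)
      show ?thesis
      proof (cases "box p q = {}")
        case True
        then have "indicat_real (box c d) x *\<^sub>R indicat_real (box a b) x *\<^sub>R g x = 0" for x
          using pq by (auto simp: indicator_def)
        then show ?thesis unfolding set_lebesgue_integral_def by (simp only: integral_zero)
      next
        case False
        \<comment> \<open>The intersection must be nonempty here: only then is
          \<open>cbox p q\<close> the closure of \<open>box p q\<close>, whereas the corners of an
          empty box could span a degenerate closed box outside \<open>A\<close>.\<close>
        then have "cbox p q \<subseteq> closure (box c d \<inter> box a b)" by (simp add: pq closure_box)
        also have "\<dots> \<subseteq> cbox a b"
          by (meson Int_lower2 box_subset_cbox closed_cbox closure_minimal order_trans)
        finally have "cbox p q \<subseteq> A" using ab by blast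
        then have "(LINT x:box c d \<inter> box a b|lborel. g x) = 0" using box0 pq by simp
        then show ?thesis by (simp add: set_lebesgue_integral_def indicator_inter_arith mult.assoc)
      qed
    qed
    ultimately have "AE x in lborel. indicator (box a b) x *\<^sub>R g x = 0"
      by (intro AE_zero_if_box_integrals_zero) (auto simp: set_integrable_def)
    then show ?thesis using AE_not_in_cbox_minus_box[of a b]
      by eventually_elim (auto simp: indicator_def split: if_splits)
  qed
  obtain D where D: "countable D" "D \<subseteq> Pow A" "\<And>X. X \<in> D \<Longrightarrow> \<exists>a b. X = cbox a b" "\<Union> D = A"
    using open_countable_Union_open_cbox[OF A] by metis
  have "AE x in lborel. \<forall>X\<in>D. x \<in> X \<longrightarrow> g x = 0"
    using D on_box by (subst AE_ball_countable) (auto, metis Pow_iff subset_iff)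
  then show ?thesis using D(4) by (auto elim!: eventually_mono)
qed

section \<open>Translation estimates for weak gradients\<close>

lemma borel_measurable_vec_nth[measurable (raw)]:
  fixes g :: "'a \<Rightarrow> real^'n"
  assumes "g \<in> borel_measurable M"
  shows "(\<lambda>x. g x $ i) \<in> borel_measurable M"
  unfolding cart_eq_inner_axis using assms by measurable

lemma nn_integral_lborel_shift:
  fixes c :: "'a::euclidean_space"
  assumes "f \<in> borel_measurable borel"
  shows "(\<integral>\<^sup>+x. f (x + c) \<partial>lborel) = (\<integral>\<^sup>+x. f x \<partial>lborel)"
proof -
  have "(\<integral>\<^sup>+x. f x \<partial>lborel) = (\<integral>\<^sup>+x. f x \<partial>distr lborel borel ((+) c))"
    by (simp add: lborel_distr_plus)
  also have "\<dots> = (\<integral>\<^sup>+x. f (c + x) \<partial>lborel)"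
    using assms by (subst nn_integral_distr) auto
  finally show ?thesis by (simp add: add.commute)
qed

lemma integral_lborel_shift:
  fixes c :: "'a::euclidean_space" and f :: "'a \<Rightarrow> real"
  assumes "f \<in> borel_measurable borel"
  shows "(\<integral>x. f (x + c) \<partial>lborel) = (\<integral>x. f x \<partial>lborel)"
proof -
  have "(\<integral>x. f x \<partial>lborel) = (\<integral>x. f x \<partial>distr lborel borel ((+) c))"
    by (simp add: lborel_distr_plus)
  also have "\<dots> = (\<integral>x. f (c + x) \<partial>lborel)"
    using assms by (subst integral_distr) auto
  finally show ?thesis by (simp add: add.commute)
qed

lemma integrable_lborel_shift:
  fixes c :: "'a::euclidean_space" and f :: "'a \<Rightarrow> real"
  assumes "integrable lborel f"
  shows "integrable lborel (\<lambda>x. f (x + c))"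
proof -
  have "integrable (distr lborel borel ((+) c)) f" using assms by (simp add: lborel_distr_plus)
  then have "integrable lborel (\<lambda>x. f (c + x))"
    using assms by (subst (asm) integrable_distr_eq) auto
  then show ?thesis by (simp add: add.commute)
qed

lemma integrable_mult_of_squares:
  fixes f g :: "'a \<Rightarrow> real"
  assumes "f \<in> borel_measurable M" "g \<in> borel_measurable M"
    and "integrable M (\<lambda>x. (f x)^2)" "integrable M (\<lambda>x. (g x)^2)"
  shows "integrable M (\<lambda>x. f x * g x)"
proof (rule Bochner_Integration.integrable_bound)
  show "integrable M (\<lambda>x. (f x)^2 + (g x)^2)" using assms by simp
  have "\<bar>f x * g x\<bar> \<le> (f x)^2 + (g x)^2" for x
  proof -
    have "2 * (\<bar>f x\<bar> * \<bar>g x\<bar>) \<le> (f x)^2 + (g x)^2"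
      using sum_squares_bound[of "\<bar>f x\<bar>" "\<bar>g x\<bar>"] by (simp add: mult.assoc)
    moreover have "0 \<le> \<bar>f x\<bar> * \<bar>g x\<bar>" by simp
    ultimately show ?thesis unfolding abs_mult by linarith
  qed
  then show "AE x in M. norm (f x * g x) \<le> norm ((f x)^2 + (g x)^2)" by simp
qed (use assms in measurable)

lemma integrable_square_add:
  fixes f g :: "'a \<Rightarrow> real"
  assumes "f \<in> borel_measurable M" "g \<in> borel_measurable M"
    and "integrable M (\<lambda>x. (f x)^2)" "integrable M (\<lambda>x. (g x)^2)"
  shows "integrable M (\<lambda>x. (f x + g x)^2)"
  using assms integrable_mult_of_squares[OF assms] by (simp add: power2_sum mult.assoc)

text \<open>This supplies the hypothesis of Fubini for functions that are translated by
  \<open>s *\<^sub>R v\<close> while \<open>s\<close> runs through the unit interval. By translation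
  invariance the inner integral has a bound independent of \<open>s\<close>.\<close>

lemma shear_integrable:
  fixes w \<psi> :: "'a::euclidean_space \<Rightarrow> real"
  assumes w[measurable]: "w \<in> borel_measurable borel" "integrable lborel (\<lambda>x. (w x)^2)"
    and psi[measurable]: "\<psi> \<in> borel_measurable borel" "integrable lborel (\<lambda>x. (\<psi> x)^2)"
  shows "integrable (lborel \<Otimes>\<^sub>M lborel) (\<lambda>(s, x). indicator {0..1::real} s * (w x * \<psi> (x - s *\<^sub>R v)))"
proof (rule integrableI_bounded)
  let ?F = "\<lambda>(s, x). indicator {0..1::real} s * (w x * \<psi> (x - s *\<^sub>R v))"
  show meas: "?F \<in> borel_measurable (lborel \<Otimes>\<^sub>M lborel)" by measurable
  have inner: "(\<integral>\<^sup>+x. ennreal (norm (?F (s, x))) \<partial>lborel) \<le>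
     indicator {0..1} s * ((\<integral>\<^sup>+x. ennreal ((w x)^2) \<partial>lborel) + (\<integral>\<^sup>+x. ennreal ((\<psi> x)^2) \<partial>lborel))" for s
  proof -
    have "(\<integral>\<^sup>+x. ennreal (norm (?F (s, x))) \<partial>lborel) \<le>
       (\<integral>\<^sup>+x. indicator {0..1} s * (ennreal ((w x)^2) + ennreal ((\<psi> (x + - s *\<^sub>R v))^2)) \<partial>lborel)"
    proof (intro nn_integral_mono)
      fix x
      let ?a = "w x" and ?b = "\<psi> (x - s *\<^sub>R v)"
      have "2 * (\<bar>?a\<bar> * \<bar>?b\<bar>) \<le> ?a^2 + ?b^2"
        using sum_squares_bound[of "\<bar>?a\<bar>" "\<bar>?b\<bar>"] by (simp add: mult.assoc)
      moreover have "0 \<le> \<bar>?a\<bar> * \<bar>?b\<bar>" by simp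
      ultimately have "\<bar>?a * ?b\<bar> \<le> ?a^2 + ?b^2" unfolding abs_mult by linarith
      then show "ennreal (norm (?F (s, x))) \<le> indicator {0..1} s * (ennreal ((w x)^2) + ennreal ((\<psi> (x + - s *\<^sub>R v))^2))"
        by (auto simp: indicator_def ennreal_plus[symmetric] intro!: ennreal_leI simp del: ennreal_plus)
    qed
    also have "\<dots> = indicator {0..1} s * ((\<integral>\<^sup>+x. ennreal ((w x)^2) \<partial>lborel) + (\<integral>\<^sup>+x. ennreal ((\<psi> (x + - s *\<^sub>R v))^2) \<partial>lborel))"
      by (subst nn_integral_cmult) (auto simp: nn_integral_add)
    also have "(\<integral>\<^sup>+x. ennreal ((\<psi> (x + - s *\<^sub>R v))^2) \<partial>lborel) = (\<integral>\<^sup>+x. ennreal ((\<psi> x)^2) \<partial>lborel)"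
      by (rule nn_integral_lborel_shift[where f = "\<lambda>x. ennreal ((\<psi> x)^2)"]) measurable
    finally show ?thesis .
  qed
  have "(\<integral>\<^sup>+p. ennreal (norm (?F p)) \<partial>(lborel \<Otimes>\<^sub>M lborel)) =
    (\<integral>\<^sup>+s. \<integral>\<^sup>+x. ennreal (norm (?F (s, x))) \<partial>lborel \<partial>lborel)"
    by (rule lborel.nn_integral_fst[symmetric]) (use meas in measurable)
  also have "\<dots> \<le> (\<integral>\<^sup>+s. indicator {0..1::real} s * ((\<integral>\<^sup>+x. ennreal ((w x)^2) \<partial>lborel) + (\<integral>\<^sup>+x. ennreal ((\<psi> x)^2) \<partial>lborel)) \<partial>lborel)"
    by (intro nn_integral_mono inner)
  also have "\<dots> = ((\<integral>\<^sup>+x. ennreal ((w x)^2) \<partial>lborel) + (\<integral>\<^sup>+x. ennreal ((\<psi> x)^2) \<partial>lborel))"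
    by (subst nn_integral_multc) auto
  also have "\<dots> < \<infinity>"
    using w(2) psi(2) by (simp add: nn_integral_eq_integral)
  finally show "(\<integral>\<^sup>+p. ennreal (norm (?F p)) \<partial>(lborel \<Otimes>\<^sub>M lborel)) < \<infinity>" .
qed

text \<open>A function and its weak gradient, both given by Borel representatives; the defining identity
  is only required for product bump functions.\<close>
definition wpair :: "(real^'n) set \<Rightarrow> (real^'n \<Rightarrow> real) \<Rightarrow> (real^'n \<Rightarrow> real^'n) \<Rightarrow> bool" where
  "wpair \<Omega> u g \<longleftrightarrow> u \<in> borel_measurable borel \<and> g \<in> borel_measurable borel \<and>
     integrable lborel (\<lambda>x. (u x)^2) \<and> integrable lborel (\<lambda>x. (norm (g x))^2) \<and>
     (\<forall>a b n i. (\<forall>k. a $ k \<le> b $ k) \<longrightarrow> cbox a b \<subseteq> \<Omega> \<longrightarrow>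
        (\<integral>x. u x * bumpD a b n ((\<lambda>_. 0)(i := 1)) x \<partial>lborel) = - (\<integral>x. g x $ i * bump a b n x \<partial>lborel))"

lemma bumpD_measurable[measurable]: "bumpD a b n c \<in> borel_measurable borel"
  by (rule borel_measurable_continuous_onI[OF bumpD_continuous])

lemma bumpD_square_integrable:
  assumes "\<forall>i. a $ i \<le> b $ i"
  shows "integrable lborel (\<lambda>x. (bumpD a b n c x)^2)"
proof -
  obtain M where M: "\<And>x. \<bar>bumpD a b n c x\<bar> \<le> M" using bumpD_bounded[OF assms] by blast
  show ?thesis
  proof (rule Bochner_Integration.integrable_bound)
    show "integrable lborel (\<lambda>x. indicator (box a b) x * M^2)"
      by (intro integrable_mult_left) (auto simp: emeasure_lborel_box_eq)
    show "AE x in lborel. norm ((bumpD a b n c x)^2) \<le> norm (indicator (box a b) x * M^2)"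
    proof (intro AE_I2)
      fix x
      have "(bumpD a b n c x)^2 \<le> M^2" using M[of x] by (simp add: abs_le_square_iff[symmetric])
      then show "norm ((bumpD a b n c x)^2) \<le> norm (indicator (box a b) x * M^2)"
        using bumpD_eq_0[OF assms, of x n c] by (cases "x \<in> box a b") auto
    qed
  qed measurable
qed

text \<open>Both sides are tested against a bump supported in \<open>A\<close>. The translation is
  moved onto the bump, whose difference \<open>?\<phi> (x - v) - ?\<phi> x\<close> is an integral of
  directional derivatives. Fubini, the weak derivative identity for each translated bump, and
  translating back then yield the right-hand side. A translated bump is again a bump, so the
  restricted identity in \<open>wpair\<close> is enough.\<close>

lemma weak_difference_formula:
  fixes \<Omega> A :: "(real^'n) set"
  assumes wp: "wpair \<Omega> u g" and A: "open A"
    and seg: "\<And>x s. x \<in> A \<Longrightarrow> 0 \<le> s \<Longrightarrow> s \<le> 1 \<Longrightarrow> x + s *\<^sub>R v \<in> \<Omega>"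
  shows "AE x in lborel. x \<in> A \<longrightarrow>
     u (x + v) - u x = (\<integral>s. indicator {0..1::real} s * (v \<bullet> g (x + s *\<^sub>R v)) \<partial>lborel)"
proof -
  have u[measurable]: "u \<in> borel_measurable borel" and g[measurable]: "g \<in> borel_measurable borel"
    and u2: "integrable lborel (\<lambda>x. (u x)^2)" and g2: "integrable lborel (\<lambda>x. (norm (g x))^2)"
    using wp by (auto simp: wpair_def)
  define w where "w x = v \<bullet> g x" for x
  have w[measurable]: "w \<in> borel_measurable borel" unfolding w_def by measurable
  have w2: "integrable lborel (\<lambda>x. (w x)^2)"
  proof (rule Bochner_Integration.integrable_bound)
    show "integrable lborel (\<lambda>x. (norm v)^2 * (norm (g x))^2)" using g2 by simp
    have "(w x)^2 \<le> (norm v)^2 * (norm (g x))^2" for x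
      using Cauchy_Schwarz_ineq[of v "g x"] by (simp add: w_def power2_norm_eq_inner)
    then show "AE x in lborel. norm ((w x)^2) \<le> norm ((norm v)^2 * (norm (g x))^2)" by simp
  qed measurable
  have gi2: "integrable lborel (\<lambda>x. (g x $ i)^2)" for i
  proof (rule Bochner_Integration.integrable_bound[OF g2])
    have "(g x $ i)^2 \<le> (norm (g x))^2" for x
      using component_le_norm_cart[of "g x" i] by (simp add: abs_le_square_iff[symmetric])
    then show "AE x in lborel. norm ((g x $ i)^2) \<le> norm ((norm (g x))^2)" by simp
  qed measurable
  define G where "G x = (\<integral>s. indicator {0..1::real} s * w (x + s *\<^sub>R v) \<partial>lborel)" for x
  have G[measurable]: "G \<in> borel_measurable borel" unfolding G_def by measurable
  have pairw: "integrable (lborel \<Otimes>\<^sub>M lborel) (\<lambda>(s, x). indicator {0..1::real} s * (\<psi> x * w (x + s *\<^sub>R v)))"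
    if "\<psi> \<in> borel_measurable borel" "integrable lborel (\<lambda>x. (\<psi> x)^2)" for \<psi>
    using shear_integrable[OF that w w2, of "- v"] by simp
  have G_pull: "(\<integral>s. indicator {0..1::real} s * (c * w (x + s *\<^sub>R v)) \<partial>lborel) = c * G x" for c x
    unfolding G_def by (subst integral_mult_right_zero[symmetric]) (simp only: mult.left_commute)
  have intG: "integrable lborel (\<lambda>x. \<psi> x * G x)"
    if "\<psi> \<in> borel_measurable borel" "integrable lborel (\<lambda>x. (\<psi> x)^2)" for \<psi>
    using lborel_pair.integrable_snd[OF pairw[OF that]] by (simp only: G_pull)
  have "AE x in lborel. x \<in> A \<longrightarrow> u (x + v) - u x - G x = 0"
  proof (rule fundamental_lemma[OF A])
    show "(\<lambda>x. u (x + v) - u x - G x) \<in> borel_measurable borel" by measurable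
  next
    fix a b :: "real^'n"
    have "(indicat_real (cbox a b) x)^2 = indicat_real (cbox a b) x" for x by (simp add: indicator_def)
    then have i2: "integrable lborel (\<lambda>x. (indicat_real (cbox a b) x)^2)"
      by (simp add: emeasure_lborel_cbox_eq)
    show "set_integrable lborel (cbox a b) (\<lambda>x. u (x + v) - u x - G x)"
      unfolding set_integrable_def right_diff_distrib real_scaleR_def
      by (intro Bochner_Integration.integrable_diff integrable_mult_of_squares[OF _ _ i2] intG i2 u2
            integrable_lborel_shift[OF u2]) measurable
  next
    fix a b :: "real^'n" and n :: nat
    assume ab: "\<forall>i. a $ i \<le> b $ i" and sub: "cbox a b \<subseteq> A"
    let ?\<phi> = "bump a b n"
    let ?D = "\<lambda>i. bumpD a b n ((\<lambda>_. 0)(i := Suc 0))"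
    note b2 = bumpD_square_integrable[OF ab, of n]
    \<comment> \<open>This is where the segment hypothesis enters: the support of the translated
      bump stays inside \<open>\<Omega>\<close>, so \<open>wpair\<close> applies to it.\<close>
    have ibox: "cbox (a + s *\<^sub>R v) (b + s *\<^sub>R v) \<subseteq> \<Omega>" if "0 \<le> s" "s \<le> 1" for s
    proof
      fix x assume "x \<in> cbox (a + s *\<^sub>R v) (b + s *\<^sub>R v)"
      then have "x - s *\<^sub>R v \<in> cbox a b"
        by (auto simp: mem_box_cart algebra_simps)
      then show "x \<in> \<Omega>" using seg[of "x - s *\<^sub>R v" s] sub that by auto
    qed
    have ftc: "?\<phi> (x - v) - ?\<phi> x = (\<integral>s. indicator {0..1::real} s * (\<Sum>i\<in>UNIV. - v $ i * ?D i (x - s *\<^sub>R v)) \<partial>lborel)" for x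
    proof -
      have "(\<integral>s. indicator {0..1::real} s *\<^sub>R (\<Sum>i\<in>UNIV. (- v) $ i * ?D i (x + s *\<^sub>R (- v))) \<partial>lborel)
          = ?\<phi> (x + 1 *\<^sub>R (- v)) - ?\<phi> (x + 0 *\<^sub>R (- v))"
      proof (rule integral_FTC_atLeastAtMost)
        fix s :: real
        show "((\<lambda>s. ?\<phi> (x + s *\<^sub>R (- v))) has_vector_derivative (\<Sum>i\<in>UNIV. (- v) $ i * ?D i (x + s *\<^sub>R (- v)))) (at s within {0..1})"
          using bumpD_directional_derivative[of a b n "\<lambda>_. 0" x "- v" s]
          by (auto simp: has_real_derivative_iff_has_vector_derivative intro: has_vector_derivative_at_within)
      next
        show "continuous_on {0..1} (\<lambda>s. \<Sum>i\<in>UNIV. (- v) $ i * ?D i (x + s *\<^sub>R (- v)))"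
          by (intro continuous_intros continuous_on_compose2[OF bumpD_continuous[of UNIV]]) auto
      qed simp
      then show ?thesis by simp
    qed
    have intuD: "integrable (lborel \<Otimes>\<^sub>M lborel) (\<lambda>(s, x). indicator {0..1::real} s * (u x * ?D i (x - s *\<^sub>R v)))" for i
      by (intro shear_integrable u2 b2) measurable
    have intuS: "integrable (lborel \<Otimes>\<^sub>M lborel)
        (\<lambda>(s, x). u x * (indicator {0..1::real} s * (\<Sum>i\<in>UNIV. - v $ i * ?D i (x - s *\<^sub>R v))))"
    proof -
      have "integrable (lborel \<Otimes>\<^sub>M lborel) (\<lambda>p. \<Sum>i\<in>UNIV. - v $ i * (case p of (s, x) \<Rightarrow> indicator {0..1::real} s * (u x * ?D i (x - s *\<^sub>R v))))"
        by (intro Bochner_Integration.integrable_sum integrable_mult_right intuD)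
      then show ?thesis by (simp add: sum_distrib_left split_def mult.left_commute)
    qed
    have iuD: "integrable lborel (\<lambda>x. u x * ?D i (x - s *\<^sub>R v))" for i s
      unfolding bumpD_shift using ab by (intro integrable_mult_of_squares u2 bumpD_square_integrable) auto
    have igD: "integrable lborel (\<lambda>x. g x $ i * ?\<phi> (x - s *\<^sub>R v))" for i s
      unfolding bumpD_shift using ab by (intro integrable_mult_of_squares gi2 bumpD_square_integrable) auto
    have "(\<integral>x. u x * (?\<phi> (x - v) - ?\<phi> x) \<partial>lborel) =
      (\<integral>x. (\<integral>s. u x * (indicator {0..1::real} s * (\<Sum>i\<in>UNIV. - v $ i * ?D i (x - s *\<^sub>R v))) \<partial>lborel) \<partial>lborel)"
      unfolding ftc by simp
    also have "\<dots> = (\<integral>s. (\<integral>x. u x * (indicator {0..1::real} s * (\<Sum>i\<in>UNIV. - v $ i * ?D i (x - s *\<^sub>R v))) \<partial>lborel) \<partial>lborel)"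
      by (rule lborel_pair.Fubini_integral[OF intuS])
    also have "\<dots> = (\<integral>s. (\<integral>x. indicator {0..1::real} s * (?\<phi> x * w (x + s *\<^sub>R v)) \<partial>lborel) \<partial>lborel)"
    proof (rule Bochner_Integration.integral_cong[OF refl])
      fix s :: real
      show "(\<integral>x. u x * (indicator {0..1::real} s * (\<Sum>i\<in>UNIV. - v $ i * ?D i (x - s *\<^sub>R v))) \<partial>lborel)
         = (\<integral>x. indicator {0..1::real} s * (?\<phi> x * w (x + s *\<^sub>R v)) \<partial>lborel)"
      proof (cases "s \<in> {0..1}")
        case True
        have "(\<integral>x. u x * (indicator {0..1::real} s * (\<Sum>i\<in>UNIV. - v $ i * ?D i (x - s *\<^sub>R v))) \<partial>lborel)
          = (\<integral>x. (\<Sum>i\<in>UNIV. - v $ i * (u x * ?D i (x - s *\<^sub>R v))) \<partial>lborel)"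
          using True by (simp add: sum_distrib_left mult.left_commute)
        also have "\<dots> = (\<Sum>i\<in>UNIV. - v $ i * (\<integral>x. u x * ?D i (x - s *\<^sub>R v) \<partial>lborel))"
          using iuD by (subst Bochner_Integration.integral_sum) auto
        also have "\<dots> = (\<Sum>i\<in>UNIV. v $ i * (\<integral>x. g x $ i * ?\<phi> (x - s *\<^sub>R v) \<partial>lborel))"
        proof (rule sum.cong[OF refl])
          fix i
          have "(\<integral>x. u x * ?D i (x - s *\<^sub>R v) \<partial>lborel) = - (\<integral>x. g x $ i * ?\<phi> (x - s *\<^sub>R v) \<partial>lborel)"
            using wp ibox[of s] True ab unfolding bumpD_shift wpair_def by auto
          then show "- v $ i * (\<integral>x. u x * ?D i (x - s *\<^sub>R v) \<partial>lborel) = v $ i * (\<integral>x. g x $ i * ?\<phi> (x - s *\<^sub>R v) \<partial>lborel)"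
            by simp
        qed
        also have "\<dots> = (\<integral>x. (\<Sum>i\<in>UNIV. v $ i * (g x $ i * ?\<phi> (x - s *\<^sub>R v))) \<partial>lborel)"
          using igD by (subst Bochner_Integration.integral_sum) auto
        also have "\<dots> = (\<integral>x. ?\<phi> (x - s *\<^sub>R v) * w x \<partial>lborel)"
          by (simp add: w_def inner_vec_def sum_distrib_left mult.left_commute mult.commute[of _ "?\<phi> _"])
        \<comment> \<open>Translating back frees the bump from \<open>s\<close> and puts the
          dependence into the gradient.\<close>
        also have "\<dots> = (\<integral>x. ?\<phi> ((x + s *\<^sub>R v) - s *\<^sub>R v) * w (x + s *\<^sub>R v) \<partial>lborel)"
          by (rule integral_lborel_shift[symmetric]) measurable
        finally show ?thesis using True by simp
      qed simp
    qed
    also have "\<dots> = (\<integral>x. (\<integral>s. indicator {0..1::real} s * (?\<phi> x * w (x + s *\<^sub>R v)) \<partial>lborel) \<partial>lborel)"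
      by (rule lborel_pair.Fubini_integral[symmetric]) (rule pairw[OF bumpD_measurable b2])
    also have "\<dots> = (\<integral>x. ?\<phi> x * G x \<partial>lborel)"
      by (simp only: G_pull)
    finally have main: "(\<integral>x. u x * (?\<phi> (x - v) - ?\<phi> x) \<partial>lborel) = (\<integral>x. ?\<phi> x * G x \<partial>lborel)" .
    have i1: "integrable lborel (\<lambda>x. u (x + v) * ?\<phi> x)"
      by (intro integrable_mult_of_squares integrable_lborel_shift[OF u2] b2) measurable
    have i2: "integrable lborel (\<lambda>x. u x * ?\<phi> x)"
      by (intro integrable_mult_of_squares u2 b2) measurable
    have i3: "integrable lborel (\<lambda>x. u x * ?\<phi> (x - v))"
      unfolding bumpD_shift using ab by (intro integrable_mult_of_squares u2 bumpD_square_integrable) auto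
    have i4: "integrable lborel (\<lambda>x. ?\<phi> x * G x)" by (rule intG[OF bumpD_measurable b2])
    have "(\<integral>x. u (x + v) * ?\<phi> x \<partial>lborel) = (\<integral>x. u x * ?\<phi> (x - v) \<partial>lborel)"
      using integral_lborel_shift[of "\<lambda>x. u x * ?\<phi> (x - v)" v] by simp
    then show "(\<integral>x. (u (x + v) - u x - G x) * ?\<phi> x \<partial>lborel) = 0"
      using main i1 i2 i3 i4 by (simp add: left_diff_distrib right_diff_distrib mult.commute)
  qed
  then show ?thesis by (auto simp: G_def w_def elim!: eventually_mono)
qed

text \<open>Jensen's inequality for the square on an interval of length 1, read off from the
  nonnegativity of the variance. In \<open>ennreal\<close> the case of an infinite right-hand side
  is trivial, so no integrability has to be assumed.\<close>

lemma square_integral_le_unit_interval: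
  fixes f :: "real \<Rightarrow> real"
  assumes [measurable]: "f \<in> borel_measurable borel"
  shows "ennreal ((\<integral>s. indicator {0..1} s * f s \<partial>lborel)^2) \<le> (\<integral>\<^sup>+s. indicator {0..1} s * ennreal ((f s)^2) \<partial>lborel)"
proof (cases "(\<integral>\<^sup>+s. indicator {0..1} s * ennreal ((f s)^2) \<partial>lborel) = \<infinity>")
  case False
  let ?i = "\<lambda>s. indicator {0..1::real} s :: real"
  have eq: "indicator {0..1} s * ennreal ((f s)^2) = ennreal ((?i s * f s)^2)" for s
    by (auto simp: indicator_def)
  have sq: "integrable lborel (\<lambda>s. (?i s * f s)^2)"
    using False unfolding eq by (intro integrableI_nonneg) (auto simp: top.not_eq_extremum)
  have one: "integrable lborel (\<lambda>s. (?i s)^2)"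
    by (simp add: power2_eq_square flip: indicator_inter_arith)
  have "integrable lborel (\<lambda>s. ?i s * (?i s * f s))"
    by (intro integrable_mult_of_squares one sq) measurable
  then have i1: "integrable lborel (\<lambda>s. ?i s * f s)"
    by (simp add: mult.assoc[symmetric] flip: indicator_inter_arith)
  define m where "m = (\<integral>s. ?i s * f s \<partial>lborel)"
  have "0 \<le> (\<integral>s. (?i s * f s - m * ?i s)^2 \<partial>lborel)" by simp
  also have "(\<lambda>s. (?i s * f s - m * ?i s)^2) = (\<lambda>s. (?i s * f s)^2 - 2 * m * (?i s * f s) + m^2 * ?i s)"
    by (auto simp: indicator_def power2_eq_square algebra_simps)
  also have "(\<integral>s. (?i s * f s)^2 - 2 * m * (?i s * f s) + m^2 * ?i s \<partial>lborel)
     = (\<integral>s. (?i s * f s)^2 \<partial>lborel) - 2 * m * m + m^2"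
    using sq i1 by (simp add: m_def)
  finally have "m^2 \<le> (\<integral>s. (?i s * f s)^2 \<partial>lborel)" by (simp add: power2_eq_square)
  then have "ennreal (m^2) \<le> ennreal (\<integral>s. (?i s * f s)^2 \<partial>lborel)" by (rule ennreal_leI)
  also have "\<dots> = (\<integral>\<^sup>+s. indicator {0..1} s * ennreal ((f s)^2) \<partial>lborel)"
    unfolding eq using sq by (intro nn_integral_eq_integral[symmetric]) auto
  finally show ?thesis by (simp add: m_def)
qed simp

abbreviation energy :: "(real^'n \<Rightarrow> real^'n) \<Rightarrow> ennreal" where
  "energy g \<equiv> \<integral>\<^sup>+x. ennreal ((norm (g x))^2) \<partial>lborel"

text \<open>Jensen and Cauchy-Schwarz are applied to the difference formula. By translation
  invariance each value of \<open>s\<close> then contributes at most \<open>(norm v)^2\<close> times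
  the full energy.\<close>

lemma weak_translation_estimate:
  fixes \<Omega> A :: "(real^'n) set"
  assumes wp: "wpair \<Omega> u g" and A: "open A"
    and seg: "\<And>x s. x \<in> A \<Longrightarrow> 0 \<le> s \<Longrightarrow> s \<le> 1 \<Longrightarrow> x + s *\<^sub>R v \<in> \<Omega>"
  shows "(\<integral>\<^sup>+x. indicator A x * ennreal ((u (x + v) - u x)^2) \<partial>lborel)
    \<le> ennreal ((norm v)^2) * energy g"
proof -
  have g[measurable]: "g \<in> borel_measurable borel" using wp by (auto simp: wpair_def)
  have diff: "AE x in lborel. x \<in> A \<longrightarrow>
     u (x + v) - u x = (\<integral>s. indicator {0..1::real} s * (v \<bullet> g (x + s *\<^sub>R v)) \<partial>lborel)"
    by (rule weak_difference_formula[OF wp A]) (rule seg)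
  have "(\<integral>\<^sup>+x. indicator A x * ennreal ((u (x + v) - u x)^2) \<partial>lborel)
     \<le> (\<integral>\<^sup>+x. \<integral>\<^sup>+s. indicator {0..1::real} s * ennreal ((v \<bullet> g (x + s *\<^sub>R v))^2) \<partial>lborel \<partial>lborel)"
  proof (intro nn_integral_mono_AE)
    show "AE x in lborel. indicator A x * ennreal ((u (x + v) - u x)^2) \<le>
       (\<integral>\<^sup>+s. indicator {0..1::real} s * ennreal ((v \<bullet> g (x + s *\<^sub>R v))^2) \<partial>lborel)"
      using diff
    proof eventually_elim
      case (elim x)
      then show ?case
        using square_integral_le_unit_interval[of "\<lambda>s. v \<bullet> g (x + s *\<^sub>R v)"]
        by (cases "x \<in> A") auto
    qed
  qed
  also have "\<dots> = (\<integral>\<^sup>+s. \<integral>\<^sup>+x. indicator {0..1::real} s * ennreal ((v \<bullet> g (x + s *\<^sub>R v))^2) \<partial>lborel \<partial>lborel)"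
    by (rule lborel_pair.Fubini') measurable
  also have "\<dots> \<le> (\<integral>\<^sup>+s. indicator {0..1::real} s * (ennreal ((norm v)^2) * energy g) \<partial>lborel)"
  proof (intro nn_integral_mono)
    fix s :: real
    have "(\<integral>\<^sup>+x. indicator {0..1::real} s * ennreal ((v \<bullet> g (x + s *\<^sub>R v))^2) \<partial>lborel)
       \<le> (\<integral>\<^sup>+x. indicator {0..1::real} s * (ennreal ((norm v)^2) * ennreal ((norm (g (x + s *\<^sub>R v)))^2)) \<partial>lborel)"
    proof (intro nn_integral_mono mult_left_mono)
      fix x
      have "(v \<bullet> g (x + s *\<^sub>R v))^2 \<le> (norm v)^2 * (norm (g (x + s *\<^sub>R v)))^2"
        using Cauchy_Schwarz_ineq[of v "g (x + s *\<^sub>R v)"] by (simp add: power2_norm_eq_inner)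
      then show "ennreal ((v \<bullet> g (x + s *\<^sub>R v))^2) \<le> ennreal ((norm v)^2) * ennreal ((norm (g (x + s *\<^sub>R v)))^2)"
        by (simp add: ennreal_mult[symmetric] ennreal_leI)
    qed simp
    also have "\<dots> = indicator {0..1::real} s * (ennreal ((norm v)^2) * (\<integral>\<^sup>+x. ennreal ((norm (g (x + s *\<^sub>R v)))^2) \<partial>lborel))"
      by ((subst nn_integral_cmult, measurable)+)
    also have "(\<integral>\<^sup>+x. ennreal ((norm (g (x + s *\<^sub>R v)))^2) \<partial>lborel) = energy g"
      by (rule nn_integral_lborel_shift[where f = "\<lambda>x. ennreal ((norm (g x))^2)"]) measurable
    finally show "(\<integral>\<^sup>+x. indicator {0..1::real} s * ennreal ((v \<bullet> g (x + s *\<^sub>R v))^2) \<partial>lborel)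
       \<le> indicator {0..1::real} s * (ennreal ((norm v)^2) * energy g)" .
  qed
  also have "\<dots> = ennreal ((norm v)^2) * energy g"
    by (subst nn_integral_multc) auto
  finally show ?thesis .
qed

section \<open>The Poincare inequality on Lipschitz domains\<close>

text \<open>The deviation is measured on \<open>A\<close> only, the energy on the whole space. This
  asymmetry lets control travel from one piece of \<open>\<Omega>\<close> to another along segments
  that leave both. An arbitrary constant \<open>m\<close> in place of the mean avoids comparing
  means of different pieces.\<close>

definition poincare_set :: "(real^'n) set \<Rightarrow> (real^'n) set \<Rightarrow> bool" where
  "poincare_set \<Omega> A \<longleftrightarrow> (\<exists>K\<ge>0. \<forall>u g. wpair \<Omega> u g \<longrightarrow>
     (\<exists>m. (\<integral>\<^sup>+x. indicator A x * ennreal ((u x - m)^2) \<partial>lborel)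
        \<le> ennreal K * energy g))"

lemma wpair_grad_norm:
  assumes "wpair \<Omega> u g"
  obtains n where "n \<ge> 0" "energy g = ennreal n"
proof
  show "energy g = ennreal (\<integral>x. (norm (g x))^2 \<partial>lborel)"
    using assms by (intro nn_integral_eq_integral) (auto simp: wpair_def)
qed simp

lemma square_triangle: "ennreal ((a - c)^2) \<le> 2 * ennreal ((a - b)^2) + 2 * ennreal ((b - c)^2)"
proof -
  have "(a - c)^2 \<le> 2 * (a - b)^2 + 2 * (b - c)^2"
    using zero_le_power2[of "a - b - (b - c)"] by (simp add: power2_eq_square algebra_simps)
  then have "ennreal ((a - c)^2) \<le> ennreal (2 * (a - b)^2 + 2 * (b - c)^2)" by (rule ennreal_leI)
  then show ?thesis by (simp add: ennreal_mult)
qed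

text \<open>Replacing \<open>u x\<close> by \<open>u (x + v)\<close> costs a multiple of the energy
  by the translation estimate, and \<open>x + v\<close> runs through a part of \<open>B\<close>,
  where the deviation is already controlled.\<close>

lemma poincare_set_shift:
  assumes B: "poincare_set \<Omega> B" "open B" and A: "open A"
    and seg: "\<And>x s. x \<in> A \<Longrightarrow> 0 \<le> s \<Longrightarrow> s \<le> 1 \<Longrightarrow> x + s *\<^sub>R v \<in> \<Omega>"
    and AB: "\<And>x. x \<in> A \<Longrightarrow> x + v \<in> B"
  shows "poincare_set \<Omega> A"
proof -
  obtain K where K: "K \<ge> 0" "\<And>u g. wpair \<Omega> u g \<Longrightarrow> \<exists>m. (\<integral>\<^sup>+x. indicator B x * ennreal ((u x - m)^2) \<partial>lborel)
        \<le> ennreal K * energy g"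
    using B(1) unfolding poincare_set_def by blast
  show ?thesis unfolding poincare_set_def
  proof (rule exI[of _ "2 * (norm v)^2 + 2 * K"], intro conjI allI impI)
    show "0 \<le> 2 * (norm v)^2 + 2 * K" using K by simp
    fix u g assume wp: "wpair \<Omega> u g"
    have u[measurable]: "u \<in> borel_measurable borel" using wp by (simp add: wpair_def)
    have [measurable]: "A \<in> sets borel" "B \<in> sets borel" using A B by auto
    let ?N = "energy g"
    obtain m where m: "(\<integral>\<^sup>+x. indicator B x * ennreal ((u x - m)^2) \<partial>lborel) \<le> ennreal K * ?N"
      using K(2)[OF wp] by blast
    have "(\<integral>\<^sup>+x. indicator A x * ennreal ((u x - m)^2) \<partial>lborel) \<le>
       (\<integral>\<^sup>+x. 2 * (indicator A x * ennreal ((u (x + v) - u x)^2)) + 2 * (indicator B (x + v) * ennreal ((u (x + v) - m)^2)) \<partial>lborel)"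
    proof (intro nn_integral_mono)
      fix x
      show "indicator A x * ennreal ((u x - m)^2) \<le> 2 * (indicator A x * ennreal ((u (x + v) - u x)^2)) + 2 * (indicator B (x + v) * ennreal ((u (x + v) - m)^2))"
        using square_triangle[of "u x" m "u (x + v)"] AB[of x] by (cases "x \<in> A") (auto simp: power2_commute)
    qed
    also have "\<dots> = 2 * (\<integral>\<^sup>+x. indicator A x * ennreal ((u (x + v) - u x)^2) \<partial>lborel) + 2 * (\<integral>\<^sup>+x. indicator B (x + v) * ennreal ((u (x + v) - m)^2) \<partial>lborel)"
      by (subst nn_integral_add) (auto simp: nn_integral_cmult)
    also have "(\<integral>\<^sup>+x. indicator B (x + v) * ennreal ((u (x + v) - m)^2) \<partial>lborel) = (\<integral>\<^sup>+x. indicator B x * ennreal ((u x - m)^2) \<partial>lborel)"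
      by (rule nn_integral_lborel_shift) measurable
    also have "2 * (\<integral>\<^sup>+x. indicator A x * ennreal ((u (x + v) - u x)^2) \<partial>lborel) + 2 * \<dots>
       \<le> 2 * (ennreal ((norm v)^2) * ?N) + 2 * (ennreal K * ?N)"
      using weak_translation_estimate[OF wp A, of v] seg m by (intro add_mono mult_left_mono) auto
    also have "\<dots> = ennreal (2 * (norm v)^2 + 2 * K) * ?N"
      using K by (simp add: ennreal_plus ennreal_mult distrib_right mult.assoc)
    finally show "\<exists>m. (\<integral>\<^sup>+x. indicator A x * ennreal ((u x - m)^2) \<partial>lborel) \<le> ennreal (2 * (norm v)^2 + 2 * K) * ?N"
      by blast
  qed
qed

section \<open>The inequality on convex sets and on unions\<close>

lemma emeasure_bounded_open:
  fixes B :: "'a::euclidean_space set"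
  assumes "open B" "bounded B" "B \<noteq> {}"
  obtains \<beta> where "\<beta> > 0" "emeasure lborel B = ennreal \<beta>"
proof
  have fin: "emeasure lborel B < \<infinity>" using assms(2) by (rule emeasure_bounded_finite)
  have "emeasure lborel B \<noteq> 0"
    using assms open_not_negligible[of B] by (auto simp: negligible_iff_null_sets null_sets_def)
  then show "measure lborel B > 0" using fin by (simp add: measure_def enn2real_positive_iff zero_less_iff_neq_zero)
  show "emeasure lborel B = ennreal (measure lborel B)"
    using fin by (simp add: emeasure_eq_ennreal_measure top.not_eq_extremum)
qed

text \<open>A function cannot exceed its average everywhere. In the convex case this selects a point
  whose value of \<open>u\<close> serves as the constant \<open>m\<close>.\<close>

lemma exists_le_average:
  assumes B[measurable]: "B \<in> sets M" and pos: "emeasure M B \<noteq> 0" "emeasure M B \<noteq> \<infinity>"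
    and f[measurable]: "f \<in> borel_measurable M" and c: "c \<noteq> \<infinity>"
    and le: "(\<integral>\<^sup>+x. indicator B x * f x \<partial>M) \<le> c * emeasure M B"
  shows "\<exists>x\<in>B. f x \<le> c"
proof (rule ccontr)
  assume neg: "\<not> ?thesis"
  have cB: "(\<integral>\<^sup>+x. c * indicator B x \<partial>M) = c * emeasure M B" by (simp add: nn_integral_cmult)
  have "(\<integral>\<^sup>+x. c * indicator B x \<partial>M) < (\<integral>\<^sup>+x. indicator B x * f x \<partial>M)"
  proof (rule nn_integral_less)
    show "(\<integral>\<^sup>+x. c * indicator B x \<partial>M) \<noteq> \<infinity>"
      unfolding cB using c pos by (simp add: ennreal_mult_eq_top_iff)
    show "AE x in M. c * indicator B x \<le> indicator B x * f x"
      using neg by (auto simp: indicator_def not_le intro!: AE_I2 less_imp_le)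
    show "\<not> (AE x in M. indicator B x * f x \<le> c * indicator B x)"
    proof
      assume "AE x in M. indicator B x * f x \<le> c * indicator B x"
      then have "AE x in M. x \<notin> B"
        using neg by (auto simp: indicator_def split: if_splits elim!: eventually_mono)
      then show False using pos AE_iff_null_sets[OF B] by (simp add: null_sets_def)
    qed
  qed measurable
  then show False using le cB by simp
qed

text \<open>The squared difference \<open>(u y - u x)^2\<close> is integrated over all pairs of
  points of \<open>B\<close> and the pairs are reordered by \<open>h = y - x\<close>. For fixed
  \<open>h\<close> the translation estimate applies, because convexity keeps the segment from
  \<open>x\<close> to \<open>x + h\<close> in \<open>B\<close>. Some \<open>x\<close> is then no
  worse than average.\<close>

lemma poincare_set_convex:
  fixes B \<Omega> :: "(real^'n) set"
  assumes B: "open B" "convex B" "bounded B" "B \<subseteq> \<Omega>"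
  shows "poincare_set \<Omega> B"
proof (cases "B = {}")
  case True
  then show ?thesis unfolding poincare_set_def by (intro exI[of _ 0]) auto
next
  case False
  obtain \<beta> where \<beta>: "\<beta> > 0" "emeasure lborel B = ennreal \<beta>"
    using emeasure_bounded_open[OF B(1,3) False] .
  define R where "R = diameter B"
  have R: "norm (x - y) \<le> R" if "x \<in> B" "y \<in> B" for x y
    using diameter_bounded_bound[OF B(3) that] by (simp add: R_def dist_norm)
  have R0: "R \<ge> 0" using diameter_ge_0[OF B(3)] by (simp add: R_def)
  define V where "V = measure lborel (cball (0::real^'n) R)"
  have V: "emeasure lborel (cball (0::real^'n) R) = ennreal V"
    unfolding V_def using emeasure_lborel_cball_finite[of "0::real^'n" R]
    by (simp add: emeasure_eq_ennreal_measure top.not_eq_extremum)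
  have V0: "V \<ge> 0" by (simp add: V_def)
  show ?thesis unfolding poincare_set_def
  \<comment> \<open>Each displacement costs at most \<open>R^2\<close> times the energy, the
    admissible displacements fill at most a ball of volume \<open>V\<close>, and averaging over
    \<open>x\<close> divides by the volume \<open>\<beta>\<close> of \<open>B\<close>.\<close>
  proof (rule exI[of _ "R^2 * V / \<beta>"], intro conjI allI impI)
    show "0 \<le> R^2 * V / \<beta>" using \<beta> V0 by simp
    fix u g assume wp: "wpair \<Omega> u g"
    have u[measurable]: "u \<in> borel_measurable borel" using wp by (simp add: wpair_def)
    have [measurable]: "B \<in> sets borel" using B by auto
    obtain n where n: "n \<ge> 0" "energy g = ennreal n"
      using wpair_grad_norm[OF wp] .
    define f where "f x = (\<integral>\<^sup>+y. indicator B y * ennreal ((u y - u x)^2) \<partial>lborel)" for x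
    have f[measurable]: "f \<in> borel_measurable borel" unfolding f_def by measurable
    have "(\<integral>\<^sup>+x. indicator B x * f x \<partial>lborel) =
       (\<integral>\<^sup>+x. \<integral>\<^sup>+h. indicator B x * (indicator B (h + x) * ennreal ((u (h + x) - u x)^2)) \<partial>lborel \<partial>lborel)"
    proof (rule nn_integral_cong)
      fix x
      have "f x = (\<integral>\<^sup>+h. indicator B (h + x) * ennreal ((u (h + x) - u x)^2) \<partial>lborel)"
        unfolding f_def by (rule nn_integral_lborel_shift[symmetric]) measurable
      then show "indicator B x * f x = (\<integral>\<^sup>+h. indicator B x * (indicator B (h + x) * ennreal ((u (h + x) - u x)^2)) \<partial>lborel)"
        by (simp add: nn_integral_cmult)
    qed
    also have "\<dots> = (\<integral>\<^sup>+h. \<integral>\<^sup>+x. indicator B x * (indicator B (h + x) * ennreal ((u (h + x) - u x)^2)) \<partial>lborel \<partial>lborel)"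
      by (rule lborel_pair.Fubini') measurable
    also have "\<dots> \<le> (\<integral>\<^sup>+h. (ennreal (R^2) * ennreal n) * indicator (cball (0::real^'n) R) h \<partial>lborel)"
    proof (intro nn_integral_mono)
      fix h :: "real^'n"
      \<comment> \<open>These are the starting points for which the displacement \<open>h\<close>
        stays in \<open>B\<close>. If there are none, \<open>h\<close> contributes nothing;
        otherwise \<open>h\<close> is no longer than the diameter.\<close>
      define A where "A = B \<inter> (\<lambda>x. x + h) -` B"
      have A: "open A" unfolding A_def using B(1)
        by (intro open_Int continuous_open_vimage) (auto intro!: continuous_intros)
      have eq: "(\<integral>\<^sup>+x. indicator B x * (indicator B (h + x) * ennreal ((u (h + x) - u x)^2)) \<partial>lborel)
        = (\<integral>\<^sup>+x. indicator A x * ennreal ((u (x + h) - u x)^2) \<partial>lborel)"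
        by (intro nn_integral_cong) (auto simp: A_def indicator_def add.commute)
      show "(\<integral>\<^sup>+x. indicator B x * (indicator B (h + x) * ennreal ((u (h + x) - u x)^2)) \<partial>lborel)
         \<le> (ennreal (R^2) * ennreal n) * indicator (cball 0 R) h"
      proof (cases "A = {}")
        case True
        then show ?thesis unfolding eq by simp
      next
        case False
        then obtain x where "x \<in> B" "x + h \<in> B" by (auto simp: A_def)
        then have h: "norm h \<le> R" using R[of "x + h" x] by simp
        have "(\<integral>\<^sup>+x. indicator A x * ennreal ((u (x + h) - u x)^2) \<partial>lborel) \<le> ennreal ((norm h)^2) * ennreal n"
          unfolding n(2)[symmetric]
        proof (rule weak_translation_estimate[OF wp A])
          fix x s assume x: "x \<in> A" "0 \<le> (s::real)" "s \<le> 1"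
          have "(1 - s) *\<^sub>R x + s *\<^sub>R (x + h) \<in> B"
            using x B(2) by (intro convexD_alt) (auto simp: A_def)
          then show "x + s *\<^sub>R h \<in> \<Omega>" using B(4) by (auto simp: algebra_simps)
        qed
        also have "\<dots> \<le> ennreal (R^2) * ennreal n"
          using h by (intro mult_right_mono ennreal_leI power_mono) auto
        finally show ?thesis unfolding eq using h by simp
      qed
    qed
    also have "\<dots> = ennreal (R^2) * ennreal n * ennreal V"
      by (subst nn_integral_cmult_indicator) (auto simp: V)
    also have "\<dots> = (ennreal (R^2 * V / \<beta>) * ennreal n) * emeasure lborel B"
      using n V0 \<beta> by (simp add: ennreal_mult[symmetric])
    finally have "\<exists>x\<in>B. f x \<le> ennreal (R^2 * V / \<beta>) * ennreal n"
      using \<beta> by (intro exists_le_average[of _ lborel]) (auto simp: ennreal_mult_eq_top_iff)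
    then show "\<exists>m. (\<integral>\<^sup>+x. indicator B x * ennreal ((u x - m)^2) \<partial>lborel)
        \<le> ennreal (R^2 * V / \<beta>) * energy g"
      unfolding n(2) f_def by blast
  qed
qed

text \<open>On the overlap, which has positive measure, \<open>u\<close> is close to the constant
  \<open>p\<close> of \<open>A\<close> and to the constant \<open>q\<close> of \<open>B\<close>.
  Hence \<open>p\<close> and \<open>q\<close> are close to each other, and \<open>p\<close> serves
  on \<open>B\<close> as well.\<close>

lemma poincare_set_Un:
  assumes A: "poincare_set \<Omega> A" "open A" "bounded A" and B: "poincare_set \<Omega> B" "open B" "bounded B"
    and AB: "A \<inter> B \<noteq> {}"
  shows "poincare_set \<Omega> (A \<union> B)"
proof -
  obtain K where K: "K \<ge> 0" "\<And>u g. wpair \<Omega> u g \<Longrightarrow> \<exists>m. (\<integral>\<^sup>+x. indicator A x * ennreal ((u x - m)^2) \<partial>lborel)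
        \<le> ennreal K * energy g"
    using A(1) unfolding poincare_set_def by blast
  obtain L where L: "L \<ge> 0" "\<And>u g. wpair \<Omega> u g \<Longrightarrow> \<exists>m. (\<integral>\<^sup>+x. indicator B x * ennreal ((u x - m)^2) \<partial>lborel)
        \<le> ennreal L * energy g"
    using B(1) unfolding poincare_set_def by blast
  obtain \<alpha> where \<alpha>: "\<alpha> > 0" "emeasure lborel (A \<inter> B) = ennreal \<alpha>"
    using emeasure_bounded_open[of "A \<inter> B"] A B AB by (metis bounded_Int open_Int)
  obtain \<beta> where \<beta>: "\<beta> > 0" "emeasure lborel B = ennreal \<beta>"
    using emeasure_bounded_open[of B] B AB by auto
  \<comment> \<open>Chosen so that \<open>M\<close> times the energy bounds
    \<open>(p - q)^2\<close>: the overlap estimate with factor \<open>2 * (K + L)\<close>, divided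
    by the measure of the overlap. Replacing \<open>q\<close> by \<open>p\<close> on
    \<open>B\<close> then costs \<open>2 * \<beta> * M\<close>.\<close>
  define M where "M = 2 * (K + L) / \<alpha>"
  have M0: "M \<ge> 0" using K L \<alpha> by (simp add: M_def)
  show ?thesis unfolding poincare_set_def
  proof (rule exI[of _ "K + 2 * L + 2 * \<beta> * M"], intro conjI allI impI)
    show "0 \<le> K + 2 * L + 2 * \<beta> * M" using K L \<beta> M0 by simp
    fix u g assume wp: "wpair \<Omega> u g"
    have u[measurable]: "u \<in> borel_measurable borel" using wp by (simp add: wpair_def)
    have [measurable]: "A \<in> sets borel" "B \<in> sets borel" using A B by auto
    obtain n where n: "n \<ge> 0" "energy g = ennreal n"
      using wpair_grad_norm[OF wp] .
    obtain p where p: "(\<integral>\<^sup>+x. indicator A x * ennreal ((u x - p)^2) \<partial>lborel) \<le> ennreal K * ennreal n"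
      using K(2)[OF wp] n(2) by auto
    obtain q where q: "(\<integral>\<^sup>+x. indicator B x * ennreal ((u x - q)^2) \<partial>lborel) \<le> ennreal L * ennreal n"
      using L(2)[OF wp] n(2) by auto
    have "ennreal ((p - q)^2) * emeasure lborel (A \<inter> B) = (\<integral>\<^sup>+x. ennreal ((p - q)^2) * indicator (A \<inter> B) x \<partial>lborel)"
      by (simp add: nn_integral_cmult_indicator)
    also have "\<dots> \<le> (\<integral>\<^sup>+x. 2 * (indicator A x * ennreal ((u x - p)^2)) + 2 * (indicator B x * ennreal ((u x - q)^2)) \<partial>lborel)"
      using square_triangle[of p q] by (intro nn_integral_mono) (auto simp: indicator_def power2_commute[of p])
    also have "\<dots> = 2 * (\<integral>\<^sup>+x. indicator A x * ennreal ((u x - p)^2) \<partial>lborel) + 2 * (\<integral>\<^sup>+x. indicator B x * ennreal ((u x - q)^2) \<partial>lborel)"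
      by (subst nn_integral_add) (auto simp: nn_integral_cmult)
    also have "\<dots> \<le> 2 * (ennreal K * ennreal n) + 2 * (ennreal L * ennreal n)"
      using p q by (intro add_mono mult_left_mono) auto
    also have "\<dots> = ennreal (2 * (K * n) + 2 * (L * n))"
      using K L n by (simp add: ennreal_mult)
    finally have "ennreal ((p - q)^2 * \<alpha>) \<le> ennreal (2 * (K * n) + 2 * (L * n))"
      using \<alpha> by (simp add: ennreal_mult)
    then have "(p - q)^2 * \<alpha> \<le> 2 * (K * n) + 2 * (L * n)"
      by (subst (asm) ennreal_le_iff) (use K L n in auto)
    then have pq: "(p - q)^2 \<le> M * n" using \<alpha> by (simp add: M_def field_simps)
    have "(\<integral>\<^sup>+x. indicator (A \<union> B) x * ennreal ((u x - p)^2) \<partial>lborel) \<le>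
      (\<integral>\<^sup>+x. indicator A x * ennreal ((u x - p)^2) + (2 * (indicator B x * ennreal ((u x - q)^2)) + 2 * (ennreal (M * n) * indicator B x)) \<partial>lborel)"
    proof (intro nn_integral_mono)
      fix x
      have "ennreal ((u x - p)^2) \<le> 2 * ennreal ((u x - q)^2) + 2 * ennreal ((q - p)^2)"
        by (rule square_triangle)
      also have "\<dots> \<le> 2 * ennreal ((u x - q)^2) + 2 * ennreal (M * n)"
        using pq by (intro add_mono mult_left_mono ennreal_leI) (auto simp: power2_commute)
      finally show "indicator (A \<union> B) x * ennreal ((u x - p)^2) \<le>
         indicator A x * ennreal ((u x - p)^2) + (2 * (indicator B x * ennreal ((u x - q)^2)) + 2 * (ennreal (M * n) * indicator B x))"
        by (auto simp: indicator_def)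
    qed
    also have "\<dots> = (\<integral>\<^sup>+x. indicator A x * ennreal ((u x - p)^2) \<partial>lborel) +
       (2 * (\<integral>\<^sup>+x. indicator B x * ennreal ((u x - q)^2) \<partial>lborel) + 2 * (ennreal (M * n) * ennreal \<beta>))"
      by (simp add: nn_integral_add nn_integral_cmult \<beta>)
    also have "\<dots> \<le> ennreal K * ennreal n + (2 * (ennreal L * ennreal n) + 2 * (ennreal (M * n) * ennreal \<beta>))"
      using p q by (intro add_mono mult_left_mono) auto
    also have "\<dots> = ennreal (K * n + (2 * (L * n) + 2 * ((M * n) * \<beta>)))"
      using K L n M0 \<beta> by (simp add: ennreal_mult)
    also have "\<dots> = ennreal (K + 2 * L + 2 * \<beta> * M) * ennreal n"
      using K L n M0 \<beta> by (subst ennreal_mult[symmetric]) (auto simp: algebra_simps)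
    finally show "\<exists>m. (\<integral>\<^sup>+x. indicator (A \<union> B) x * ennreal ((u x - m)^2) \<partial>lborel)
        \<le> ennreal (K + 2 * L + 2 * \<beta> * M) * energy g"
      unfolding n(2) by blast
  qed
qed

text \<open>A piece that met no other one would disconnect the union. So some pair overlaps, and
  merging it lowers the number of pieces.\<close>

lemma poincare_set_finite_Union:
  assumes "finite F" "F \<noteq> {}"
    and "\<And>X. X \<in> F \<Longrightarrow> open X \<and> X \<noteq> {} \<and> bounded X \<and> poincare_set \<Omega> X"
    and "connected (\<Union>F)"
  shows "poincare_set \<Omega> (\<Union>F)"
  using assms
proof (induction "card F" arbitrary: F rule: less_induct)
  case less
  obtain X where X: "X \<in> F" using less.prems by blast
  show ?case
  proof (cases "F = {X}")
    case True
    then show ?thesis using less.prems(3)[OF X] by simp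
  next
    case False
    have "X \<inter> \<Union>(F - {X}) \<noteq> {}"
    proof
      assume e: "X \<inter> \<Union>(F - {X}) = {}"
      have "open (\<Union>(F - {X}))" using less.prems(3) by (intro open_Union) auto
      moreover have "\<Union>F \<subseteq> X \<union> \<Union>(F - {X})" by auto
      moreover have "\<Union>(F - {X}) \<inter> \<Union>F \<noteq> {}" "X \<inter> \<Union>F \<noteq> {}"
        using False X less.prems(3) by auto
      ultimately show False using connectedD[OF less.prems(4), of X "\<Union>(F - {X})"] e X less.prems(3)[OF X] by blast
    qed
    then obtain Y where Y: "Y \<in> F" "Y \<noteq> X" "X \<inter> Y \<noteq> {}" by auto
    define F' where "F' = insert (X \<union> Y) (F - {X, Y})"
    have U: "\<Union>F' = \<Union>F" using X Y by (auto simp: F'_def)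
    \<comment> \<open>Only an inequality, since \<open>X \<union> Y\<close> may already be a member
      of \<open>F\<close>; two sets are removed and at most one is added.\<close>
    have "card F' \<le> Suc (card (F - {X, Y}))" using less.prems(1) by (simp add: F'_def card_insert_if)
    also have "\<dots> < card F"
    proof -
      have "card {X, Y} \<le> card F" using X Y less.prems(1) by (intro card_mono) auto
      then show ?thesis using X Y less.prems(1) by (simp add: card_Diff_subset)
    qed
    finally have "card F' < card F" .
    moreover have "poincare_set \<Omega> (X \<union> Y)"
      using less.prems(3)[OF X] less.prems(3)[OF Y(1)] Y(3) by (intro poincare_set_Un) auto
    ultimately have "poincare_set \<Omega> (\<Union>F')"
      using less.prems X Y U by (intro less.hyps) (auto simp: F'_def)
    then show ?thesis using U by simp
  qed
qed

text \<open>The layer of thickness \<open>a\<close> just below the graph is not convex. Moved by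
  \<open>a\<close> along the graph axis, away from the graph, it lands in the cylinder
  \<open>B\<close>, which lies strictly below the graph and is convex. The path stays in
  \<open>\<Omega>\<close> because the height of the graph does not change along the axis, and the
  Lipschitz bound makes the graph nearly flat over a base of small radius
  \<open>\<delta>\<close>.\<close>

lemma poincare_set_boundary:
  fixes \<Omega> :: "(real^'n) set"
  assumes dom: "lipschitz_domain \<Omega>" and x: "x \<in> frontier \<Omega>"
  shows "\<exists>N. open N \<and> x \<in> N \<and> poincare_set \<Omega> (N \<inter> \<Omega>)"
proof -
  have op: "open \<Omega>" using dom by (simp add: lipschitz_domain_def)
  obtain r Q j \<gamma> L where r: "r > 0" and Q: "orthogonal_transformation Q" and lip: "L-lipschitz_on UNIV (\<gamma> :: real^'n \<Rightarrow> real)"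
    and dep: "\<And>z. \<gamma> z = \<gamma> (\<chi> i. if i = j then 0 else z $ i)"
    and loc: "\<Omega> \<inter> ball x r = {y \<in> ball x r. Q (y - x) $ j < \<gamma> (Q (y - x))}"
    using dom x unfolding lipschitz_domain_def by blast
  define e :: "real^'n" where "e = axis j 1"
  define P where "P z = z - (z $ j) *\<^sub>R e" for z :: "real^'n"
  define z where "z y = Q (y - x)" for y
  have L0: "L \<ge> 0" using lip lipschitz_on_nonneg by blast
  have linQ: "linear Q" using Q by (simp add: orthogonal_transformation_linear)
  have nz: "norm (z y) = dist x y" for y
    using Q by (simp add: z_def orthogonal_transformation_norm dist_norm norm_minus_commute)
  have contz: "continuous_on UNIV z"
    unfolding z_def by (intro continuous_on_compose2[OF linear_continuous_on[OF linear_conv_bounded_linear[THEN iffD1, OF linQ], of UNIV]] continuous_intros) auto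
  have contg: "continuous_on UNIV \<gamma>" using lip by (rule lipschitz_on_continuous_on)
  have contgz: "continuous_on UNIV (\<lambda>y. \<gamma> (z y))"
    by (rule continuous_on_compose2[OF contg contz]) auto
  have contP: "continuous_on UNIV (\<lambda>y. P (z y))"
    unfolding P_def by (intro continuous_intros contz)
  have e_j: "e $ j = 1" and norme: "norm e = 1" by (auto simp: e_def)
  have Pe: "P (y - c *\<^sub>R e) = P y" for y c by (simp add: P_def e_j algebra_simps)
  have \<gamma>P: "\<gamma> y = \<gamma> (P y)" for y
  proof -
    have "(\<chi> i. if i = j then 0 else y $ i) = P y"
      by (auto simp: P_def e_def vec_eq_iff axis_def)
    then show ?thesis using dep[of y] by simp
  qed
  have below: "y \<in> \<Omega> \<longleftrightarrow> z y $ j < \<gamma> (z y)" if "norm (z y) < r" for y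
  proof -
    have "y \<in> ball x r" using that by (simp add: nz)
    moreover have "y \<in> \<Omega> \<inter> ball x r \<longleftrightarrow> y \<in> {y \<in> ball x r. Q (y - x) $ j < \<gamma> (Q (y - x))}"
      by (simp only: loc)
    ultimately show ?thesis unfolding z_def by blast
  qed
  have zx: "z x = 0" using linQ by (simp add: z_def linear_0)
  have "x \<notin> \<Omega>" using x op by (simp add: frontier_def interior_open)
  then have "\<gamma> 0 \<le> 0" using below[of x] zx r by simp
  \<comment> \<open>Otherwise a neighbourhood of \<open>x\<close> would lie above the graph and miss
    \<open>\<Omega>\<close>, although \<open>x\<close> is in its closure.\<close>
  moreover have "\<not> \<gamma> 0 < 0"
  proof
    assume neg: "\<gamma> 0 < 0"
    define W where "W = {y. \<gamma> (z y) < z y $ j} \<inter> ball x r"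
    have "open W" unfolding W_def by (intro open_Int open_Collect_less contgz continuous_intros contz) auto
    moreover have "x \<in> W" using neg r by (simp add: W_def zx)
    moreover have "W \<inter> \<Omega> = {}" using below by (auto simp: W_def nz)
    ultimately show False using x open_Int_closure_eq_empty[of W \<Omega>] unfolding frontier_def by blast
  qed
  ultimately have \<gamma>0: "\<gamma> 0 = 0" by simp
  have \<gamma>_bd: "\<bar>\<gamma> y\<bar> \<le> L * norm (P y)" for y
    using lipschitz_onD[OF lip, of "P y" 0] \<gamma>P[of y] \<gamma>0 by (simp add: dist_norm)
  have norm_le: "norm y \<le> norm (P y) + \<bar>y $ j\<bar>" for y
  proof -
    have "y = P y + (y $ j) *\<^sub>R e" by (simp add: P_def)
    then have "norm y \<le> norm (P y) + norm ((y $ j) *\<^sub>R e)" by (metis norm_triangle_ineq)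
    then show ?thesis by (simp add: norme)
  qed
  define a where "a = r / 8"
  \<comment> \<open>Over a base of radius \<open>\<delta>\<close> the graph varies by at most
    \<open>a / 4\<close>; the summand 1 covers the case \<open>L = 0\<close>.\<close>
  define \<delta> where "\<delta> = min a (a / (4 * (L + 1)))"
  have a: "a > 0" "r = 8 * a" using r by (auto simp: a_def)
  have \<delta>: "\<delta> > 0" "\<delta> \<le> a" using a L0 by (auto simp: \<delta>_def)
  have L\<delta>: "L * \<delta> \<le> a / 4"
  proof -
    have "L * \<delta> \<le> L * (a / (4 * (L + 1)))" using L0 by (intro mult_left_mono) (auto simp: \<delta>_def)
    also have "\<dots> = (L / (L + 1)) * (a / 4)" by simp
    also have "\<dots> \<le> 1 * (a / 4)" using L0 a by (intro mult_right_mono) auto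
    finally show ?thesis by simp
  qed
  have \<gamma>_small: "\<bar>\<gamma> y\<bar> \<le> a / 4" if "norm (P y) < \<delta>" for y
    using \<gamma>_bd[of y] mult_left_mono[of "norm (P y)" \<delta> L] that L0 L\<delta> by linarith
  define N where "N = {y. norm (P (z y)) < \<delta>} \<inter> {y. \<bar>z y $ j - \<gamma> (z y)\<bar> < a}"
  \<comment> \<open>The layer has axis coordinate between \<open>\<gamma> - a\<close> and
    \<open>\<gamma>\<close>, where \<bar>\<gamma>\<bar> \<le> a / 4. Lowered by \<open>a\<close>, it
    falls between \<open>- 9 / 4 * a\<close> and \<open>- 3 / 4 * a\<close>, hence stays below the
    graph. All this happens well within the radius \<open>8 * a\<close>.\<close>
  define B where "B = {y. norm (P (z y)) < \<delta> \<and> - 9 / 4 * a < z y $ j \<and> z y $ j < - 3 / 4 * a}"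
  have oN: "open N"
    unfolding N_def by (intro open_Int open_Collect_less continuous_intros contgz contz contP)
  have xN: "x \<in> N" using \<delta> a by (simp add: N_def zx P_def \<gamma>0)
  have oB: "open B"
  proof -
    have "B = {y. norm (P (z y)) < \<delta>} \<inter> {y. - 9 / 4 * a < z y $ j} \<inter> {y. z y $ j < - 3 / 4 * a}"
      by (auto simp: B_def)
    then show ?thesis by (simp only:) (intro open_Int open_Collect_less continuous_intros contz contP)
  qed
  have B\<Omega>: "y \<in> \<Omega> \<and> y \<in> ball x r" if "y \<in> B" for y
  proof -
    have "norm (z y) < r" using norm_le[of "z y"] that \<delta> a by (auto simp: B_def)
    moreover have "z y $ j < \<gamma> (z y)" using \<gamma>_small[of "z y"] that a by (auto simp: B_def)
    ultimately show ?thesis using below by (simp add: nz)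
  qed
  have cB: "convex B"
  proof (rule convexI)
    fix p q and s t :: real
    assume pq: "p \<in> B" "q \<in> B" "0 \<le> s" "0 \<le> t" "s + t = 1"
    have "s *\<^sub>R p + t *\<^sub>R q - x = s *\<^sub>R (p - x) + t *\<^sub>R (q - x)"
      using pq(5) by (simp add: algebra_simps flip: scaleR_add_left)
    then have zc: "z (s *\<^sub>R p + t *\<^sub>R q) = s *\<^sub>R z p + t *\<^sub>R z q"
      using linQ by (simp add: z_def linear_add linear_scale)
    then have "P (z (s *\<^sub>R p + t *\<^sub>R q)) = s *\<^sub>R P (z p) + t *\<^sub>R P (z q)"
      by (simp add: P_def algebra_simps)
    moreover have "s *\<^sub>R P (z p) + t *\<^sub>R P (z q) \<in> ball 0 \<delta>"
      using pq by (intro convexD[OF convex_ball]) (auto simp: B_def)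
    moreover have "s *\<^sub>R (z p $ j) + t *\<^sub>R (z q $ j) \<in> {- 9 / 4 * a<..<- 3 / 4 * a}"
      using pq by (intro convexD) (auto simp: B_def)
    ultimately show "s *\<^sub>R p + t *\<^sub>R q \<in> B"
      by (simp add: B_def zc)
  qed
  have "bounded B" using B\<Omega> by (intro bounded_subset[OF bounded_ball[of x r]]) auto
  then have PB: "poincare_set \<Omega> B" using oB cB B\<Omega> by (intro poincare_set_convex) auto
  \<comment> \<open>An orthogonal map is onto, so some displacement lowers the axis coordinate by
    exactly \<open>a\<close> and fixes the other coordinates.\<close>
  obtain v where v: "Q v = - (a *\<^sub>R e)"
    using orthogonal_transformation_surj[OF Q] by (metis surj_def)
  have zv: "z (y + s *\<^sub>R v) = z y - (s * a) *\<^sub>R e" for y s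
  proof -
    have "y + s *\<^sub>R v - x = (y - x) + s *\<^sub>R v" by simp
    then show ?thesis using linQ v by (simp only: z_def linear_add linear_scale) simp
  qed
  have A: "norm (P (z y)) < \<delta> \<and> \<gamma> (z y) - a < z y $ j \<and> z y $ j < \<gamma> (z y)" if "y \<in> N \<inter> \<Omega>" for y
  proof -
    have y: "norm (P (z y)) < \<delta>" "\<bar>z y $ j - \<gamma> (z y)\<bar> < a" using that by (auto simp: N_def)
    then have "norm (z y) < r" using norm_le[of "z y"] \<gamma>_small[of "z y"] \<delta> a by auto
    then show ?thesis using y below that by auto
  qed
  have "poincare_set \<Omega> (N \<inter> \<Omega>)"
  proof (rule poincare_set_shift[OF PB oB, where v = v])
    show "open (N \<inter> \<Omega>)" using oN op by auto
    fix y assume y: "y \<in> N \<inter> \<Omega>"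
    note Ay = A[OF y]
    have g: "\<bar>\<gamma> (z y)\<bar> \<le> a / 4" using \<gamma>_small Ay by blast
    show "y + v \<in> B"
      using Ay g zv[of y 1] by (auto simp: B_def Pe e_j)
    fix s :: real assume s: "0 \<le> s" "s \<le> 1"
    then have sa: "0 \<le> s * a" "s * a \<le> a" using a by (auto simp: mult_left_le_one_le)
    have "norm (z (y + s *\<^sub>R v)) < r"
    proof -
      have "norm (z (y + s *\<^sub>R v)) \<le> norm (P (z y)) + \<bar>z y $ j - s * a\<bar>"
        using norm_le[of "z (y + s *\<^sub>R v)"] by (simp add: zv Pe e_j)
      then show ?thesis using Ay g sa \<delta> a by linarith
    qed
    \<comment> \<open>The axis coordinate decreases, while \<open>\<gamma>\<close> sees only the
      unchanged projection \<open>P\<close>.\<close>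
    moreover have "z (y + s *\<^sub>R v) $ j < \<gamma> (z (y + s *\<^sub>R v))"
      using Ay sa \<gamma>P[of "z y - (s * a) *\<^sub>R e"] \<gamma>P[of "z y"] by (simp add: zv Pe e_j)
    ultimately show "y + s *\<^sub>R v \<in> \<Omega>" using below by blast
  qed
  then show ?thesis using oN xN by blast
qed

text \<open>Finitely many pieces come from compactness of the closure, and this is why boundary
  points need neighbourhoods of their own.\<close>

theorem poincare_lipschitz_domain:
  fixes \<Omega> :: "(real^'n) set"
  assumes dom: "lipschitz_domain \<Omega>" and con: "connected \<Omega>" and ne: "\<Omega> \<noteq> {}"
  shows "poincare_set \<Omega> \<Omega>"
proof -
  have op: "open \<Omega>" and bd: "bounded \<Omega>" using dom by (auto simp: lipschitz_domain_def)
  have "\<exists>N. open N \<and> x \<in> N \<and> poincare_set \<Omega> (N \<inter> \<Omega>)" if "x \<in> closure \<Omega>" for x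
  proof (cases "x \<in> \<Omega>")
    case True
    then obtain r where r: "r > 0" "ball x r \<subseteq> \<Omega>" using op open_contains_ball by blast
    then have "poincare_set \<Omega> (ball x r)" by (intro poincare_set_convex) auto
    then show ?thesis using r by (intro exI[of _ "ball x r"]) (auto simp: Int_absorb2)
  next
    case False
    then have "x \<in> frontier \<Omega>" using that op by (simp add: frontier_def interior_open)
    then show ?thesis by (rule poincare_set_boundary[OF dom])
  qed
  then obtain N where N: "\<And>x. x \<in> closure \<Omega> \<Longrightarrow> open (N x) \<and> x \<in> N x \<and> poincare_set \<Omega> (N x \<inter> \<Omega>)"
    by metis
  have "compact (closure \<Omega>)" using bd by simp
  then obtain C where C: "C \<subseteq> closure \<Omega>" "finite C" "closure \<Omega> \<subseteq> (\<Union>c\<in>C. N c)"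
    using compactE_image[of "closure \<Omega>" "closure \<Omega>" N] N by blast
  \<comment> \<open>Empty members are filtered out because merging asks for nonempty pieces; the
    union is unaffected.\<close>
  define F where "F = {X \<in> (\<lambda>c. N c \<inter> \<Omega>) ` C. X \<noteq> {}}"
  have U: "\<Union>F = \<Omega>" using C(3) closure_subset[of \<Omega>] by (auto simp: F_def) blast
  have "poincare_set \<Omega> (\<Union>F)"
  proof (rule poincare_set_finite_Union)
    show "finite F" using C by (simp add: F_def)
    show "F \<noteq> {}" using U ne by auto
    show "connected (\<Union>F)" using U con by simp
    show "open X \<and> X \<noteq> {} \<and> bounded X \<and> poincare_set \<Omega> X" if "X \<in> F" for X
      using that C(1) N op bd by (auto simp: F_def intro: bounded_subset)
  qed
  then show ?thesis using U by simp
qed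

section \<open>Riesz representation and completeness of square-integrable functions\<close>

text \<open>The quadratic is evaluated at its minimum \<open>b / c\<close>; if \<open>c = 0\<close>,
  it is affine and bounded below, so \<open>b = 0\<close>. Besides Cauchy-Schwarz this yields the
  Euler-Lagrange equation, through the case \<open>a = 0\<close>.\<close>

lemma discriminant_le:
  fixes a b c :: real
  assumes quad: "\<And>t. 0 \<le> a - 2 * t * b + t^2 * c" and c: "c \<ge> 0"
  shows "b^2 \<le> a * c"
proof (cases "c = 0")
  case True
  have "b = 0"
  proof (rule ccontr)
    assume "b \<noteq> 0"
    \<comment> \<open>The witness is the parameter at which the affine function takes the value
      \<open>- 1\<close>.\<close>
    then have "a - 2 * ((a + 1) / (2 * b)) * b + ((a + 1) / (2 * b))^2 * c = - 1"
      using True by (simp add: field_simps)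
    then show False using quad[of "(a + 1) / (2 * b)"] by simp
  qed
  then show ?thesis using True by simp
next
  case False
  then have "c > 0" using c by simp
  then show ?thesis using quad[of "b / c"] by (simp add: field_simps power2_eq_square)
qed

text \<open>Riesz representation for a complete semi-inner product; \<open>comb u c v\<close> plays the role of \<open>u + c v\<close>.
  A minimising sequence of \<open>B u u - 2 l u\<close> is Cauchy by the parallelogram identity.\<close>
lemma riesz_semi_inner_product:
  fixes V :: "'a set" and comb :: "'a \<Rightarrow> real \<Rightarrow> 'a \<Rightarrow> 'a" and B :: "'a \<Rightarrow> 'a \<Rightarrow> real" and l :: "'a \<Rightarrow> real"
  assumes ne: "V \<noteq> {}" and comb: "\<And>u c v. u \<in> V \<Longrightarrow> v \<in> V \<Longrightarrow> comb u c v \<in> V"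
    and sym: "\<And>u v. u \<in> V \<Longrightarrow> v \<in> V \<Longrightarrow> B u v = B v u"
    and lin: "\<And>u c v w. u \<in> V \<Longrightarrow> v \<in> V \<Longrightarrow> w \<in> V \<Longrightarrow> B (comb u c v) w = B u w + c * B v w"
    and pos: "\<And>u. u \<in> V \<Longrightarrow> B u u \<ge> 0"
    and llin: "\<And>u c v. u \<in> V \<Longrightarrow> v \<in> V \<Longrightarrow> l (comb u c v) = l u + c * l v"
    and K: "K \<ge> 0" and bnd: "\<And>u. u \<in> V \<Longrightarrow> (l u)^2 \<le> K * B u u"
    and complete: "\<And>f. (\<And>n::nat. f n \<in> V) \<Longrightarrow>
       (\<And>\<epsilon>. \<epsilon> > 0 \<Longrightarrow> \<exists>N. \<forall>m\<ge>N. \<forall>n\<ge>N. B (comb (f m) (-1) (f n)) (comb (f m) (-1) (f n)) < \<epsilon>) \<Longrightarrow>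
       \<exists>u\<in>V. (\<lambda>n. B (comb (f n) (-1) u) (comb (f n) (-1) u)) \<longlonglongrightarrow> 0"
  shows "\<exists>u\<in>V. \<forall>v\<in>V. B u v = l v"
proof -
  have quad: "B (comb u c v) (comb u c v) = B u u + 2 * c * B u v + c^2 * B v v" if "u \<in> V" "v \<in> V" for u v c
  proof -
    note m = comb[OF that, of c]
    have "B (comb u c v) (comb u c v) = B u (comb u c v) + c * B v (comb u c v)"
      using lin[OF that m] .
    moreover have "B u (comb u c v) = B u u + c * B u v"
      using sym[OF that(1) m] lin[OF that that(1), of c] sym[OF that] by simp
    moreover have "B v (comb u c v) = B u v + c * B v v"
      using sym[OF that(2) m] lin[OF that that(2), of c] by simp
    ultimately show ?thesis by (simp add: power2_eq_square algebra_simps)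
  qed
  have CS: "(B u v)^2 \<le> B u u * B v v" if "u \<in> V" "v \<in> V" for u v
  proof (rule discriminant_le)
    fix t
    show "0 \<le> B u u - 2 * t * B u v + t^2 * B v v"
      using pos[OF comb[OF that, of "- t"]] quad[OF that, of "- t"] by simp
  qed (use that pos in auto)
  define J where "J u = B u u - 2 * l u" for u
  \<comment> \<open>By the inequality of means \<open>4 * (K * B u u)\<close> is at most
    \<open>(K + B u u)^2\<close>, so \<open>2 * l u\<close> exceeds \<open>B u u\<close> by at most
    \<open>K\<close>.\<close>
  have lower: "J u \<ge> - K" if "u \<in> V" for u
  proof -
    have "4 * (K * B u u) \<le> (K + B u u)^2"
      using zero_le_power2[of "K - B u u"] by (simp add: power2_eq_square algebra_simps)
    then have "(2 * l u)^2 \<le> (K + B u u)^2" using bnd[OF that] by (simp add: power2_eq_square)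
    then have "\<bar>2 * l u\<bar> \<le> K + B u u" using K pos[OF that] by (metis abs_le_square_iff abs_of_nonneg add_nonneg_nonneg)
    then show ?thesis by (simp add: J_def)
  qed
  define I where "I = Inf (J ` V)"
  have bdd: "bdd_below (J ` V)" using lower by (intro bdd_belowI[of _ "- K"]) auto
  have I_le: "I \<le> J u" if "u \<in> V" for u unfolding I_def using bdd that by (intro cInf_lower) auto
  have "\<exists>u\<in>V. J u < I + 1 / Suc n" for n
  proof -
    have "Inf (J ` V) < I + 1 / Suc n" by (simp add: I_def)
    then show ?thesis using ne by (subst (asm) cInf_less_iff[OF _ bdd]) auto
  qed
  then obtain f where f: "\<And>n. f n \<in> V" "\<And>n. J (f n) < I + 1 / Suc n" by metis
  have para: "B (comb u (-1) v) (comb u (-1) v) \<le> 2 * (J u - I) + 2 * (J v - I)" if uv: "u \<in> V" "v \<in> V" for u v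
  proof -
    \<comment> \<open>The midpoint of \<open>u\<close> and \<open>v\<close>, where \<open>J\<close>
      is still at least the infimum \<open>I\<close>.\<close>
    let ?m = "comb u (1/2) (comb v (-1) u)"
    have m: "?m \<in> V" using uv comb by auto
    have Bm: "B ?m ?m = B u u + (B u v - B u u) + 1/4 * (B v v - 2 * B u v + B u u)"
    proof -
      have "B u (comb v (-1) u) = B u v - B u u"
        using sym[OF uv(1) comb[OF uv(2,1)], of "-1"] lin[OF uv(2,1,1), of "-1"] sym[OF uv] by simp
      moreover have "B (comb v (-1) u) (comb v (-1) u) = B v v - 2 * B u v + B u u"
        using quad[OF uv(2,1), of "-1"] sym[OF uv] by simp
      ultimately show ?thesis using uv comb by (simp add: quad power2_eq_square)
    qed
    have "4 * J ?m = 2 * J u + 2 * J v - B (comb u (-1) v) (comb u (-1) v)"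
      using uv comb unfolding J_def Bm by (simp add: llin quad field_simps)
    then show ?thesis using I_le[OF m] by simp
  qed
  have "\<exists>u\<in>V. (\<lambda>n. B (comb (f n) (-1) u) (comb (f n) (-1) u)) \<longlonglongrightarrow> 0"
  proof (rule complete[OF f(1)])
    fix \<epsilon> :: real assume "\<epsilon> > 0"
    then obtain N where N: "1 / real (Suc N) < \<epsilon> / 4" by (meson divide_pos_pos nat_approx_posE zero_less_numeral)
    have "B (comb (f m) (-1) (f n)) (comb (f m) (-1) (f n)) < \<epsilon>" if "m \<ge> N" "n \<ge> N" for m n
    proof -
      have "1 / real (Suc m) \<le> 1 / real (Suc N)" "1 / real (Suc n) \<le> 1 / real (Suc N)"
        using that by (auto intro!: divide_left_mono)
      then have "J (f m) - I < \<epsilon> / 4" "J (f n) - I < \<epsilon> / 4"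
        using f(2)[of m] f(2)[of n] N by (smt (verit))+
      then have "2 * (J (f m) - I) + 2 * (J (f n) - I) < \<epsilon>" by argo
      with para[OF f(1) f(1)] show ?thesis by (rule le_less_trans)
    qed
    then show "\<exists>N. \<forall>m\<ge>N. \<forall>n\<ge>N. B (comb (f m) (-1) (f n)) (comb (f m) (-1) (f n)) < \<epsilon>" by blast
  qed
  then obtain u where u: "u \<in> V" and lim: "(\<lambda>n. B (comb (f n) (-1) u) (comb (f n) (-1) u)) \<longlonglongrightarrow> 0" by blast
  have "B u v = l v" if v: "v \<in> V" for v
  proof -
    have limB: "(\<lambda>n. B (f n) v) \<longlonglongrightarrow> B u v"
    proof -
      have "(\<lambda>n. (B (f n) v - B u v)^2) \<longlonglongrightarrow> 0"
      proof (rule tendsto_sandwich[OF _ _ tendsto_const])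
        show "\<forall>\<^sub>F n in sequentially. (B (f n) v - B u v)^2 \<le> B (comb (f n) (-1) u) (comb (f n) (-1) u) * B v v"
          using CS[OF comb[OF f(1) u] v] lin[OF f(1) u v, of _ "-1"] by (intro always_eventually) (metis (no_types, lifting) mult_minus1 uminus_add_conv_diff add.commute)
        show "(\<lambda>n. B (comb (f n) (-1) u) (comb (f n) (-1) u) * B v v) \<longlonglongrightarrow> 0"
          using tendsto_mult_right[OF lim] by simp
      qed simp
      from tendsto_real_sqrt[OF this] have "(\<lambda>n. B (f n) v - B u v) \<longlonglongrightarrow> 0" by (simp add: tendsto_rabs_zero_iff)
      then show ?thesis by (simp add: LIM_zero_iff)
    qed
    \<comment> \<open>Perturbing the minimising sequence by \<open>t\<close> times \<open>v\<close>
      cannot push \<open>J\<close> below \<open>I\<close>. In the limit a quadratic in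
      \<open>t\<close> without constant term stays nonnegative, so its linear coefficient
      \<open>l v - B u v\<close> vanishes.\<close>
    have "0 \<le> 0 - 2 * t * (l v - B u v) + t^2 * B v v" for t
    proof (rule LIMSEQ_le[OF tendsto_const])
      have "(\<lambda>n. 1 / Suc n + (2 * t * (B (f n) v - l v) + t^2 * B v v)) \<longlonglongrightarrow> 0 + (2 * t * (B u v - l v) + t^2 * B v v)"
        using LIMSEQ_inverse_real_of_nat by (intro tendsto_intros limB) (simp add: inverse_eq_divide)
      then show "(\<lambda>n. 1 / Suc n + (2 * t * (B (f n) v - l v) + t^2 * B v v)) \<longlonglongrightarrow> 0 - 2 * t * (l v - B u v) + t^2 * B v v"
        by (simp add: algebra_simps)
      have "0 \<le> 1 / Suc n + (2 * t * (B (f n) v - l v) + t^2 * B v v)" for n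
      proof -
        have "J (comb (f n) t v) = J (f n) + (2 * t * (B (f n) v - l v) + t^2 * B v v)"
          using f(1) v by (simp add: J_def quad llin algebra_simps)
        then show ?thesis using I_le[OF comb[OF f(1)[of n] v, of t]] f(2)[of n] by linarith
      qed
      then show "\<exists>N. \<forall>n\<ge>N. 0 \<le> 1 / Suc n + (2 * t * (B (f n) v - l v) + t^2 * B v v)" by blast
    qed
    then have "(l v - B u v)^2 \<le> 0 * B v v" by (rule discriminant_le) (use pos v in auto)
    then show ?thesis by simp
  qed
  then show ?thesis using u by blast
qed

section \<open>Completeness of the space of square-integrable functions\<close>

lemma Cauchy_Schwarz_integral:
  fixes f g :: "'a \<Rightarrow> real"
  assumes [measurable]: "f \<in> borel_measurable M" "g \<in> borel_measurable M"
    and f2: "integrable M (\<lambda>x. (f x)^2)" and g2: "integrable M (\<lambda>x. (g x)^2)"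
  shows "(\<integral>x. f x * g x \<partial>M)^2 \<le> (\<integral>x. (f x)^2 \<partial>M) * (\<integral>x. (g x)^2 \<partial>M)"
proof (rule discriminant_le)
  fix t :: real
  have fg: "integrable M (\<lambda>x. f x * g x)" by (intro integrable_mult_of_squares assms)
  have "0 \<le> (\<integral>x. (f x - t * g x)^2 \<partial>M)" by simp
  also have "(\<lambda>x. (f x - t * g x)^2) = (\<lambda>x. (f x)^2 - 2 * t * (f x * g x) + t^2 * (g x)^2)"
    by (auto simp: power2_eq_square algebra_simps)
  also have "(\<integral>x. (f x)^2 - 2 * t * (f x * g x) + t^2 * (g x)^2 \<partial>M)
     = (\<integral>x. (f x)^2 \<partial>M) - 2 * t * (\<integral>x. f x * g x \<partial>M) + t^2 * (\<integral>x. (g x)^2 \<partial>M)"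
    using f2 g2 fg by simp
  finally show "0 \<le> (\<integral>x. (f x)^2 \<partial>M) - 2 * t * (\<integral>x. f x * g x \<partial>M) + t^2 * (\<integral>x. (g x)^2 \<partial>M)" .
qed simp

text \<open>The terms of a convergent series are bounded, so the increments are dominated by a
  geometric sequence of ratio \<open>sqrt (1/2)\<close> and are summable.\<close>

lemma convergent_of_weighted_square_sum:
  fixes a :: "nat \<Rightarrow> real"
  assumes fin: "(\<Sum>k. ennreal (2 ^ k * (a (Suc k) - a k)^2)) \<noteq> \<infinity>"
  shows "convergent a"
proof -
  let ?t = "\<lambda>k. 2 ^ k * (a (Suc k) - a k)^2"
  have "summable ?t" using fin by (intro summable_suminf_not_top) auto
  then have "Bseq ?t" using summable_LIMSEQ_zero convergent_def convergent_imp_Bseq by blast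
  then obtain S where S: "\<And>k. \<bar>?t k\<bar> \<le> S" by (auto simp: Bseq_def)
  have S0: "S \<ge> 0" using S[of 0] by (meson abs_ge_zero order_trans)
  have bd: "\<bar>a (Suc k) - a k\<bar> \<le> sqrt S * (sqrt (1/2)) ^ k" for k
  proof -
    have "2 ^ k * (a (Suc k) - a k)^2 \<le> S" using S[of k] by simp
    then have "(a (Suc k) - a k)^2 \<le> S * (1/2) ^ k" by (simp add: power_one_over field_simps)
    then have "sqrt ((a (Suc k) - a k)^2) \<le> sqrt (S * (1/2) ^ k)" by (rule real_sqrt_le_mono)
    then show ?thesis unfolding real_sqrt_abs by (simp add: real_sqrt_mult real_sqrt_power)
  qed
  have "summable (\<lambda>k. sqrt S * (sqrt (1/2)) ^ k)"
    by (intro summable_mult summable_geometric) (auto simp: real_sqrt_divide)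
  then have "summable (\<lambda>k. a (Suc k) - a k)"
    by (rule summable_comparison_test'[where N = 0]) (use bd in auto)
  then have "convergent (\<lambda>n. \<Sum>k<n. a (Suc k) - a k)" by (simp add: summable_iff_convergent)
  then have "convergent (\<lambda>n. (a n - a 0) + a 0)"
    by (intro convergent_add convergent_const) (simp add: sum_lessThan_telescope)
  then show ?thesis by simp
qed

text \<open>Riesz--Fischer: along a subsequence with \<open>\<integral>(f (Suc k) - f k)\<^sup>2 < 4 ^ - k\<close> the weights \<open>2 ^ k\<close> still
  give an integrable sum, which forces pointwise convergence; Fatou's lemma does the rest.\<close>
lemma L2_complete:
  fixes f :: "nat \<Rightarrow> 'a \<Rightarrow> real"
  assumes [measurable]: "\<And>n. f n \<in> borel_measurable M" and f2: "\<And>n. integrable M (\<lambda>x. (f n x)^2)"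
    and cauchy: "\<And>\<epsilon>. \<epsilon> > 0 \<Longrightarrow> \<exists>N. \<forall>m\<ge>N. \<forall>n\<ge>N. (\<integral>x. (f m x - f n x)^2 \<partial>M) < \<epsilon>"
  shows "\<exists>g. g \<in> borel_measurable M \<and> integrable M (\<lambda>x. (g x)^2) \<and> (\<lambda>n. \<integral>x. (f n x - g x)^2 \<partial>M) \<longlonglongrightarrow> 0"
proof -
  have sq: "integrable M (\<lambda>x. (f m x - f n x)^2)" for m n
    using integrable_square_add[of "f m" M "\<lambda>x. - f n x"] f2 by simp
  have nn: "(\<integral>\<^sup>+x. ennreal ((f m x - f n x)^2) \<partial>M) = ennreal (\<integral>x. (f m x - f n x)^2 \<partial>M)" for m n
    using sq by (intro nn_integral_eq_integral) auto
  have "\<exists>N. \<forall>m\<ge>N. \<forall>n\<ge>N. (\<integral>x. (f m x - f n x)^2 \<partial>M) < (1/4) ^ k" for k :: nat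
    by (rule cauchy) simp
  then obtain N where N: "\<And>k m n. m \<ge> N k \<Longrightarrow> n \<ge> N k \<Longrightarrow> (\<integral>x. (f m x - f n x)^2 \<partial>M) < (1/4) ^ k" by metis
  \<comment> \<open>The sum over all \<open>j \<le> k\<close> dominates \<open>N k\<close> and is
    monotone; the summand \<open>k\<close> makes the indices unbounded.\<close>
  define r where "r k = (\<Sum>j\<le>k. N j) + k" for k
  have rN: "r k \<ge> N k" for k unfolding r_def by (simp add: trans_le_add1 member_le_sum)
  have rmono: "r (Suc k) \<ge> r k" for k by (simp add: r_def)
  have rk: "r k \<ge> k" for k by (simp add: r_def)
  have "(\<integral>\<^sup>+x. (\<Sum>k. ennreal (2 ^ k * (f (r (Suc k)) x - f (r k) x)^2)) \<partial>M)
      = (\<Sum>k. \<integral>\<^sup>+x. ennreal (2 ^ k * (f (r (Suc k)) x - f (r k) x)^2) \<partial>M)"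
    by (intro nn_integral_suminf) measurable
  also have "\<dots> \<le> (\<Sum>k. ennreal ((1/2) ^ k))"
  proof (intro suminf_le summableI)
    fix k
    have "(\<integral>\<^sup>+x. ennreal (2 ^ k * (f (r (Suc k)) x - f (r k) x)^2) \<partial>M) = ennreal (2 ^ k) * ennreal (\<integral>x. (f (r (Suc k)) x - f (r k) x)^2 \<partial>M)"
      unfolding nn[symmetric] by (subst nn_integral_cmult[symmetric]) (auto simp: ennreal_mult)
    also have "\<dots> \<le> ennreal (2 ^ k) * ennreal ((1/4) ^ k)"
      using N[of k "r (Suc k)" "r k"] rN[of k] rmono[of k]
      by (intro mult_left_mono ennreal_leI) auto
    also have "\<dots> = ennreal (2 ^ k * (1/4) ^ k)" by (simp add: ennreal_mult)
    also have "2 ^ k * (1/4) ^ k = (1/2 :: real) ^ k" by (simp flip: power_mult_distrib)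
    finally show "(\<integral>\<^sup>+x. ennreal (2 ^ k * (f (r (Suc k)) x - f (r k) x)^2) \<partial>M) \<le> ennreal ((1/2) ^ k)" .
  qed
  also have "\<dots> = ennreal (\<Sum>k. (1/2) ^ k)" by (intro suminf_ennreal2 summable_geometric) auto
  also have "\<dots> < \<infinity>" by simp
  finally have "AE x in M. (\<Sum>k. ennreal (2 ^ k * (f (r (Suc k)) x - f (r k) x)^2)) \<noteq> \<infinity>"
    by (intro nn_integral_noteq_infinite) auto
  then have conv: "AE x in M. convergent (\<lambda>k. f (r k) x)"
    by eventually_elim (rule convergent_of_weighted_square_sum)
  define g where "g x = lim (\<lambda>k. f (r k) x)" for x
  have g[measurable]: "g \<in> borel_measurable M" unfolding g_def by (intro borel_measurable_lim_metric) measurable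
  have lim: "AE x in M. (\<lambda>k. f (r k) x) \<longlonglongrightarrow> g x"
    using conv by eventually_elim (simp add: g_def convergent_LIMSEQ_iff)
  \<comment> \<open>Used twice: with bound 1 it shows that the limit is square integrable, and with
    bound \<open>e / 2\<close> it gives convergence of the whole sequence.\<close>
  have fatou: "(\<integral>\<^sup>+x. ennreal ((f n x - g x)^2) \<partial>M) \<le> ennreal \<epsilon>"
    if "\<And>m. m \<ge> K \<Longrightarrow> (\<integral>x. (f n x - f m x)^2 \<partial>M) \<le> \<epsilon>" for n K \<epsilon>
  proof -
    have "(\<integral>\<^sup>+x. ennreal ((f n x - g x)^2) \<partial>M) = (\<integral>\<^sup>+x. liminf (\<lambda>k. ennreal ((f n x - f (r k) x)^2)) \<partial>M)"
    proof (intro nn_integral_cong_AE)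
      show "AE x in M. ennreal ((f n x - g x)^2) = liminf (\<lambda>k. ennreal ((f n x - f (r k) x)^2))"
        using lim
      proof eventually_elim
        case (elim x)
        then have "(\<lambda>k. ennreal ((f n x - f (r k) x)^2)) \<longlonglongrightarrow> ennreal ((f n x - g x)^2)"
          by (intro tendsto_ennrealI tendsto_intros)
        from lim_imp_Liminf[OF sequentially_bot this] show ?case by simp
      qed
    qed
    also have "\<dots> \<le> liminf (\<lambda>k. \<integral>\<^sup>+x. ennreal ((f n x - f (r k) x)^2) \<partial>M)"
      by (intro nn_integral_liminf) measurable
    also have "\<dots> \<le> liminf (\<lambda>k. ennreal \<epsilon>)"
    proof (rule Liminf_mono)
      show "\<forall>\<^sub>F k in sequentially. (\<integral>\<^sup>+x. ennreal ((f n x - f (r k) x)^2) \<partial>M) \<le> ennreal \<epsilon>"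
        using eventually_ge_at_top[of K]
      proof eventually_elim
        case (elim k)
        then show ?case unfolding nn using that[of "r k"] rk[of k] by (intro ennreal_leI) auto
      qed
    qed
    also have "\<dots> = ennreal \<epsilon>" by (rule Liminf_const[OF sequentially_bot])
    finally show ?thesis .
  qed
  obtain N1 where N1: "\<forall>m\<ge>N1. \<forall>n\<ge>N1. (\<integral>x. (f m x - f n x)^2 \<partial>M) < 1" using cauchy[of 1] by auto
  have diff: "integrable M (\<lambda>x. (f N1 x - g x)^2)"
  proof (rule integrableI_nonneg)
    have "(\<integral>\<^sup>+x. ennreal ((f N1 x - g x)^2) \<partial>M) \<le> ennreal 1" using N1 by (intro fatou[of N1]) (auto intro: less_imp_le)
    then show "(\<integral>\<^sup>+x. ennreal ((f N1 x - g x)^2) \<partial>M) < \<infinity>" using le_less_trans by fastforce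
  qed auto
  have g2: "integrable M (\<lambda>x. (g x)^2)"
    using integrable_square_add[of "f N1" M "\<lambda>x. g x - f N1 x"] f2 diff[unfolded power2_commute[of "f N1 _"]] by simp
  have "(\<lambda>n. \<integral>x. (f n x - g x)^2 \<partial>M) \<longlonglongrightarrow> 0"
  proof (rule LIMSEQ_I)
    fix e :: real assume e: "e > 0"
    then obtain K where K: "\<forall>m\<ge>K. \<forall>n\<ge>K. (\<integral>x. (f m x - f n x)^2 \<partial>M) < e / 2" using cauchy[of "e / 2"] by auto
    have "norm ((\<integral>x. (f n x - g x)^2 \<partial>M) - 0) < e" if "n \<ge> K" for n
    proof -
      have "(\<integral>\<^sup>+x. ennreal ((f n x - g x)^2) \<partial>M) \<le> ennreal (e / 2)"
        using K that by (intro fatou[of K]) (auto intro: less_imp_le)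
      moreover have "integrable M (\<lambda>x. (f n x - g x)^2)"
        using integrable_square_add[of "f n" M "\<lambda>x. - g x"] f2 g2 by simp
      ultimately have "(\<integral>x. (f n x - g x)^2 \<partial>M) \<le> e / 2"
        using e by (subst (asm) nn_integral_eq_integral) auto
      then show ?thesis using e by simp
    qed
    then show "\<exists>K. \<forall>n\<ge>K. norm ((\<integral>x. (f n x - g x)^2 \<partial>M) - 0) < e" by blast
  qed
  then show ?thesis using g g2 by blast
qed

section \<open>Weak derivatives\<close>

text \<open>The bridge between the two settings: a Borel function that vanishes off
  \<open>\<Omega>\<close> does not see the restriction, and completing the measure does not change
  its integral.\<close>

lemma lborel_integral_eq_lebesgue_on:
  fixes F :: "'a::euclidean_space \<Rightarrow> real"
  assumes \<Omega>: "open \<Omega>" and F: "F \<in> borel_measurable borel" "\<And>x. x \<notin> \<Omega> \<Longrightarrow> F x = 0"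
  shows "(\<integral>x. F x \<partial>lebesgue_on \<Omega>) = (\<integral>x. F x \<partial>lborel)" "integrable (lebesgue_on \<Omega>) F \<longleftrightarrow> integrable lborel F"
proof -
  have s: "\<Omega> \<inter> space lebesgue \<in> sets lebesgue" using \<Omega> by auto
  have eq: "(\<lambda>x. indicator \<Omega> x *\<^sub>R F x) = F" using F(2) by (auto simp: indicator_def fun_eq_iff)
  show "(\<integral>x. F x \<partial>lebesgue_on \<Omega>) = (\<integral>x. F x \<partial>lborel)"
    unfolding integral_restrict_space[OF s] eq using F by (intro integral_completion) auto
  show "integrable (lebesgue_on \<Omega>) F \<longleftrightarrow> integrable lborel F"
    unfolding integrable_restrict_space[OF s] eq using F by (intro integrable_completion) auto
qed

lemma AE_lebesgue_on_iff:
  assumes "open (\<Omega> :: 'a::euclidean_space set)"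
  shows "(AE x in lebesgue_on \<Omega>. P x) \<longleftrightarrow> (AE x in lborel. x \<in> \<Omega> \<longrightarrow> P x)"
proof -
  have s: "\<Omega> \<inter> space lebesgue \<in> sets lebesgue" using assms by auto
  show ?thesis unfolding AE_restrict_space_iff[OF s] by (rule AE_completion_iff)
qed

lemma borel_measurable_lebesgue_onI:
  assumes "f \<in> borel_measurable borel"
  shows "f \<in> borel_measurable (lebesgue_on \<Omega>)"
  using assms by (intro measurable_restrict_space1 measurable_completion) auto

lemma borel_representative:
  fixes u :: "'a::euclidean_space \<Rightarrow> real"
  assumes \<Omega>: "open \<Omega>" and u: "u \<in> borel_measurable (lebesgue_on \<Omega>)"
  obtains U where "U \<in> borel_measurable borel" "\<And>x. x \<notin> \<Omega> \<Longrightarrow> U x = 0" "AE x in lebesgue_on \<Omega>. u x = U x"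
proof -
  have "(\<lambda>x. if x \<in> \<Omega> then u x else 0) \<in> borel_measurable lebesgue"
    using u \<Omega> by (intro borel_measurable_if_I) auto
  then obtain g where g: "g \<in> borel_measurable lborel" "AE x in lborel. (if x \<in> \<Omega> then u x else 0) = g x"
    using completion_ex_borel_measurable_real by blast
  show thesis
  proof
    show "(\<lambda>x. indicator \<Omega> x * g x) \<in> borel_measurable borel" using g(1) \<Omega> by auto
    show "AE x in lebesgue_on \<Omega>. u x = indicator \<Omega> x * g x"
      unfolding AE_lebesgue_on_iff[OF \<Omega>] using g(2) by (auto elim!: eventually_mono)
  qed (simp add: indicator_def)
qed

section \<open>Square-integrable functions and weak derivatives on a bounded open set\<close>

lemma L2_onD:
  assumes "L2_on \<Omega> u"
  shows "u \<in> borel_measurable (lebesgue_on \<Omega>)" "integrable (lebesgue_on \<Omega>) (\<lambda>x. (u x)^2)"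
  using assms by (auto simp: L2_on_def)

lemma L2_on_mult: "L2_on \<Omega> u \<Longrightarrow> L2_on \<Omega> v \<Longrightarrow> integrable (lebesgue_on \<Omega>) (\<lambda>x. u x * v x)"
  by (intro integrable_mult_of_squares L2_onD)

lemma L2_on_add: "L2_on \<Omega> u \<Longrightarrow> L2_on \<Omega> v \<Longrightarrow> L2_on \<Omega> (\<lambda>x. u x + v x)"
  unfolding L2_on_def by (auto intro: integrable_square_add)

lemma L2_on_cmult: "L2_on \<Omega> u \<Longrightarrow> L2_on \<Omega> (\<lambda>x. c * u x)"
  unfolding L2_on_def by (auto simp: power_mult_distrib)

lemma L2_on_comb: "L2_on \<Omega> u \<Longrightarrow> L2_on \<Omega> v \<Longrightarrow> L2_on \<Omega> (\<lambda>x. u x + c * v x)"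
  by (intro L2_on_add L2_on_cmult)

lemma L2_on_diff: "L2_on \<Omega> u \<Longrightarrow> L2_on \<Omega> v \<Longrightarrow> L2_on \<Omega> (\<lambda>x. u x - v x)"
  using L2_on_comb[of \<Omega> u v "-1"] by simp

lemma L2_on_bounded:
  assumes \<Omega>: "open \<Omega>" "bounded \<Omega>" and f: "f \<in> borel_measurable (lebesgue_on \<Omega>)"
    and M: "AE x in lebesgue_on \<Omega>. \<bar>f x\<bar> \<le> M"
  shows "L2_on \<Omega> f"
  unfolding L2_on_def
proof
  have "finite_measure (lebesgue_on \<Omega>)"
    using \<Omega> by (intro finite_measure_lebesgue_on lmeasurable_open)
  then show "integrable (lebesgue_on \<Omega>) (\<lambda>x. (f x)^2)"
  proof (rule finite_measure.integrable_const_bound[where B = "M^2"])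
    show "AE x in lebesgue_on \<Omega>. norm ((f x)^2) \<le> M^2"
      using M by eventually_elim (metis abs_ge_zero norm_power power2_abs power_mono real_norm_def)
  qed (use f in measurable)
qed fact

lemma L2_on_const: "open \<Omega> \<Longrightarrow> bounded \<Omega> \<Longrightarrow> L2_on \<Omega> (\<lambda>x. c)"
  by (rule L2_on_bounded[where M = "\<bar>c\<bar>"]) auto

lemma L2_on_integrable:
  assumes "open \<Omega>" "bounded \<Omega>" "L2_on \<Omega> u"
  shows "integrable (lebesgue_on \<Omega>) u"
  using L2_on_mult[OF assms(3) L2_on_const[OF assms(1,2), of 1]] by simp

lemma L2_on_continuous:
  assumes \<Omega>: "open \<Omega>" "bounded \<Omega>" and f: "continuous_on UNIV (f :: real^'n \<Rightarrow> real)"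
  shows "L2_on \<Omega> f"
proof -
  have "compact (f ` closure \<Omega>)"
    using \<Omega>(2) f by (intro compact_continuous_image) (auto intro: continuous_on_subset)
  then obtain M where "\<forall>x\<in>closure \<Omega>. \<bar>f x\<bar> \<le> M"
    using compact_imp_bounded bounded_iff by (metis image_eqI real_norm_def)
  then have "AE x in lebesgue_on \<Omega>. \<bar>f x\<bar> \<le> M"
    using closure_subset[of \<Omega>] by (intro AE_I2) (auto simp: space_restrict_space)
  then show ?thesis
    using \<Omega> borel_measurable_continuous_onI[OF f] by (intro L2_on_bounded borel_measurable_lebesgue_onI)
qed

lemma L2_on_test_fun:
  assumes "open \<Omega>" "bounded \<Omega>" "test_fun \<Omega> \<phi>"
  shows "L2_on \<Omega> (pdiffs is \<phi>)"
  using assms by (intro L2_on_continuous) (auto simp: test_fun_def smooth_fun_def)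

text \<open>Bumps over closed boxes inside \<open>\<Omega>\<close> are test functions, so the
  fundamental lemma applies to a Borel representative.\<close>

lemma AE_zero_if_test_integrals_zero:
  fixes f :: "real^'n \<Rightarrow> real"
  assumes \<Omega>: "open \<Omega>" "bounded \<Omega>" and f: "L2_on \<Omega> f"
    and zero: "\<And>\<phi>. test_fun \<Omega> \<phi> \<Longrightarrow> (\<integral>x. f x * \<phi> x \<partial>lebesgue_on \<Omega>) = 0"
  shows "AE x in lebesgue_on \<Omega>. f x = 0"
proof -
  let ?M = "lebesgue_on \<Omega>"
  obtain U where U[measurable]: "U \<in> borel_measurable borel" and U0: "\<And>x. x \<notin> \<Omega> \<Longrightarrow> U x = 0"
    and fU: "AE x in ?M. f x = U x"
    using borel_representative[OF \<Omega>(1) L2_onD(1)[OF f]] by blast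
  note [measurable] = L2_onD(1)[OF f] borel_measurable_lebesgue_onI[OF U]
  have "integrable ?M U"
    using L2_on_integrable[OF \<Omega> f] fU by (subst integrable_cong_AE[symmetric]) auto
  then have intU: "integrable lborel U" using lborel_integral_eq_lebesgue_on(2)[OF \<Omega>(1) U U0] by simp
  have "AE x in lborel. x \<in> \<Omega> \<longrightarrow> U x = 0"
  proof (rule fundamental_lemma[OF \<Omega>(1) U])
    show "set_integrable lborel (cbox a b) U" for a b
      unfolding set_integrable_def using intU by (intro integrable_mult_indicator) auto
    fix a b :: "real^'n" and n
    assume "\<forall>i. a $ i \<le> b $ i" "cbox a b \<subseteq> \<Omega>"
    then have "0 = (\<integral>x. f x * bump a b n x \<partial>?M)" using zero test_fun_bumpD by metis
    also have "\<dots> = (\<integral>x. U x * bump a b n x \<partial>?M)"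
    proof (rule integral_cong_AE)
      note [measurable] = borel_measurable_lebesgue_onI[OF bumpD_measurable[of a b n "\<lambda>_. 0"], of \<Omega>]
      show "(\<lambda>x. f x * bump a b n x) \<in> borel_measurable ?M" by measurable
      show "(\<lambda>x. U x * bump a b n x) \<in> borel_measurable ?M" by measurable
      show "AE x in ?M. f x * bump a b n x = U x * bump a b n x"
        using fU by eventually_elim simp
    qed
    also have "\<dots> = (\<integral>x. U x * bump a b n x \<partial>lborel)"
      by (intro lborel_integral_eq_lebesgue_on \<Omega>) (auto simp: U0)
    finally show "(\<integral>x. U x * bump a b n x \<partial>lborel) = 0" by simp
  qed
  then have "AE x in ?M. U x = 0" by (simp add: AE_lebesgue_on_iff[OF \<Omega>(1)])
  with fU show ?thesis by eventually_elim simp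
qed

lemma weak_deriv_unique:
  assumes \<Omega>: "open \<Omega>" "bounded \<Omega>" and "L2_on \<Omega> g" "is_weak_deriv \<Omega> is u g"
    and "L2_on \<Omega> k" "is_weak_deriv \<Omega> is u k"
  shows "AE x in lebesgue_on \<Omega>. g x = k x"
proof -
  have "AE x in lebesgue_on \<Omega>. g x - k x = 0"
  proof (rule AE_zero_if_test_integrals_zero[OF \<Omega>])
    show "L2_on \<Omega> (\<lambda>x. g x - k x)" using assms by (intro L2_on_diff)
    fix \<phi> assume \<phi>: "test_fun \<Omega> \<phi>"
    have "(-1) ^ length is * (\<integral>x. g x * \<phi> x \<partial>lebesgue_on \<Omega>) = (-1) ^ length is * (\<integral>x. k x * \<phi> x \<partial>lebesgue_on \<Omega>)"
      using assms(4,6)[unfolded is_weak_deriv_def, rule_format, OF \<phi>] by argo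
    then have "(\<integral>x. g x * \<phi> x \<partial>lebesgue_on \<Omega>) = (\<integral>x. k x * \<phi> x \<partial>lebesgue_on \<Omega>)" by simp
    moreover have "integrable (lebesgue_on \<Omega>) (\<lambda>x. g x * \<phi> x)" "integrable (lebesgue_on \<Omega>) (\<lambda>x. k x * \<phi> x)"
      using L2_on_mult[OF assms(3) L2_on_test_fun[OF \<Omega> \<phi>, of "[]"]]
        L2_on_mult[OF assms(5) L2_on_test_fun[OF \<Omega> \<phi>, of "[]"]] by simp_all
    ultimately show "(\<integral>x. (g x - k x) * \<phi> x \<partial>lebesgue_on \<Omega>) = 0"
      by (simp add: left_diff_distrib)
  qed
  then show ?thesis by eventually_elim simp
qed

text \<open>\<open>weakD\<close> is a choice and carries information only after some
  square-integrable weak derivative has been exhibited.\<close>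

lemma weakD_props:
  assumes "L2_on \<Omega> g" "is_weak_deriv \<Omega> is u g"
  shows "L2_on \<Omega> (weakD \<Omega> is u)" "is_weak_deriv \<Omega> is u (weakD \<Omega> is u)"
  using someI[of "\<lambda>g. L2_on \<Omega> g \<and> is_weak_deriv \<Omega> is u g" g] assms by (auto simp: weakD_def)

lemma weakD_AE_eq:
  assumes "open \<Omega>" "bounded \<Omega>" "L2_on \<Omega> g" "is_weak_deriv \<Omega> is u g"
  shows "AE x in lebesgue_on \<Omega>. weakD \<Omega> is u x = g x"
  using assms weakD_props[OF assms(3,4)] by (intro weak_deriv_unique)

lemma is_weak_deriv_Nil: "is_weak_deriv \<Omega> [] u u"
  by (simp add: is_weak_deriv_def)

lemma is_weak_deriv_comb:
  assumes \<Omega>: "open \<Omega>" "bounded \<Omega>" and L: "L2_on \<Omega> u" "L2_on \<Omega> v" "L2_on \<Omega> g" "L2_on \<Omega> k"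
    and w: "is_weak_deriv \<Omega> is u g" "is_weak_deriv \<Omega> is v k"
  shows "is_weak_deriv \<Omega> is (\<lambda>x. u x + c * v x) (\<lambda>x. g x + c * k x)"
  unfolding is_weak_deriv_def
proof (intro allI impI)
  fix \<phi> assume \<phi>: "test_fun \<Omega> \<phi>"
  have i1: "integrable (lebesgue_on \<Omega>) (\<lambda>x. u x * pdiffs is \<phi> x)" "integrable (lebesgue_on \<Omega>) (\<lambda>x. v x * pdiffs is \<phi> x)"
    using L L2_on_test_fun[OF \<Omega> \<phi>] L2_on_mult by blast+
  have i2: "integrable (lebesgue_on \<Omega>) (\<lambda>x. g x * \<phi> x)" "integrable (lebesgue_on \<Omega>) (\<lambda>x. k x * \<phi> x)"
    using L L2_on_test_fun[OF \<Omega> \<phi>, of "[]"] L2_on_mult by auto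
  have "(\<integral>x. (u x + c * v x) * pdiffs is \<phi> x \<partial>lebesgue_on \<Omega>) =
     (\<integral>x. u x * pdiffs is \<phi> x \<partial>lebesgue_on \<Omega>) + c * (\<integral>x. v x * pdiffs is \<phi> x \<partial>lebesgue_on \<Omega>)"
    using i1 by (simp add: distrib_right mult.assoc)
  also have "\<dots> = (-1) ^ length is * (\<integral>x. g x * \<phi> x \<partial>lebesgue_on \<Omega>) + c * ((-1) ^ length is * (\<integral>x. k x * \<phi> x \<partial>lebesgue_on \<Omega>))"
    using w \<phi> unfolding is_weak_deriv_def by simp
  also have "\<dots> = (-1) ^ length is * (\<integral>x. (g x + c * k x) * \<phi> x \<partial>lebesgue_on \<Omega>)"
    using i2 by (simp add: distrib_right mult.assoc algebra_simps)
  finally show "(\<integral>x. (u x + c * v x) * pdiffs is \<phi> x \<partial>lebesgue_on \<Omega>) =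
     (-1) ^ length is * (\<integral>x. (g x + c * k x) * \<phi> x \<partial>lebesgue_on \<Omega>)" .
qed

text \<open>Needed for constants to have gradient 0. The integral of
  \<open>\<phi> (x + e) - \<phi> x\<close> vanishes by translation invariance; writing the
  difference as an integral along the segment and exchanging the order turns it into the integral of
  the derivative.\<close>

lemma integral_pdiff_test_fun:
  fixes \<phi> :: "real^'n \<Rightarrow> real"
  assumes \<Omega>: "open \<Omega>" "bounded \<Omega>" and \<phi>: "test_fun \<Omega> \<phi>"
  shows "(\<integral>x. pdiff i \<phi> x \<partial>lebesgue_on \<Omega>) = 0"
proof -
  define e :: "real^'n" where "e = axis i 1"
  define \<psi> where "\<psi> = pdiff i \<phi>"
  have c\<psi>: "continuous_on UNIV \<psi>" and c\<phi>: "continuous_on UNIV \<phi>"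
    using \<phi> by (auto simp: test_fun_def smooth_fun_def \<psi>_def dest: spec[of _ "[]"] spec[of _ "[i]"])
  have [measurable]: "\<psi> \<in> borel_measurable borel" "\<phi> \<in> borel_measurable borel"
    using c\<psi> c\<phi> by (auto intro: borel_measurable_continuous_onI)
  have deriv: "((\<lambda>t. \<phi> (x + t *\<^sub>R e)) has_real_derivative \<psi> (x + s *\<^sub>R e)) (at s)" for x s
  proof -
    have "(\<lambda>t. \<phi> ((x + s *\<^sub>R e) + t *\<^sub>R e)) differentiable (at 0)"
      using \<phi> by (auto simp: test_fun_def smooth_fun_def e_def dest!: spec[of _ "[]"])
    then have "((\<lambda>t. \<phi> ((x + s *\<^sub>R e) + t *\<^sub>R e)) has_real_derivative \<psi> (x + s *\<^sub>R e)) (at 0)"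
      unfolding \<psi>_def pdiff_def e_def[symmetric] by (metis DERIV_deriv_iff_real_differentiable)
    then have "((\<lambda>t. \<phi> (x + (t + s) *\<^sub>R e)) has_real_derivative \<psi> (x + s *\<^sub>R e)) (at 0)"
      by (simp add: algebra_simps)
    then show ?thesis using DERIV_shift[of "\<lambda>t. \<phi> (x + t *\<^sub>R e)" "\<psi> (x + s *\<^sub>R e)" 0 s] by simp
  qed
  define S where "S = closure {x. \<phi> x \<noteq> 0}"
  have S: "compact S" "S \<subseteq> \<Omega>" using \<phi> by (auto simp: S_def test_fun_def)
  have \<phi>0: "\<phi> x = 0" if "x \<notin> S" for x using that closure_subset[of "{x. \<phi> x \<noteq> 0}"] by (auto simp: S_def)
  \<comment> \<open>The complement of the support is open, so near such a point
    \<open>\<phi>\<close> is identically 0 along the axis.\<close>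
  have \<psi>0: "\<psi> x = 0" if "x \<notin> S" for x
  proof -
    have "open ((\<lambda>t. x + t *\<^sub>R e) -` (- S))"
      by (intro continuous_open_vimage continuous_intros) (auto simp: S_def)
    moreover have "0 \<in> (\<lambda>t. x + t *\<^sub>R e) -` (- S)" using that by simp
    ultimately have "\<forall>\<^sub>F t in nhds 0. t \<in> (\<lambda>t. x + t *\<^sub>R e) -` (- S)"
      by (rule eventually_nhds_in_open)
    then have "\<forall>\<^sub>F t in nhds 0. \<phi> (x + t *\<^sub>R e) = 0"
      by eventually_elim (use \<phi>0 in auto)
    then have "((\<lambda>t. \<phi> (x + t *\<^sub>R e)) has_real_derivative 0) (at 0)"
      by (subst DERIV_cong_ev[OF refl _ refl, where g = "\<lambda>_. 0"]) auto
    with deriv[of x 0] show ?thesis using DERIV_unique by fastforce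
  qed
  have sq: "integrable lborel (\<lambda>x. (f x)^2)" "integrable lborel f"
    if "continuous_on UNIV f" "\<And>x. x \<notin> S \<Longrightarrow> f x = 0" for f :: "real^'n \<Rightarrow> real"
  proof -
    have fm: "f \<in> borel_measurable borel" using that(1) by (rule borel_measurable_continuous_onI)
    have L: "L2_on \<Omega> f" using \<Omega> that by (intro L2_on_continuous)
    show "integrable lborel (\<lambda>x. (f x)^2)"
      using L2_onD(2)[OF L] lborel_integral_eq_lebesgue_on(2)[OF \<Omega>(1), of "\<lambda>x. (f x)^2"] fm that S by auto
    show "integrable lborel f"
      using L2_on_integrable[OF \<Omega> L] lborel_integral_eq_lebesgue_on(2)[OF \<Omega>(1) fm] that S by auto
  qed
  obtain R where R: "\<And>x. x \<in> S \<Longrightarrow> norm x \<le> R" using S compact_imp_bounded bounded_iff by metis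
  \<comment> \<open>A cutoff that supplies the second square-integrable factor for
    \<open>shear_integrable\<close>. Its radius exceeds that of the support by 1, the largest
    displacement \<open>s *\<^sub>R e\<close>.\<close>
  define w where "w = indicat_real (cball (0::real^'n) (R + 1))"
  have w[measurable]: "w \<in> borel_measurable borel" unfolding w_def by (intro borel_measurable_indicator) auto
  have "(w x)^2 = w x" for x by (simp add: w_def indicator_def)
  then have w2: "integrable lborel (\<lambda>x. (w x)^2)"
    using emeasure_lborel_cball_finite[of "0::real^'n" "R + 1"] by (simp add: w_def)
  have ww: "w x * \<psi> (x + s *\<^sub>R e) = \<psi> (x + s *\<^sub>R e)" if "0 \<le> s" "s \<le> 1" for x s
  proof (cases "x + s *\<^sub>R e \<in> S")
    case True
    have "norm x \<le> norm (x + s *\<^sub>R e) + norm (s *\<^sub>R e)" by (metis add_diff_cancel_right' norm_triangle_ineq4)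
    then show ?thesis using R[OF True] that by (simp add: w_def e_def)
  qed (simp add: \<psi>0)
  have pair: "integrable (lborel \<Otimes>\<^sub>M lborel) (\<lambda>(s, x). indicator {0..1::real} s * \<psi> (x + s *\<^sub>R e))"
  proof -
    have "(\<lambda>(s, x). indicator {0..1::real} s * \<psi> (x + s *\<^sub>R e)) = (\<lambda>(s, x). indicator {0..1::real} s * (w x * \<psi> (x - s *\<^sub>R (- e))))"
      using ww by (auto simp: indicator_def)
    then show ?thesis
      using shear_integrable[OF w w2 _ sq(1)[OF c\<psi> \<psi>0], of "- e"] by simp
  qed
  have "0 = (\<integral>x. \<phi> (x + e) - \<phi> x \<partial>lborel)"
    using sq(2)[OF c\<phi> \<phi>0] integrable_lborel_shift[OF sq(2)[OF c\<phi> \<phi>0], of e]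
    by (simp add: integral_lborel_shift)
  also have "\<dots> = (\<integral>x. (\<integral>s. indicator {0..1::real} s * \<psi> (x + s *\<^sub>R e) \<partial>lborel) \<partial>lborel)"
  proof (rule Bochner_Integration.integral_cong[OF refl])
    fix x
    have "(\<integral>s. indicator {0..1::real} s *\<^sub>R \<psi> (x + s *\<^sub>R e) \<partial>lborel) = \<phi> (x + 1 *\<^sub>R e) - \<phi> (x + 0 *\<^sub>R e)"
    proof (rule integral_FTC_atLeastAtMost)
      show "((\<lambda>s. \<phi> (x + s *\<^sub>R e)) has_vector_derivative \<psi> (x + s *\<^sub>R e)) (at s within {0..1})" for s
        using deriv[of x s] by (auto simp: has_real_derivative_iff_has_vector_derivative intro: has_vector_derivative_at_within)
      show "continuous_on {0..1} (\<lambda>s. \<psi> (x + s *\<^sub>R e))"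
        by (intro continuous_on_compose2[OF c\<psi>] continuous_intros) auto
    qed simp
    then show "\<phi> (x + e) - \<phi> x = (\<integral>s. indicator {0..1::real} s * \<psi> (x + s *\<^sub>R e) \<partial>lborel)" by simp
  qed
  also have "\<dots> = (\<integral>s. (\<integral>x. indicator {0..1::real} s * \<psi> (x + s *\<^sub>R e) \<partial>lborel) \<partial>lborel)"
    by (rule lborel_pair.Fubini_integral[OF pair])
  also have "\<dots> = (\<integral>s. indicator {0..1::real} s * (\<integral>x. \<psi> x \<partial>lborel) \<partial>lborel)"
    by (simp add: integral_lborel_shift)
  also have "\<dots> = (\<integral>x. \<psi> x \<partial>lborel)" by simp
  also have "\<dots> = (\<integral>x. \<psi> x \<partial>lebesgue_on \<Omega>)"
    using \<psi>0 S by (intro lborel_integral_eq_lebesgue_on(1)[OF \<Omega>(1), symmetric]) auto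
  finally show ?thesis by (simp add: \<psi>_def)
qed

section \<open>Constants and linear combinations in \<open>H1\<close>\<close>

lemma is_weak_deriv_const:
  assumes "open \<Omega>" "bounded \<Omega>"
  shows "is_weak_deriv \<Omega> [i] (\<lambda>x. c) (\<lambda>x. 0)"
  using integral_pdiff_test_fun[OF assms] by (simp add: is_weak_deriv_def)

text \<open>For \<open>s = 1\<close> the fractional part is 0, so the Gagliardo condition is void;
  the empty list contributes nothing beyond \<open>u\<close> itself.\<close>

lemma H1_iff: "u \<in> H1 \<Omega> \<longleftrightarrow> L2_on \<Omega> u \<and> (\<forall>i. \<exists>g. L2_on \<Omega> g \<and> is_weak_deriv \<Omega> [i] u g)"
proof -
  have len: "length is \<le> Suc 0 \<longleftrightarrow> is = [] \<or> (\<exists>i. is = [i])" for "is" :: "'a list"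
    by (cases "is") auto
  show ?thesis
    using is_weak_deriv_Nil[of \<Omega> u] by (auto simp: Hs_space_def sob_int_def sob_frac_def len)
qed

lemma H1_weakD:
  assumes "u \<in> H1 \<Omega>"
  shows "L2_on \<Omega> u" "L2_on \<Omega> (weakD \<Omega> [i] u)" "is_weak_deriv \<Omega> [i] u (weakD \<Omega> [i] u)"
  using assms weakD_props unfolding H1_iff by blast+

text \<open>The gradient of a combination is a choice of its own, so linearity holds only almost
  everywhere, by uniqueness of weak derivatives.\<close>

lemma H1_comb:
  assumes \<Omega>: "open \<Omega>" "bounded \<Omega>" and uv: "u \<in> H1 \<Omega>" "v \<in> H1 \<Omega>"
  shows "(\<lambda>x. u x + c * v x) \<in> H1 \<Omega>"
    "AE x in lebesgue_on \<Omega>. wgrad \<Omega> (\<lambda>x. u x + c * v x) x = wgrad \<Omega> u x + c *\<^sub>R wgrad \<Omega> v x"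
proof -
  let ?M = "lebesgue_on \<Omega>"
  note u = H1_weakD[OF uv(1)] and v = H1_weakD[OF uv(2)]
  have w: "is_weak_deriv \<Omega> [i] (\<lambda>x. u x + c * v x) (\<lambda>x. weakD \<Omega> [i] u x + c * weakD \<Omega> [i] v x)" for i
    using \<Omega> u v by (intro is_weak_deriv_comb)
  have L: "L2_on \<Omega> (\<lambda>x. weakD \<Omega> [i] u x + c * weakD \<Omega> [i] v x)" for i
    using u v by (intro L2_on_comb)
  show "(\<lambda>x. u x + c * v x) \<in> H1 \<Omega>"
    unfolding H1_iff using w L L2_on_comb[OF u(1) v(1)] by blast
  have "AE x in ?M. \<forall>i\<in>UNIV. weakD \<Omega> [i] (\<lambda>x. u x + c * v x) x = weakD \<Omega> [i] u x + c * weakD \<Omega> [i] v x"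
    using weakD_AE_eq[OF \<Omega> L w] by (intro AE_finite_allI) auto
  then show "AE x in ?M. wgrad \<Omega> (\<lambda>x. u x + c * v x) x = wgrad \<Omega> u x + c *\<^sub>R wgrad \<Omega> v x"
    by eventually_elim (simp add: wgrad_def vec_eq_iff)
qed

lemma H1_const:
  assumes \<Omega>: "open \<Omega>" "bounded \<Omega>"
  shows "(\<lambda>x. c) \<in> H1 \<Omega>" "AE x in lebesgue_on \<Omega>. wgrad \<Omega> (\<lambda>x. c) x = 0"
proof -
  have L: "L2_on \<Omega> (\<lambda>x. 0)" "L2_on \<Omega> (\<lambda>x. c)" using \<Omega> by (auto intro: L2_on_const)
  then show "(\<lambda>x. c) \<in> H1 \<Omega>" unfolding H1_iff using is_weak_deriv_const[OF \<Omega>] by blast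
  have "AE x in lebesgue_on \<Omega>. \<forall>i\<in>UNIV. weakD \<Omega> [i] (\<lambda>x. c) x = 0"
    using weakD_AE_eq[OF \<Omega> L(1) is_weak_deriv_const[OF \<Omega>]] by (intro AE_finite_allI) auto
  then show "AE x in lebesgue_on \<Omega>. wgrad \<Omega> (\<lambda>x. c) x = 0"
    by eventually_elim (simp add: wgrad_def vec_eq_iff)
qed

section \<open>Gradients of \<open>H1\<close> functions and the inequality for functions of mean
  zero\<close>

lemma borel_measurable_vec_lambda:
  fixes G :: "'n::finite \<Rightarrow> 'a \<Rightarrow> real"
  assumes "\<And>i. G i \<in> borel_measurable M"
  shows "(\<lambda>x. \<chi> i. G i x) \<in> borel_measurable M"
  by (rule borel_measurable_euclidean_space[THEN iffD2])
    (use assms in \<open>auto simp: Basis_vec_def inner_axis\<close>)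

lemma norm_square_vec: "(norm (v :: real^'n))^2 = (\<Sum>i\<in>UNIV. (v $ i)^2)"
  unfolding power2_norm_eq_inner inner_vec_def by (simp add: power2_eq_square)

lemma H1_grad_inner_integrable:
  assumes "u \<in> H1 \<Omega>" "v \<in> H1 \<Omega>"
  shows "integrable (lebesgue_on \<Omega>) (\<lambda>x. wgrad \<Omega> u x \<bullet> wgrad \<Omega> v x)"
  unfolding inner_vec_def wgrad_def
  using assms by (auto intro!: Bochner_Integration.integrable_sum L2_on_mult H1_weakD(2))

lemma H1_grad_square_integrable:
  assumes "u \<in> H1 \<Omega>"
  shows "integrable (lebesgue_on \<Omega>) (\<lambda>x. (norm (wgrad \<Omega> u x))^2)"
  using H1_grad_inner_integrable[OF assms assms] by (simp add: power2_norm_eq_inner)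

abbreviation dirichlet :: "(real^'n) set \<Rightarrow> (real^'n \<Rightarrow> real) \<Rightarrow> real" where
  "dirichlet \<Omega> u \<equiv> \<integral>x. (norm (wgrad \<Omega> u x))^2 \<partial>lebesgue_on \<Omega>"

text \<open>The function and each of its weak partial derivatives get a Borel representative
  extended by 0, so the whole-space energy in \<open>poincare_set\<close> becomes the Dirichlet
  integral over \<open>\<Omega>\<close>.\<close>

lemma wpair_of_H1:
  fixes \<Omega> :: "(real^'n) set"
  assumes \<Omega>: "open \<Omega>" "bounded \<Omega>" and u: "u \<in> H1 \<Omega>"
  obtains U G where "wpair \<Omega> U G" "AE x in lebesgue_on \<Omega>. u x = U x" "\<And>x. x \<notin> \<Omega> \<Longrightarrow> U x = 0"
    "AE x in lebesgue_on \<Omega>. wgrad \<Omega> u x = G x" "\<And>x. x \<notin> \<Omega> \<Longrightarrow> G x = 0"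
proof -
  let ?M = "lebesgue_on \<Omega>"
  have rep: "\<exists>F. F \<in> borel_measurable borel \<and> (\<forall>x. x \<notin> \<Omega> \<longrightarrow> F x = 0) \<and> (AE x in ?M. f x = F x) \<and>
     integrable lborel (\<lambda>x. (F x)^2) \<and> (\<forall>\<phi>. continuous_on UNIV \<phi> \<longrightarrow> (\<integral>x. f x * \<phi> x \<partial>?M) = (\<integral>x. F x * \<phi> x \<partial>lborel))"
    if f: "L2_on \<Omega> f" for f
  proof -
    obtain F where F[measurable]: "F \<in> borel_measurable borel" and F0: "\<And>x. x \<notin> \<Omega> \<Longrightarrow> F x = 0"
      and fF: "AE x in ?M. f x = F x"
      using borel_representative[OF \<Omega>(1) L2_onD(1)[OF f]] by blast
    note [measurable] = L2_onD(1)[OF f] borel_measurable_lebesgue_onI[OF F]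
    have "integrable ?M (\<lambda>x. (F x)^2)"
      by (rule integrable_cong_AE_imp[OF L2_onD(2)[OF f]]) (use fF in \<open>auto elim!: eventually_mono\<close>)
    then have "integrable lborel (\<lambda>x. (F x)^2)"
      using lborel_integral_eq_lebesgue_on(2)[OF \<Omega>(1), of "\<lambda>x. (F x)^2"] F0 by simp
    moreover have "(\<integral>x. f x * \<phi> x \<partial>?M) = (\<integral>x. F x * \<phi> x \<partial>lborel)"
      if "continuous_on UNIV \<phi>" for \<phi>
    proof -
      have \<phi>[measurable]: "\<phi> \<in> borel_measurable borel" using that by (rule borel_measurable_continuous_onI)
      note [measurable] = borel_measurable_lebesgue_onI[OF \<phi>]
      have "(\<integral>x. f x * \<phi> x \<partial>?M) = (\<integral>x. F x * \<phi> x \<partial>?M)"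
        by (rule integral_cong_AE) (use fF in \<open>auto elim!: eventually_mono\<close>)
      also have "\<dots> = (\<integral>x. F x * \<phi> x \<partial>lborel)"
        by (intro lborel_integral_eq_lebesgue_on(1) \<Omega>) (auto simp: F0)
      finally show ?thesis .
    qed
    ultimately show ?thesis using F F0 fF by blast
  qed
  obtain U where U: "U \<in> borel_measurable borel" "\<And>x. x \<notin> \<Omega> \<Longrightarrow> U x = 0" "AE x in ?M. u x = U x"
     "integrable lborel (\<lambda>x. (U x)^2)" "\<And>\<phi>. continuous_on UNIV \<phi> \<Longrightarrow> (\<integral>x. u x * \<phi> x \<partial>?M) = (\<integral>x. U x * \<phi> x \<partial>lborel)"
    using rep[OF H1_weakD(1)[OF u]] by blast
  have "\<forall>i. \<exists>F. F \<in> borel_measurable borel \<and> (\<forall>x. x \<notin> \<Omega> \<longrightarrow> F x = 0) \<and> (AE x in ?M. weakD \<Omega> [i] u x = F x) \<and>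
     integrable lborel (\<lambda>x. (F x)^2) \<and> (\<forall>\<phi>. continuous_on UNIV \<phi> \<longrightarrow> (\<integral>x. weakD \<Omega> [i] u x * \<phi> x \<partial>?M) = (\<integral>x. F x * \<phi> x \<partial>lborel))"
    using rep[OF H1_weakD(2)[OF u]] by blast
  from choice[OF this] obtain G where G0: "\<And>i. G i \<in> borel_measurable borel \<and> (\<forall>x. x \<notin> \<Omega> \<longrightarrow> G i x = 0) \<and> (AE x in ?M. weakD \<Omega> [i] u x = G i x) \<and>
     integrable lborel (\<lambda>x. (G i x)^2) \<and> (\<forall>\<phi>. continuous_on UNIV \<phi> \<longrightarrow> (\<integral>x. weakD \<Omega> [i] u x * \<phi> x \<partial>?M) = (\<integral>x. G i x * \<phi> x \<partial>lborel))"
    by auto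
  have G: "G i \<in> borel_measurable borel" "x \<notin> \<Omega> \<Longrightarrow> G i x = 0" "AE x in ?M. weakD \<Omega> [i] u x = G i x"
     "integrable lborel (\<lambda>x. (G i x)^2)" "continuous_on UNIV \<phi> \<Longrightarrow> (\<integral>x. weakD \<Omega> [i] u x * \<phi> x \<partial>?M) = (\<integral>x. G i x * \<phi> x \<partial>lborel)" for i x \<phi>
    using G0[of i] by auto
  show thesis
  proof
    show "AE x in ?M. u x = U x" by fact
    show "U x = 0" if "x \<notin> \<Omega>" for x using U that by blast
    show "(\<chi> i. G i x) = 0" if "x \<notin> \<Omega>" for x using G(2) that by (simp add: vec_eq_iff)
    have "AE x in ?M. \<forall>i\<in>UNIV. weakD \<Omega> [i] u x = G i x"
      using G(3) by (intro AE_finite_allI) auto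
    then show "AE x in ?M. wgrad \<Omega> u x = (\<chi> i. G i x)"
      by eventually_elim (simp add: wgrad_def vec_eq_iff)
    show "wpair \<Omega> U (\<lambda>x. \<chi> i. G i x)"
      unfolding wpair_def
    proof (intro conjI allI impI)
      show "(\<lambda>x. \<chi> i. G i x) \<in> borel_measurable borel" using G(1) by (rule borel_measurable_vec_lambda)
      show "integrable lborel (\<lambda>x. (norm (\<chi> i. G i x))^2)"
        using G(4) by (simp add: norm_square_vec)
      fix a b :: "real^'n" and n i
      assume ab: "\<forall>k. a $ k \<le> b $ k" "cbox a b \<subseteq> \<Omega>"
      have "pdiffs [i] (bump a b n) = bumpD a b n ((\<lambda>_. 0)(i := 1))"
        unfolding pdiffs_bumpD by (rule arg_cong[where f = "bumpD a b n"]) auto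
      then have "(\<integral>x. u x * bumpD a b n ((\<lambda>_. 0)(i := 1)) x \<partial>?M) = - (\<integral>x. weakD \<Omega> [i] u x * bump a b n x \<partial>?M)"
        using H1_weakD(3)[OF u, of i, unfolded is_weak_deriv_def, rule_format, OF test_fun_bumpD[OF ab, of n "\<lambda>_. 0"]]
        by (simp only:) simp
      then show "(\<integral>x. U x * bumpD a b n ((\<lambda>_. 0)(i := 1)) x \<partial>lborel) = - (\<integral>x. (\<chi> i. G i x) $ i * bump a b n x \<partial>lborel)"
        using U(5)[OF bumpD_continuous] G(5)[OF bumpD_continuous] by simp
    qed (use U in auto)
  qed
qed

lemma measure_open_bounded_pos:
  fixes \<Omega> :: "(real^'n) set"
  assumes "open \<Omega>" "bounded \<Omega>" "\<Omega> \<noteq> {}"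
  shows "measure lebesgue \<Omega> > 0"
proof -
  obtain \<beta> where "\<beta> > 0" "emeasure lborel \<Omega> = ennreal \<beta>" using emeasure_bounded_open[OF assms] .
  moreover have "emeasure lebesgue \<Omega> = emeasure lborel \<Omega>" using assms by simp
  ultimately show ?thesis by (simp add: measure_def)
qed

text \<open>For a function of mean zero the cross term of \<open>(u - m)^2\<close> integrates to 0.
  Whatever constant \<open>m\<close> the inequality delivers, dropping it only decreases the
  integral.\<close>

theorem poincare_H1_diamond:
  fixes \<Omega> :: "(real^'n) set"
  assumes dom: "lipschitz_domain \<Omega>" "connected \<Omega>" "\<Omega> \<noteq> {}"
  obtains K where "K \<ge> 0" "\<And>u. u \<in> H1_diamond \<Omega> \<Longrightarrow>
     (\<integral>x. (u x)^2 \<partial>lebesgue_on \<Omega>) \<le> K * dirichlet \<Omega> u"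
proof -
  let ?M = "lebesgue_on \<Omega>"
  have \<Omega>: "open \<Omega>" "bounded \<Omega>" using dom by (auto simp: lipschitz_domain_def)
  obtain K where K: "K \<ge> 0" "\<And>u g. wpair \<Omega> u g \<Longrightarrow> \<exists>m. (\<integral>\<^sup>+x. indicator \<Omega> x * ennreal ((u x - m)^2) \<partial>lborel)
        \<le> ennreal K * energy g"
    using poincare_lipschitz_domain[OF dom] unfolding poincare_set_def by blast
  show thesis
  proof (rule that[OF K(1)])
    fix u assume "u \<in> H1_diamond \<Omega>"
    then have u: "u \<in> H1 \<Omega>" "(\<integral>x. u x \<partial>?M) = 0" by (auto simp: H1_diamond_def)
    obtain U G where wp: "wpair \<Omega> U G" and U: "AE x in ?M. u x = U x" "\<And>x. x \<notin> \<Omega> \<Longrightarrow> U x = 0"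
      and G: "AE x in ?M. wgrad \<Omega> u x = G x" "\<And>x. x \<notin> \<Omega> \<Longrightarrow> G x = 0"
      using wpair_of_H1[OF \<Omega> u(1)] by blast
    have Um[measurable]: "U \<in> borel_measurable borel" and Gm[measurable]: "G \<in> borel_measurable borel"
      and G2: "integrable lborel (\<lambda>x. (norm (G x))^2)" using wp by (auto simp: wpair_def)
    have [measurable]: "\<Omega> \<in> sets borel" using \<Omega> by simp
    obtain m where m: "(\<integral>\<^sup>+x. indicator \<Omega> x * ennreal ((U x - m)^2) \<partial>lborel)
        \<le> ennreal K * energy G" using K(2)[OF wp] by blast
    note [measurable] = L2_onD(1)[OF H1_weakD(1)[OF u(1)]]
    have um: "L2_on \<Omega> (\<lambda>x. u x - m)" by (intro L2_on_diff H1_weakD[OF u(1)] L2_on_const \<Omega>)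
    have fm[measurable]: "(\<lambda>x. indicator \<Omega> x * (U x - m)^2) \<in> borel_measurable borel" by measurable
    note [measurable] = borel_measurable_lebesgue_onI[OF fm]
    have AEeq: "AE x in ?M. (u x - m)^2 = indicator \<Omega> x * (U x - m)^2"
      using U(1) AE_space by eventually_elim (auto simp: space_restrict_space)
    have int1: "integrable ?M (\<lambda>x. indicator \<Omega> x * (U x - m)^2)"
      by (rule integrable_cong_AE_imp[OF L2_onD(2)[OF um]]) (use AEeq in auto)
    have int2: "integrable lborel (\<lambda>x. indicator \<Omega> x * (U x - m)^2)"
      using int1 lborel_integral_eq_lebesgue_on(2)[OF \<Omega>(1) fm] by simp
    have "(\<integral>x. (u x - m)^2 \<partial>?M) = (\<integral>x. indicator \<Omega> x * (U x - m)^2 \<partial>?M)"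
      by (rule integral_cong_AE) (use AEeq in auto)
    also have "\<dots> = (\<integral>x. indicator \<Omega> x * (U x - m)^2 \<partial>lborel)"
      by (intro lborel_integral_eq_lebesgue_on(1)[OF \<Omega>(1) fm]) simp
    finally have e1: "(\<integral>x. (u x - m)^2 \<partial>?M) = (\<integral>x. indicator \<Omega> x * (U x - m)^2 \<partial>lborel)" .
    have gm: "(\<lambda>x. (norm (G x))^2) \<in> borel_measurable borel" by measurable
    have "dirichlet \<Omega> u = (\<integral>x. (norm (G x))^2 \<partial>?M)"
    proof (rule integral_cong_AE)
      show "(\<lambda>x. (norm (wgrad \<Omega> u x))^2) \<in> borel_measurable ?M"
        using H1_grad_square_integrable[OF u(1)] by (rule borel_measurable_integrable)
      show "(\<lambda>x. (norm (G x))^2) \<in> borel_measurable ?M" by (rule borel_measurable_lebesgue_onI[OF gm])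
      show "AE x in ?M. (norm (wgrad \<Omega> u x))^2 = (norm (G x))^2" using G(1) by eventually_elim simp
    qed
    also have "\<dots> = (\<integral>x. (norm (G x))^2 \<partial>lborel)"
      by (intro lborel_integral_eq_lebesgue_on(1)[OF \<Omega>(1) gm]) (simp add: G)
    finally have e2: "dirichlet \<Omega> u = (\<integral>x. (norm (G x))^2 \<partial>lborel)" .
    have "ennreal (\<integral>x. indicator \<Omega> x * (U x - m)^2 \<partial>lborel) = (\<integral>\<^sup>+x. ennreal (indicator \<Omega> x * (U x - m)^2) \<partial>lborel)"
      by (rule nn_integral_eq_integral[OF int2, symmetric]) auto
    also have "\<dots> = (\<integral>\<^sup>+x. indicator \<Omega> x * ennreal ((U x - m)^2) \<partial>lborel)"
      by (intro nn_integral_cong) (auto simp: indicator_def)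
    also have "\<dots> \<le> ennreal K * ennreal (\<integral>x. (norm (G x))^2 \<partial>lborel)"
      using m nn_integral_eq_integral[OF G2] by simp
    also have "\<dots> = ennreal (K * (\<integral>x. (norm (G x))^2 \<partial>lborel))" using K by (simp add: ennreal_mult)
    finally have le: "(\<integral>x. (u x - m)^2 \<partial>?M) \<le> K * dirichlet \<Omega> u"
      unfolding e1 e2 using K by (subst (asm) ennreal_le_iff) auto
    have "(\<integral>x. (u x - m)^2 \<partial>?M) = (\<integral>x. (u x)^2 - 2 * m * u x + m^2 \<partial>?M)"
      by (simp add: power2_diff algebra_simps)
    also have "\<dots> = (\<integral>x. (u x)^2 \<partial>?M) - 2 * m * (\<integral>x. u x \<partial>?M) + (\<integral>x. m^2 \<partial>?M)"
    proof -
      have i: "integrable ?M (\<lambda>x. (u x)^2)" "integrable ?M (\<lambda>x. 2 * m * u x)"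
        "integrable ?M (\<lambda>x. m^2)"
        using L2_onD(2)[OF H1_weakD(1)[OF u(1)]] L2_on_integrable[OF \<Omega> H1_weakD(1)[OF u(1)]]
          L2_on_integrable[OF \<Omega> L2_on_const[OF \<Omega>, of "m^2"]] by (auto intro: integrable_mult_right)
      show ?thesis
        unfolding Bochner_Integration.integral_add[OF Bochner_Integration.integrable_diff[OF i(1,2)] i(3)]
          Bochner_Integration.integral_diff[OF i(1,2)] integral_mult_right_zero ..
    qed
    also have "\<dots> \<ge> (\<integral>x. (u x)^2 \<partial>?M)"
    proof -
      have "0 \<le> (\<integral>x. m^2 \<partial>?M)" by (rule integral_nonneg_AE) simp
      then show ?thesis unfolding u(2) by linarith
    qed
    finally show "(\<integral>x. (u x)^2 \<partial>?M) \<le> K * dirichlet \<Omega> u"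
      using le by linarith
  qed
qed

lemma L2_limit_integral:
  fixes f :: "nat \<Rightarrow> real^'n \<Rightarrow> real"
  assumes f: "\<And>n. L2_on \<Omega> (f n)" and g: "L2_on \<Omega> g" and k: "L2_on \<Omega> k"
    and lim: "(\<lambda>n. \<integral>x. (f n x - g x)^2 \<partial>lebesgue_on \<Omega>) \<longlonglongrightarrow> 0"
  shows "(\<lambda>n. \<integral>x. f n x * k x \<partial>lebesgue_on \<Omega>) \<longlonglongrightarrow> (\<integral>x. g x * k x \<partial>lebesgue_on \<Omega>)"
proof -
  let ?M = "lebesgue_on \<Omega>"
  have eq: "(\<integral>x. (f n x - g x) * k x \<partial>?M) = (\<integral>x. f n x * k x \<partial>?M) - (\<integral>x. g x * k x \<partial>?M)" for n
    using L2_on_mult[OF f k, of n] L2_on_mult[OF g k] by (simp add: left_diff_distrib)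
  have "(\<lambda>n. ((\<integral>x. f n x * k x \<partial>?M) - (\<integral>x. g x * k x \<partial>?M))^2) \<longlonglongrightarrow> 0"
  proof (rule tendsto_sandwich[OF _ _ tendsto_const])
    show "\<forall>\<^sub>F n in sequentially. ((\<integral>x. f n x * k x \<partial>?M) - (\<integral>x. g x * k x \<partial>?M))^2
       \<le> (\<integral>x. (f n x - g x)^2 \<partial>?M) * (\<integral>x. (k x)^2 \<partial>?M)"
      unfolding eq[symmetric]
      by (intro always_eventually allI Cauchy_Schwarz_integral L2_onD[OF L2_on_diff[OF f g]] L2_onD[OF k])
    show "(\<lambda>n. (\<integral>x. (f n x - g x)^2 \<partial>?M) * (\<integral>x. (k x)^2 \<partial>?M)) \<longlonglongrightarrow> 0"
      using tendsto_mult_right[OF lim] by simp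
  qed simp
  from tendsto_real_sqrt[OF this]
  have "(\<lambda>n. (\<integral>x. f n x * k x \<partial>?M) - (\<integral>x. g x * k x \<partial>?M)) \<longlonglongrightarrow> 0"
    by (simp add: tendsto_rabs_zero_iff)
  then show ?thesis by (simp add: LIM_zero_iff)
qed

text \<open>By the Poincare inequality a sequence that is Cauchy in the gradient seminorm is Cauchy in \<open>L\<^sup>2\<close>.\<close>
lemma H1_diamond_complete:
  fixes \<Omega> :: "(real^'n) set" and f :: "nat \<Rightarrow> real^'n \<Rightarrow> real"
  assumes dom: "lipschitz_domain \<Omega>" "connected \<Omega>" "\<Omega> \<noteq> {}"
    and f: "\<And>n. f n \<in> H1_diamond \<Omega>"
    and cauchy: "\<And>\<epsilon>. \<epsilon> > 0 \<Longrightarrow> \<exists>N. \<forall>m\<ge>N. \<forall>n\<ge>N. (\<integral>x. (norm (wgrad \<Omega> (\<lambda>x. f m x + (-1) * f n x) x))^2 \<partial>lebesgue_on \<Omega>) < \<epsilon>"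
  shows "\<exists>u\<in>H1_diamond \<Omega>. (\<lambda>n. \<integral>x. (norm (wgrad \<Omega> (\<lambda>x. f n x + (-1) * u x) x))^2 \<partial>lebesgue_on \<Omega>) \<longlonglongrightarrow> 0"
proof -
  let ?M = "lebesgue_on \<Omega>"
  have \<Omega>: "open \<Omega>" "bounded \<Omega>" using dom by (auto simp: lipschitz_domain_def)
  obtain K where K: "K \<ge> 0" "\<And>u. u \<in> H1_diamond \<Omega> \<Longrightarrow>
     (\<integral>x. (u x)^2 \<partial>?M) \<le> K * dirichlet \<Omega> u"
    using poincare_H1_diamond[OF dom] by blast
  have fH: "f n \<in> H1 \<Omega>" and f0: "(\<integral>x. f n x \<partial>?M) = 0" for n using f[of n] by (auto simp: H1_diamond_def)
  note fL = H1_weakD[OF fH]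
  \<comment> \<open>Up to a null set the gradient of a difference is the difference of the chosen
    gradients, so the seminorm splits into componentwise \<open>L2\<close> distances.\<close>
  have grad: "(\<integral>x. (norm (wgrad \<Omega> (\<lambda>x. p x + (-1) * q x) x))^2 \<partial>?M)
     = (\<Sum>i\<in>UNIV. \<integral>x. (weakD \<Omega> [i] p x - weakD \<Omega> [i] q x)^2 \<partial>?M)" if p: "p \<in> H1 \<Omega>" and q: "q \<in> H1 \<Omega>" for p q
  proof -
    have "(\<integral>x. (norm (wgrad \<Omega> (\<lambda>x. p x + (-1) * q x) x))^2 \<partial>?M)
       = (\<integral>x. (\<Sum>i\<in>UNIV. (weakD \<Omega> [i] p x - weakD \<Omega> [i] q x)^2) \<partial>?M)"
    proof (rule integral_cong_AE)
      show "(\<lambda>x. (norm (wgrad \<Omega> (\<lambda>x. p x + (-1) * q x) x))^2) \<in> borel_measurable ?M"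
        by (intro borel_measurable_integrable H1_grad_square_integrable H1_comb \<Omega> p q)
      show "(\<lambda>x. \<Sum>i\<in>UNIV. (weakD \<Omega> [i] p x - weakD \<Omega> [i] q x)^2) \<in> borel_measurable ?M"
        using L2_onD(1)[OF H1_weakD(2)[OF p]] L2_onD(1)[OF H1_weakD(2)[OF q]] by measurable
      show "AE x in ?M. (norm (wgrad \<Omega> (\<lambda>x. p x + (-1) * q x) x))^2 = (\<Sum>i\<in>UNIV. (weakD \<Omega> [i] p x - weakD \<Omega> [i] q x)^2)"
        using H1_comb(2)[OF \<Omega> p q, of "-1"]
      proof eventually_elim
        case (elim x)
        then show ?case by (simp only:) (simp add: norm_square_vec wgrad_def)
      qed
    qed
    also have "\<dots> = (\<Sum>i\<in>UNIV. \<integral>x. (weakD \<Omega> [i] p x - weakD \<Omega> [i] q x)^2 \<partial>?M)"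
      by (intro Bochner_Integration.integral_sum L2_onD(2) L2_on_diff H1_weakD(2) p q)
    finally show ?thesis .
  qed
  have ex: "\<exists>g. g \<in> borel_measurable ?M \<and> integrable ?M (\<lambda>x. (g x)^2) \<and>
     (\<lambda>n. \<integral>x. (weakD \<Omega> [i] (f n) x - g x)^2 \<partial>?M) \<longlonglongrightarrow> 0" for i
  proof (rule L2_complete)
    fix \<epsilon> :: real assume "\<epsilon> > 0"
    then obtain N where N: "\<forall>m\<ge>N. \<forall>n\<ge>N. (\<integral>x. (norm (wgrad \<Omega> (\<lambda>x. f m x + (-1) * f n x) x))^2 \<partial>?M) < \<epsilon>"
      using cauchy by blast
    have "(\<integral>x. (weakD \<Omega> [i] (f m) x - weakD \<Omega> [i] (f n) x)^2 \<partial>?M) < \<epsilon>" if "m \<ge> N" "n \<ge> N" for m n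
    proof -
      have "(\<integral>x. (weakD \<Omega> [i] (f m) x - weakD \<Omega> [i] (f n) x)^2 \<partial>?M)
        \<le> (\<Sum>i\<in>UNIV. \<integral>x. (weakD \<Omega> [i] (f m) x - weakD \<Omega> [i] (f n) x)^2 \<partial>?M)"
        by (rule member_le_sum[where f = "\<lambda>i. \<integral>x. (weakD \<Omega> [i] (f m) x - weakD \<Omega> [i] (f n) x)^2 \<partial>?M"]) auto
      then show ?thesis using N that unfolding grad[OF fH fH] by (meson le_less_trans)
    qed
    then show "\<exists>N. \<forall>m\<ge>N. \<forall>n\<ge>N. (\<integral>x. (weakD \<Omega> [i] (f m) x - weakD \<Omega> [i] (f n) x)^2 \<partial>?M) < \<epsilon>" by blast
  qed (use L2_onD[OF fL(2)] in auto)
  from choice[OF allI[OF ex]] obtain g where g: "\<forall>i. g i \<in> borel_measurable ?M \<and> integrable ?M (\<lambda>x. (g i x)^2) \<and>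
     (\<lambda>n. \<integral>x. (weakD \<Omega> [i] (f n) x - g i x)^2 \<partial>?M) \<longlonglongrightarrow> 0" by (rule exE)
  have gL: "L2_on \<Omega> (g i)" and glim: "(\<lambda>n. \<integral>x. (weakD \<Omega> [i] (f n) x - g i x)^2 \<partial>?M) \<longlonglongrightarrow> 0" for i
    using g[rule_format, of i] by (simp_all add: L2_on_def)
  have "\<exists>u. u \<in> borel_measurable ?M \<and> integrable ?M (\<lambda>x. (u x)^2) \<and>
     (\<lambda>n. \<integral>x. (f n x - u x)^2 \<partial>?M) \<longlonglongrightarrow> 0"
  proof (rule L2_complete)
    fix \<epsilon> :: real assume \<epsilon>: "\<epsilon> > 0"
    \<comment> \<open>Dividing by \<open>K + 1\<close> instead of \<open>K\<close> covers the case
      \<open>K = 0\<close>.\<close>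
    then obtain N where N: "\<forall>m\<ge>N. \<forall>n\<ge>N. (\<integral>x. (norm (wgrad \<Omega> (\<lambda>x. f m x + (-1) * f n x) x))^2 \<partial>?M) < \<epsilon> / (K + 1)"
      using cauchy[of "\<epsilon> / (K + 1)"] K by auto
    have "(\<integral>x. (f m x - f n x)^2 \<partial>?M) < \<epsilon>" if "m \<ge> N" "n \<ge> N" for m n
    proof -
      let ?d = "\<lambda>x. f m x + (-1) * f n x"
      let ?I = "\<integral>x. (norm (wgrad \<Omega> ?d x))^2 \<partial>?M"
      have "?d \<in> H1_diamond \<Omega>"
        using H1_comb(1)[OF \<Omega> fH fH, of m "-1" n] f0 L2_on_integrable[OF \<Omega> fL(1)] by (simp add: H1_diamond_def)
      from K(2)[OF this] have "(\<integral>x. (f m x - f n x)^2 \<partial>?M) \<le> K * ?I" by simp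
      also have "\<dots> \<le> (K + 1) * ?I" by (intro mult_right_mono) auto
      also have "\<dots> < (K + 1) * (\<epsilon> / (K + 1))" using N that K by (intro mult_strict_left_mono) auto
      also have "\<dots> = \<epsilon>" using K by simp
      finally show ?thesis .
    qed
    then show "\<exists>N. \<forall>m\<ge>N. \<forall>n\<ge>N. (\<integral>x. (f m x - f n x)^2 \<partial>?M) < \<epsilon>" by blast
  qed (use L2_onD[OF fL(1)] in auto)
  then obtain u where u0: "u \<in> borel_measurable ?M" "integrable ?M (\<lambda>x. (u x)^2)" and ulim: "(\<lambda>n. \<integral>x. (f n x - u x)^2 \<partial>?M) \<longlonglongrightarrow> 0"
    by blast
  have u: "L2_on \<Omega> u" using u0 by (simp add: L2_on_def)
  \<comment> \<open>For a fixed test function both sides of the defining identity are continuous in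
    \<open>L2\<close>, so the limits of the partial derivatives are the partial derivatives of the
    limit.\<close>
  have wd: "is_weak_deriv \<Omega> [i] u (g i)" for i
    unfolding is_weak_deriv_def
  proof (intro allI impI)
    fix \<phi> assume \<phi>: "test_fun \<Omega> \<phi>"
    have "(\<lambda>n. \<integral>x. f n x * pdiffs [i] \<phi> x \<partial>?M) \<longlonglongrightarrow> (\<integral>x. u x * pdiffs [i] \<phi> x \<partial>?M)"
      by (intro L2_limit_integral fL u L2_on_test_fun \<Omega> \<phi> ulim)
    moreover have "(\<lambda>n. \<integral>x. weakD \<Omega> [i] (f n) x * pdiffs [] \<phi> x \<partial>?M) \<longlonglongrightarrow> (\<integral>x. g i x * pdiffs [] \<phi> x \<partial>?M)"
      by (intro L2_limit_integral fL gL L2_on_test_fun \<Omega> \<phi> glim)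
    then have "(\<lambda>n. (-1) ^ length [i] * (\<integral>x. weakD \<Omega> [i] (f n) x * \<phi> x \<partial>?M)) \<longlonglongrightarrow> (-1) ^ length [i] * (\<integral>x. g i x * \<phi> x \<partial>?M)"
      by (intro tendsto_mult_left) simp
    moreover have "(\<integral>x. f n x * pdiffs [i] \<phi> x \<partial>?M) = (-1) ^ length [i] * (\<integral>x. weakD \<Omega> [i] (f n) x * \<phi> x \<partial>?M)" for n
      using fL(3)[of i n, unfolded is_weak_deriv_def, rule_format, OF \<phi>] .
    ultimately show "(\<integral>x. u x * pdiffs [i] \<phi> x \<partial>?M) = (-1) ^ length [i] * (\<integral>x. g i x * \<phi> x \<partial>?M)"
      using LIMSEQ_unique by auto
  qed
  have uH: "u \<in> H1 \<Omega>" unfolding H1_iff using u wd gL by blast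
  \<comment> \<open>Pairing with the constant 1 shows that the limit has mean zero.\<close>
  have "(\<lambda>n. \<integral>x. f n x * 1 \<partial>?M) \<longlonglongrightarrow> (\<integral>x. u x * 1 \<partial>?M)"
    by (intro L2_limit_integral fL u L2_on_const \<Omega> ulim)
  then have "(\<integral>x. u x \<partial>?M) = 0" by (simp add: f0 LIMSEQ_const_iff)
  then have uD: "u \<in> H1_diamond \<Omega>" using uH by (simp add: H1_diamond_def)
  have eq: "(\<integral>x. (weakD \<Omega> [i] (f n) x - weakD \<Omega> [i] u x)^2 \<partial>?M) = (\<integral>x. (weakD \<Omega> [i] (f n) x - g i x)^2 \<partial>?M)" for i n
  proof (rule integral_cong_AE)
    show "(\<lambda>x. (weakD \<Omega> [i] (f n) x - weakD \<Omega> [i] u x)^2) \<in> borel_measurable ?M"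
      by (intro borel_measurable_integrable L2_onD(2) L2_on_diff fL H1_weakD uH)
    show "(\<lambda>x. (weakD \<Omega> [i] (f n) x - g i x)^2) \<in> borel_measurable ?M"
      by (intro borel_measurable_integrable L2_onD(2) L2_on_diff fL gL)
    show "AE x in ?M. (weakD \<Omega> [i] (f n) x - weakD \<Omega> [i] u x)^2 = (weakD \<Omega> [i] (f n) x - g i x)^2"
      using weakD_AE_eq[OF \<Omega> gL wd, of i] by eventually_elim simp
  qed
  have "(\<lambda>n. \<integral>x. (norm (wgrad \<Omega> (\<lambda>x. f n x + (-1) * u x) x))^2 \<partial>?M) \<longlonglongrightarrow> (\<Sum>i\<in>(UNIV::'n set). 0)"
    unfolding grad[OF fH uH] eq by (intro tendsto_sum glim)
  then show ?thesis using uD by auto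
qed

section \<open>Solvability of the Neumann problem\<close>

lemma weighted_integrable:
  fixes w f :: "'a \<Rightarrow> real"
  assumes w: "w \<in> borel_measurable M" "0 < c" "AE x in M. c \<le> w x \<and> w x \<le> C" and f: "integrable M f"
  shows "integrable M (\<lambda>x. f x * w x)"
proof (rule Bochner_Integration.integrable_bound)
  show "integrable M (\<lambda>x. C * f x)" using f by simp
  show "(\<lambda>x. f x * w x) \<in> borel_measurable M" using w f by simp
  show "AE x in M. norm (f x * w x) \<le> norm (C * f x)"
    using w(3)
  proof eventually_elim
    case (elim x)
    then have "\<bar>w x\<bar> \<le> \<bar>C\<bar>" using \<open>0 < c\<close> by auto
    then show ?case by (simp add: abs_mult mult.commute[of "\<bar>C\<bar>"] mult_left_mono)
  qed
qed

lemma weighted_integral_bounds: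
  fixes w f :: "'a \<Rightarrow> real"
  assumes w: "w \<in> borel_measurable M" "0 < c" "AE x in M. c \<le> w x \<and> w x \<le> C" and f: "integrable M f" "\<And>x. f x \<ge> 0"
  shows "c * (\<integral>x. f x \<partial>M) \<le> (\<integral>x. f x * w x \<partial>M)" "(\<integral>x. f x * w x \<partial>M) \<le> C * (\<integral>x. f x \<partial>M)"
proof -
  note i = weighted_integrable[OF w f(1)]
  have "(\<integral>x. f x * c \<partial>M) \<le> (\<integral>x. f x * w x \<partial>M)"
    by (rule integral_mono_AE) (use i f w(3) in \<open>auto intro!: mult_left_mono intro: eventually_mono[OF w(3)]\<close>)
  then show "c * (\<integral>x. f x \<partial>M) \<le> (\<integral>x. f x * w x \<partial>M)" by (simp add: mult.commute)
  have "(\<integral>x. f x * w x \<partial>M) \<le> (\<integral>x. f x * C \<partial>M)"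
    by (rule integral_mono_AE) (use i f w(3) in \<open>auto intro!: mult_left_mono intro: eventually_mono[OF w(3)]\<close>)
  then show "(\<integral>x. f x * w x \<partial>M) \<le> C * (\<integral>x. f x \<partial>M)" by (simp add: mult.commute)
qed

lemma L2_on_weighted:
  assumes w: "w \<in> borel_measurable (lebesgue_on \<Omega>)" "0 < c" "AE x in lebesgue_on \<Omega>. c \<le> w x \<and> w x \<le> C"
    and f: "L2_on \<Omega> f"
  shows "L2_on \<Omega> (\<lambda>x. f x * w x)"
  unfolding L2_on_def
proof
  show "(\<lambda>x. f x * w x) \<in> borel_measurable (lebesgue_on \<Omega>)" using w L2_onD[OF f] by simp
  have "integrable (lebesgue_on \<Omega>) (\<lambda>x. (f x)^2 * w x * w x)"
    by (intro weighted_integrable[OF w] L2_onD(2) f)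
  then show "integrable (lebesgue_on \<Omega>) (\<lambda>x. (f x * w x)^2)"
    by (simp add: power2_eq_square ac_simps)
qed

lemma wdens_measurable:
  assumes "L2_on \<Omega> h"
  shows "wdens \<Omega> h \<in> borel_measurable (lebesgue_on \<Omega>)"
  unfolding wdens_def using L2_onD(1)[OF assms] by measurable

text \<open>The bounds on the density make the weighted form equivalent to the Dirichlet form. The
  Poincare inequality is used twice: it bounds the right-hand side by the form, and it gives
  completeness of \<open>H1_diamond\<close> in the gradient seminorm.\<close>

theorem psi_sol_exists:
  fixes \<Omega> :: "(real^'n) set"
  assumes dom: "lipschitz_domain \<Omega>" "connected \<Omega>" "\<Omega> \<noteq> {}"
    and h: "L2_on \<Omega> h" and \<xi>: "L2_on \<Omega> \<xi>"
    and c: "0 < c" and bd: "AE x in lebesgue_on \<Omega>. c \<le> wdens \<Omega> h x \<and> wdens \<Omega> h x \<le> C"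
  shows "\<exists>\<psi>. psi_sol \<Omega> h \<xi> \<psi>"
proof -
  let ?M = "lebesgue_on \<Omega>"
  have \<Omega>: "open \<Omega>" "bounded \<Omega>" using dom by (auto simp: lipschitz_domain_def)
  define w where "w = wdens \<Omega> h"
  define V where "V = measure lebesgue \<Omega>"
  have V: "V > 0" unfolding V_def by (rule measure_open_bounded_pos[OF \<Omega> dom(3)])
  have w: "w \<in> borel_measurable ?M" "0 < c" "AE x in ?M. c \<le> w x \<and> w x \<le> C"
    using wdens_measurable[OF h] c bd by (auto simp: w_def)
  have rho: "rho_int \<Omega> h f = (\<integral>x. f x * w x \<partial>?M) / V" for f
    by (simp add: rho_int_def nu0_int_def w_def V_def)
  obtain K where K: "K \<ge> 0" "\<And>u. u \<in> H1_diamond \<Omega> \<Longrightarrow>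
     (\<integral>x. (u x)^2 \<partial>?M) \<le> K * dirichlet \<Omega> u"
    using poincare_H1_diamond[OF dom] by blast
  define z where "z x = \<xi> x - rho_int \<Omega> h \<xi>" for x
  have z: "L2_on \<Omega> z" unfolding z_def by (intro L2_on_diff \<xi> L2_on_const \<Omega>)
  note zw = L2_on_weighted[OF w z]
  let ?comb = "\<lambda>u c v x. u x + c * v x :: real"
  let ?B = "\<lambda>u v. rho_int \<Omega> h (\<lambda>x. wgrad \<Omega> u x \<bullet> wgrad \<Omega> v x)"
  let ?l = "\<lambda>u. rho_int \<Omega> h (\<lambda>x. z x * u x)"
  let ?A = "\<integral>x. (z x * w x)^2 \<partial>?M"
  have HD: "u \<in> H1 \<Omega>" "L2_on \<Omega> u" "(\<integral>x. u x \<partial>?M) = 0" if "u \<in> H1_diamond \<Omega>" for u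
    using that H1_weakD(1) by (auto simp: H1_diamond_def)
  have gi: "integrable ?M (\<lambda>x. (wgrad \<Omega> u x \<bullet> wgrad \<Omega> v x) * w x)"
    if "u \<in> H1_diamond \<Omega>" "v \<in> H1_diamond \<Omega>" for u v
    by (intro weighted_integrable[OF w] H1_grad_inner_integrable HD that)
  have Bnorm: "c / V * dirichlet \<Omega> u \<le> ?B u u"
    "?B u u \<le> C / V * dirichlet \<Omega> u" if "u \<in> H1_diamond \<Omega>" for u
    using weighted_integral_bounds[OF w H1_grad_square_integrable[OF HD(1)[OF that]]] V
    by (auto simp: rho power2_norm_eq_inner divide_right_mono)
  have "\<exists>\<psi>\<in>H1_diamond \<Omega>. \<forall>\<eta>\<in>H1_diamond \<Omega>. ?B \<psi> \<eta> = ?l \<eta>"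
  \<comment> \<open>Cauchy-Schwarz brings in \<open>?A\<close>, the Poincare inequality
    \<open>K\<close>, and the lower bound on the density \<open>V / c\<close>; two factors
    \<open>1 / V\<close> come from squaring the normalised integral.\<close>
  proof (rule riesz_semi_inner_product[where comb = ?comb and K = "?A * K / (c * V)"])
    show "H1_diamond \<Omega> \<noteq> {}" using H1_const(1)[OF \<Omega>, of 0] by (auto simp: H1_diamond_def)
    show combD: "?comb u a v \<in> H1_diamond \<Omega>" if "u \<in> H1_diamond \<Omega>" "v \<in> H1_diamond \<Omega>" for u a v
      using H1_comb(1)[OF \<Omega> HD(1)[OF that(1)] HD(1)[OF that(2)], of a] HD[OF that(1)] HD[OF that(2)]
        L2_on_integrable[OF \<Omega> HD(2)[OF that(1)]] L2_on_integrable[OF \<Omega> HD(2)[OF that(2)]]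
      by (simp add: H1_diamond_def)
    show "?B u v = ?B v u" for u v by (simp add: inner_commute)
    show "?B (?comb u a v) y = ?B u y + a * ?B v y"
      if "u \<in> H1_diamond \<Omega>" "v \<in> H1_diamond \<Omega>" "y \<in> H1_diamond \<Omega>" for u v y a
    proof -
      have "(\<integral>x. (wgrad \<Omega> (?comb u a v) x \<bullet> wgrad \<Omega> y x) * w x \<partial>?M)
        = (\<integral>x. (wgrad \<Omega> u x \<bullet> wgrad \<Omega> y x) * w x + a * ((wgrad \<Omega> v x \<bullet> wgrad \<Omega> y x) * w x) \<partial>?M)"
      proof (rule integral_cong_AE)
        show "AE x in ?M. (wgrad \<Omega> (?comb u a v) x \<bullet> wgrad \<Omega> y x) * w x =
           (wgrad \<Omega> u x \<bullet> wgrad \<Omega> y x) * w x + a * ((wgrad \<Omega> v x \<bullet> wgrad \<Omega> y x) * w x)"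
          using H1_comb(2)[OF \<Omega> HD(1)[OF that(1)] HD(1)[OF that(2)], of a]
          by eventually_elim (simp add: inner_add_left algebra_simps)
        show "(\<lambda>x. (wgrad \<Omega> (?comb u a v) x \<bullet> wgrad \<Omega> y x) * w x) \<in> borel_measurable ?M"
          by (rule borel_measurable_integrable[OF gi[OF combD[OF that(1,2)] that(3)]])
        show "(\<lambda>x. (wgrad \<Omega> u x \<bullet> wgrad \<Omega> y x) * w x + a * ((wgrad \<Omega> v x \<bullet> wgrad \<Omega> y x) * w x)) \<in> borel_measurable ?M"
          by (intro borel_measurable_integrable Bochner_Integration.integrable_add integrable_mult_right gi that)
      qed
      also have "\<dots> = (\<integral>x. (wgrad \<Omega> u x \<bullet> wgrad \<Omega> y x) * w x \<partial>?M) + a * (\<integral>x. (wgrad \<Omega> v x \<bullet> wgrad \<Omega> y x) * w x \<partial>?M)"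
        using Bochner_Integration.integral_add[OF gi[OF that(1,3)] integrable_mult_right[OF gi[OF that(2,3)], of a]]
        by (simp only: integral_mult_right_zero)
      finally show ?thesis unfolding rho by (simp add: add_divide_distrib)
    qed
    show pos: "?B u u \<ge> 0" if "u \<in> H1_diamond \<Omega>" for u
    proof -
      have "0 \<le> c / V * dirichlet \<Omega> u" using c V by simp
      then show ?thesis using Bnorm(1)[OF that] by linarith
    qed
    have zi: "integrable ?M (\<lambda>x. z x * u x * w x)" if "u \<in> H1_diamond \<Omega>" for u
      by (intro weighted_integrable[OF w] L2_on_mult z HD that)
    show "?l (?comb u a v) = ?l u + a * ?l v" if "u \<in> H1_diamond \<Omega>" "v \<in> H1_diamond \<Omega>" for u a v
    proof -
      have "(\<integral>x. z x * ?comb u a v x * w x \<partial>?M) = (\<integral>x. z x * u x * w x + a * (z x * v x * w x) \<partial>?M)"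
        by (simp add: algebra_simps)
      also have "\<dots> = (\<integral>x. z x * u x * w x \<partial>?M) + a * (\<integral>x. z x * v x * w x \<partial>?M)"
        using Bochner_Integration.integral_add[OF zi[OF that(1)] integrable_mult_right[OF zi[OF that(2)], of a]]
        by (simp only: integral_mult_right_zero)
      finally show ?thesis unfolding rho by (simp add: add_divide_distrib)
    qed
    show "0 \<le> ?A * K / (c * V)" using K c V by simp
    show "(?l u)^2 \<le> ?A * K / (c * V) * ?B u u" if "u \<in> H1_diamond \<Omega>" for u
    proof -
      let ?N = "\<integral>x. (norm (wgrad \<Omega> u x))^2 \<partial>?M"
      have "(\<integral>x. z x * w x * u x \<partial>?M)^2 \<le> ?A * (\<integral>x. (u x)^2 \<partial>?M)"
        by (intro Cauchy_Schwarz_integral L2_onD[OF zw] L2_onD[OF HD(2)[OF that]])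
      also have "\<dots> \<le> ?A * (K * ?N)" by (intro mult_left_mono K(2) that) simp
      also have "?N \<le> V / c * ?B u u" using Bnorm(1)[OF that] c V by (simp add: field_simps)
      then have "?A * (K * ?N) \<le> ?A * (K * (V / c * ?B u u))"
        using K by (intro mult_left_mono) auto
      finally have le: "(\<integral>x. z x * w x * u x \<partial>?M)^2 \<le> ?A * (K * (V / c * ?B u u))" .
      have "(?l u)^2 = (\<integral>x. z x * w x * u x \<partial>?M)^2 / V^2"
        by (simp add: rho power_divide ac_simps)
      also have "\<dots> \<le> ?A * (K * (V / c * ?B u u)) / V^2" using le by (intro divide_right_mono) auto
      also have "\<dots> = ?A * K / (c * V) * ?B u u" using V by (simp add: power2_eq_square)
      finally show ?thesis .
    qed
    fix f :: "nat \<Rightarrow> real^'n \<Rightarrow> real"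
    assume f: "\<And>n. f n \<in> H1_diamond \<Omega>"
      and cau: "\<And>\<epsilon>. \<epsilon> > 0 \<Longrightarrow> \<exists>N. \<forall>m\<ge>N. \<forall>n\<ge>N. ?B (?comb (f m) (-1) (f n)) (?comb (f m) (-1) (f n)) < \<epsilon>"
    \<comment> \<open>The lower bound on the density turns the Cauchy condition for
      \<open>?B\<close> into one for the Dirichlet form; the upper bound later turns convergence
      back.\<close>
    have "\<exists>u\<in>H1_diamond \<Omega>. (\<lambda>n. \<integral>x. (norm (wgrad \<Omega> (?comb (f n) (-1) u) x))^2 \<partial>?M) \<longlonglongrightarrow> 0"
    proof (rule H1_diamond_complete[OF dom f])
      fix \<epsilon> :: real assume "\<epsilon> > 0"
      then have "c / V * \<epsilon> > 0" using c V by simp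
      from cau[OF this] obtain N where N: "\<And>m n. m \<ge> N \<Longrightarrow> n \<ge> N \<Longrightarrow> ?B (?comb (f m) (-1) (f n)) (?comb (f m) (-1) (f n)) < c / V * \<epsilon>" by blast
      have "dirichlet \<Omega> (?comb (f m) (-1) (f n)) < \<epsilon>" if "m \<ge> N" "n \<ge> N" for m n
      proof -
        have "c / V * dirichlet \<Omega> (?comb (f m) (-1) (f n)) < c / V * \<epsilon>"
          by (rule le_less_trans[OF Bnorm(1)[OF combD[OF f f]] N[OF that]])
        then show ?thesis by (rule mult_less_cancel_left_pos[THEN iffD1, rotated]) (use c V in simp)
      qed
      then show "\<exists>N. \<forall>m\<ge>N. \<forall>n\<ge>N. dirichlet \<Omega> (?comb (f m) (-1) (f n)) < \<epsilon>" by blast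
    qed
    then obtain u where u: "u \<in> H1_diamond \<Omega>"
      and lim: "(\<lambda>n. \<integral>x. (norm (wgrad \<Omega> (?comb (f n) (-1) u) x))^2 \<partial>?M) \<longlonglongrightarrow> 0" by blast
    have "(\<lambda>n. ?B (?comb (f n) (-1) u) (?comb (f n) (-1) u)) \<longlonglongrightarrow> 0"
    proof (rule tendsto_sandwich[OF _ _ tendsto_const])
      show "\<forall>\<^sub>F n in sequentially. 0 \<le> ?B (?comb (f n) (-1) u) (?comb (f n) (-1) u)"
        by (intro always_eventually allI pos combD f u)
      show "\<forall>\<^sub>F n in sequentially. ?B (?comb (f n) (-1) u) (?comb (f n) (-1) u) \<le> C / V * dirichlet \<Omega> (?comb (f n) (-1) u)"
        by (intro always_eventually allI Bnorm combD f u)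
      show "(\<lambda>n. C / V * dirichlet \<Omega> (?comb (f n) (-1) u)) \<longlonglongrightarrow> 0"
        using tendsto_mult_left[OF lim, of "C / V"] by simp
    qed
    then show "\<exists>u\<in>H1_diamond \<Omega>. (\<lambda>n. ?B (?comb (f n) (-1) u) (?comb (f n) (-1) u)) \<longlonglongrightarrow> 0" using u by blast
  qed
  then show ?thesis unfolding psi_sol_def z_def by blast
qed

section \<open>Differentiating exponential integrals\<close>

lemma integral_lebesgue_on_const:
  assumes "open (\<Omega> :: (real^'n) set)"
  shows "(\<integral>x. c \<partial>lebesgue_on \<Omega>) = c * measure lebesgue \<Omega>"
  using assms by (simp add: measure_restrict_space)

text \<open>The density bounds confine \<open>h\<close> to the interval from
  \<open>ln (c * Z)\<close> to \<open>ln (C * Z)\<close> with an unknown normalisation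
  \<open>Z\<close>. Since \<open>h\<close> has mean zero, this interval contains 0, and its length
  \<open>ln (C / c)\<close> is free of \<open>Z\<close>.\<close>

lemma potential_bounded:
  fixes \<Omega> :: "(real^'n) set"
  assumes \<Omega>: "open \<Omega>" "bounded \<Omega>" "\<Omega> \<noteq> {}" and h: "h \<in> L2_0 \<Omega>"
    and c: "0 < c" "c < C" and bd: "AE x in lebesgue_on \<Omega>. c \<le> wdens \<Omega> h x \<and> wdens \<Omega> h x \<le> C"
  shows "AE x in lebesgue_on \<Omega>. \<bar>h x\<bar> \<le> ln (C / c)"
proof -
  let ?M = "lebesgue_on \<Omega>"
  define V where "V = measure lebesgue \<Omega>"
  define Z where "Z = nu0_int \<Omega> (\<lambda>y. exp (h y))"
  have V: "V > 0" unfolding V_def by (rule measure_open_bounded_pos[OF \<Omega>])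
  have hL: "L2_on \<Omega> h" and h0: "(\<integral>x. h x \<partial>?M) = 0"
    using h V by (auto simp: L2_0_def nu0_int_def V_def)
  have hi: "integrable ?M h" by (rule L2_on_integrable[OF \<Omega>(1,2) hL])
  have ci: "integrable ?M (\<lambda>x. k)" for k :: real
    by (rule L2_on_integrable[OF \<Omega>(1,2) L2_on_const[OF \<Omega>(1,2)]])
  \<comment> \<open>If \<open>exp h\<close> were not integrable, its integral would be 0 by default
    and \<open>wdens\<close> would vanish; the lower bound on the density excludes this.\<close>
  have Z: "Z > 0"
  proof (rule ccontr)
    assume "\<not> Z > 0"
    then have "wdens \<Omega> h x \<le> 0" for x
      unfolding wdens_def Z_def[symmetric] by (simp add: divide_nonneg_nonpos)
    then have "AE x in ?M. False"
      using bd c by (auto elim!: eventually_mono simp: not_le intro: order_trans) (meson less_le_trans not_less order_trans)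
    then have "(\<integral>x. 1 \<partial>?M) = (\<integral>x. (0::real) \<partial>?M)" by (intro integral_cong_AE) auto
    then show False using integral_lebesgue_on_const[OF \<Omega>(1), of 1] V by (simp add: V_def)
  qed
  have AEb: "AE x in ?M. ln (c * Z) \<le> h x \<and> h x \<le> ln (C * Z)"
    using bd
  proof eventually_elim
    case (elim x)
    then have "c * Z \<le> exp (h x)" "exp (h x) \<le> C * Z"
      using Z by (auto simp: wdens_def Z_def[symmetric] field_simps)
    then show ?case using Z c by (metis ln_exp ln_le_cancel_iff exp_gt_zero mult_pos_pos less_trans)
  qed
  have "ln (c * Z) * V \<le> 0"
    using integral_mono_AE[OF ci hi, of "ln (c * Z)"] AEb unfolding h0 integral_lebesgue_on_const[OF \<Omega>(1)] V_def
    by (auto elim!: eventually_mono)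
  then have l: "ln (c * Z) \<le> 0" using V by (simp add: mult_le_0_iff)
  have "0 \<le> ln (C * Z) * V"
    using integral_mono_AE[OF hi ci, of "ln (C * Z)"] AEb unfolding h0 integral_lebesgue_on_const[OF \<Omega>(1)] V_def
    by (auto elim!: eventually_mono)
  then have u: "0 \<le> ln (C * Z)" using V by (simp add: zero_le_mult_iff)
  have "ln (C * Z) = ln C + ln Z" "ln (c * Z) = ln c + ln Z" "ln (C / c) = ln C - ln c"
    using c Z by (auto simp: ln_mult ln_div)
  note ln_eqs = this
  from AEb show ?thesis
  proof eventually_elim
    case (elim x)
    then show ?case using l u ln_eqs by linarith
  qed
qed

text \<open>Convexity places the remainder between 0 and \<open>(a - a0) * (exp a - exp a0)\<close>,
  and \<open>exp\<close> is Lipschitz with constant \<open>exp b\<close> on the interval in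
  question.\<close>

lemma exp_remainder_bound:
  fixes a a0 b :: real
  assumes "\<bar>a\<bar> \<le> b" "\<bar>a0\<bar> \<le> b"
  shows "\<bar>exp a - exp a0 - (a - a0) * exp a0\<bar> \<le> exp b * (a - a0)^2"
proof -
  have conv: "(y - x) * exp x \<le> exp y - exp x" for x y :: real
  proof -
    have "exp x * (1 + (y - x)) \<le> exp x * exp (y - x)" by (intro mult_left_mono exp_ge_add_one_self) auto
    then show ?thesis by (simp add: exp_diff algebra_simps)
  qed
  have lip: "\<bar>exp a - exp a0\<bar> \<le> exp b * \<bar>a - a0\<bar>"
  proof (cases "a0 \<le> a")
    case True
    have "exp a - exp a0 \<le> (a - a0) * exp a" using conv[of a0 a] by (simp add: algebra_simps)
    also have "\<dots> \<le> (a - a0) * exp b" using True assms by (intro mult_left_mono) auto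
    finally show ?thesis using True by (simp add: mult.commute)
  next
    case False
    have "exp a0 - exp a \<le> (a0 - a) * exp a0" using conv[of a a0] by (simp add: algebra_simps)
    also have "\<dots> \<le> (a0 - a) * exp b" using False assms by (intro mult_left_mono) auto
    finally show ?thesis using False by (simp add: mult.commute)
  qed
  have "0 \<le> exp a - exp a0 - (a - a0) * exp a0" using conv[of a a0] by simp
  moreover have "exp a - exp a0 - (a - a0) * exp a0 \<le> (a - a0) * (exp a - exp a0)"
    using conv[of a0 a] by (simp add: algebra_simps)
  moreover have "(a - a0) * (exp a - exp a0) \<le> \<bar>a - a0\<bar> * \<bar>exp a - exp a0\<bar>" by (metis abs_ge_self abs_mult)
  moreover have "\<bar>a - a0\<bar> * \<bar>exp a - exp a0\<bar> \<le> \<bar>a - a0\<bar> * (exp b * \<bar>a - a0\<bar>)" by (intro mult_left_mono lip) auto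
  moreover have "\<bar>a - a0\<bar> * (exp b * \<bar>a - a0\<bar>) = exp b * (a - a0)^2" by (simp add: power2_eq_square)
  ultimately show ?thesis by linarith
qed

lemma tail_square_small:
  fixes \<eta> :: "'a \<Rightarrow> real"
  assumes [measurable]: "\<eta> \<in> borel_measurable M" and i: "integrable M (\<lambda>x. (\<eta> x)^2)" and e: "e > 0"
  shows "\<exists>n::nat. (\<integral>x. (if \<bar>\<eta> x\<bar> \<le> real n then 0 else (\<eta> x)^2) \<partial>M) < e"
proof -
  have "(\<lambda>n. \<integral>x. (if \<bar>\<eta> x\<bar> \<le> real n then 0 else (\<eta> x)^2) \<partial>M) \<longlonglongrightarrow> (\<integral>x. 0 \<partial>M)"
  proof (rule integral_dominated_convergence[OF _ _ i])
    show "AE x in M. (\<lambda>n. if \<bar>\<eta> x\<bar> \<le> real n then 0 else (\<eta> x)^2) \<longlonglongrightarrow> 0"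
    proof (intro AE_I2)
      fix x
      obtain N :: nat where "\<bar>\<eta> x\<bar> \<le> real N" using real_arch_simple by blast
      then have "\<forall>\<^sub>F n in sequentially. 0 = (if \<bar>\<eta> x\<bar> \<le> real n then 0 else (\<eta> x)^2)"
        by (intro eventually_sequentiallyI[of N]) auto
      then show "(\<lambda>n. if \<bar>\<eta> x\<bar> \<le> real n then 0 else (\<eta> x)^2) \<longlonglongrightarrow> 0"
        by (rule Lim_transform_eventually[OF tendsto_const])
    qed
  qed auto
  then have "\<forall>\<^sub>F n in sequentially. (\<integral>x. (if \<bar>\<eta> x\<bar> \<le> real n then 0 else (\<eta> x)^2) \<partial>M) < e"
    using e by (intro order_tendstoD(2)) auto
  then show ?thesis by (auto simp: eventually_sequentially)
qed

text \<open>Since \<open>\<eta>\<close> may be unbounded, it is cut at a level \<open>n\<close>.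
  Below the level the factor \<open>n^2\<close> is harmless as \<open>f\<close> tends to 0 in
  \<open>L2\<close>; above it the uniform bound on \<open>f\<close> meets a small tail of
  \<open>\<eta>\<close>.\<close>

lemma bounded_L2_null_mult:
  fixes \<eta> :: "'a \<Rightarrow> real" and f :: "'b \<Rightarrow> 'a \<Rightarrow> real"
  assumes \<eta>[measurable]: "\<eta> \<in> borel_measurable M" and i: "integrable M (\<lambda>x. (\<eta> x)^2)"
    and f: "\<forall>\<^sub>F \<tau> in F. f \<tau> \<in> borel_measurable M \<and> integrable M (\<lambda>x. (f \<tau> x)^2) \<and> (AE x in M. \<bar>f \<tau> x\<bar> \<le> B)"
    and lim: "((\<lambda>\<tau>. \<integral>x. (f \<tau> x)^2 \<partial>M) \<longlongrightarrow> 0) F"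
  shows "((\<lambda>\<tau>. \<integral>x. (\<eta> x * f \<tau> x)^2 \<partial>M) \<longlongrightarrow> 0) F"
proof (rule tendstoI)
  fix e :: real assume e: "e > 0"
  \<comment> \<open>The summand 1 allows division by \<open>k\<close> even when
    \<open>B = 0\<close>.\<close>
  define k where "k = B^2 + 1"
  have k: "k > 0" "B^2 \<le> k" unfolding k_def by (smt (verit) zero_le_power2)+
  obtain n :: nat where n: "(\<integral>x. (if \<bar>\<eta> x\<bar> \<le> real n then 0 else (\<eta> x)^2) \<partial>M) < e / (2 * k)"
    using tail_square_small[OF \<eta> i, of "e / (2 * k)"] e k by auto
  let ?T = "\<lambda>x. if \<bar>\<eta> x\<bar> \<le> real n then 0 else (\<eta> x)^2"
  have Ti: "integrable M ?T"
    by (rule Bochner_Integration.integrable_bound[OF i]) auto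
  have "((\<lambda>\<tau>. (real n)^2 * (\<integral>x. (f \<tau> x)^2 \<partial>M)) \<longlongrightarrow> 0) F" using tendsto_mult_left[OF lim] by simp
  then have "\<forall>\<^sub>F \<tau> in F. (real n)^2 * (\<integral>x. (f \<tau> x)^2 \<partial>M) < e / 2"
    using e by (intro order_tendstoD(2)) auto
  with f show "\<forall>\<^sub>F \<tau> in F. dist (\<integral>x. (\<eta> x * f \<tau> x)^2 \<partial>M) 0 < e"
  proof eventually_elim
    case (elim \<tau>)
    then have [measurable]: "f \<tau> \<in> borel_measurable M" and fi: "integrable M (\<lambda>x. (f \<tau> x)^2)"
      and fB: "AE x in M. \<bar>f \<tau> x\<bar> \<le> B" and small: "(real n)^2 * (\<integral>x. (f \<tau> x)^2 \<partial>M) < e / 2" by auto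
    have le: "AE x in M. (\<eta> x * f \<tau> x)^2 \<le> (real n)^2 * (f \<tau> x)^2 + B^2 * ?T x"
      using fB
    proof eventually_elim
      case (elim x)
      have f2: "(f \<tau> x)^2 \<le> B^2" using elim by (metis abs_ge_zero power2_abs power_mono)
      show ?case
      proof (cases "\<bar>\<eta> x\<bar> \<le> real n")
        case True
        then have "(\<eta> x)^2 \<le> (real n)^2" by (metis abs_ge_zero power2_abs power_mono)
        then show ?thesis using True by (simp add: power_mult_distrib mult_right_mono)
      next
        case False
        then have T: "?T x = (\<eta> x)^2" by simp
        have "(\<eta> x)^2 * (f \<tau> x)^2 \<le> B^2 * (\<eta> x)^2"
          using mult_left_mono[OF f2, of "(\<eta> x)^2"] by (simp add: mult.commute)
        moreover have "0 \<le> (real n)^2 * (f \<tau> x)^2" by simp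
        ultimately show ?thesis unfolding T power_mult_distrib by linarith
      qed
    qed
    have ri: "integrable M (\<lambda>x. (real n)^2 * (f \<tau> x)^2 + B^2 * ?T x)"
      by (intro Bochner_Integration.integrable_add integrable_mult_right fi Ti)
    have "(\<integral>x. (\<eta> x * f \<tau> x)^2 \<partial>M) \<le> (\<integral>x. (real n)^2 * (f \<tau> x)^2 + B^2 * ?T x \<partial>M)"
    proof (rule integral_mono_AE[OF _ ri le])
      show "integrable M (\<lambda>x. (\<eta> x * f \<tau> x)^2)"
        by (rule Bochner_Integration.integrable_bound[OF ri]) (use le in \<open>auto elim!: eventually_mono\<close>)
    qed
    also have "\<dots> = (real n)^2 * (\<integral>x. (f \<tau> x)^2 \<partial>M) + B^2 * (\<integral>x. ?T x \<partial>M)"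
      using Bochner_Integration.integral_add[OF integrable_mult_right[OF fi, of "(real n)^2"] integrable_mult_right[OF Ti, of "B^2"]]
      by (simp only: integral_mult_right_zero)
    also have "B^2 * (\<integral>x. ?T x \<partial>M) \<le> k * (\<integral>x. ?T x \<partial>M)"
      using k by (intro mult_right_mono integral_nonneg_AE) auto
    also have "\<dots> < k * (e / (2 * k))" using n k by (intro mult_strict_left_mono) auto
    also have "\<dots> = e / 2" using k by simp
    finally have "(\<integral>x. (\<eta> x * f \<tau> x)^2 \<partial>M) < e" using small by linarith
    moreover have "0 \<le> (\<integral>x. (\<eta> x * f \<tau> x)^2 \<partial>M)" by simp
    ultimately show ?case by (simp only: dist_real_def diff_zero abs_of_nonneg)
  qed
qed

text \<open>The error of the difference quotient splits into \<open>\<eta> * exp (h t)\<close> times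
  \<open>Q - d\<close>, which vanishes by Cauchy-Schwarz, and a Taylor remainder bounded by
  \<open>exp b\<close> times \<bar>\<eta> * f\<bar> times \<bar>Q\<bar>. In the latter
  \<open>Q\<close> stays bounded in \<open>L2\<close>, while \<open>\<eta> * f\<close> tends to 0
  there because \<open>f\<close> is uniformly bounded and small in \<open>L2\<close>.\<close>

lemma integral_exp_has_derivative:
  fixes \<Omega> :: "(real^'n) set" and h :: "real \<Rightarrow> real^'n \<Rightarrow> real"
  assumes \<Omega>: "open \<Omega>" "bounded \<Omega>" and t: "t \<in> S"
    and h: "\<And>\<tau>. \<tau> \<in> S \<Longrightarrow> L2_on \<Omega> (h \<tau>)" and hb: "\<And>\<tau>. \<tau> \<in> S \<Longrightarrow> AE x in lebesgue_on \<Omega>. \<bar>h \<tau> x\<bar> \<le> b"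
    and d: "L2_on \<Omega> d" and \<eta>: "L2_on \<Omega> \<eta>"
    and lim: "((\<lambda>\<tau>. \<integral>x. ((h \<tau> x - h t x) / (\<tau> - t) - d x)^2 \<partial>lebesgue_on \<Omega>) \<longlongrightarrow> 0) (at t within S)"
  shows "((\<lambda>\<tau>. \<integral>x. \<eta> x * exp (h \<tau> x) \<partial>lebesgue_on \<Omega>) has_real_derivative
     (\<integral>x. \<eta> x * (d x * exp (h t x)) \<partial>lebesgue_on \<Omega>)) (at t within S)"
proof -
  let ?M = "lebesgue_on \<Omega>"
  let ?S = "at t within S"
  define Q where "Q \<tau> x = (h \<tau> x - h t x) / (\<tau> - t)" for \<tau> x
  define f where "f \<tau> x = h \<tau> x - h t x" for \<tau> x
  define q where "q \<tau> = (\<integral>x. (Q \<tau> x - d x)^2 \<partial>?M)" for \<tau>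
  define D where "D = 2 * (\<integral>x. (d x)^2 \<partial>?M)"
  define P where "P \<tau> = (\<integral>x. (\<eta> x * f \<tau> x)^2 \<partial>?M)" for \<tau>
  have qlim: "(q \<longlongrightarrow> 0) ?S" using lim unfolding q_def[abs_def] Q_def .
  have inS: "\<forall>\<^sub>F \<tau> in ?S. \<tau> \<in> S \<and> \<tau> \<noteq> t" by (auto simp: eventually_at_filter)
  have fL: "L2_on \<Omega> (f \<tau>)" if "\<tau> \<in> S" for \<tau> unfolding f_def by (intro L2_on_diff h that t)
  have QL: "L2_on \<Omega> (Q \<tau>)" if "\<tau> \<in> S" for \<tau>
    using L2_on_cmult[OF fL[OF that], of "1 / (\<tau> - t)"] by (simp add: Q_def[abs_def] f_def)
  have eL: "L2_on \<Omega> (\<lambda>x. exp (h \<tau> x))" if "\<tau> \<in> S" for \<tau>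
    using hb[OF that] L2_onD(1)[OF h[OF that]]
    by (intro L2_on_bounded[OF \<Omega>, where M = "exp b"]) (auto elim!: eventually_mono)
  have fB: "AE x in ?M. \<bar>f \<tau> x\<bar> \<le> 2 * b" if "\<tau> \<in> S" for \<tau>
    using hb[OF that] hb[OF t] by eventually_elim (auto simp: f_def)
  \<comment> \<open>The difference quotients converge in \<open>L2\<close>, hence their norms stay
    bounded.\<close>
  have Q2: "(\<integral>x. (Q \<tau> x)^2 \<partial>?M) \<le> 2 * q \<tau> + D" if "\<tau> \<in> S" for \<tau>
  proof -
    have i: "integrable ?M (\<lambda>x. 2 * (Q \<tau> x - d x)^2)" "integrable ?M (\<lambda>x. 2 * (d x)^2)"
      by (intro integrable_mult_right L2_onD(2) L2_on_diff QL that d)+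
    have "(\<integral>x. (Q \<tau> x)^2 \<partial>?M) \<le> (\<integral>x. 2 * (Q \<tau> x - d x)^2 + 2 * (d x)^2 \<partial>?M)"
    proof (rule integral_mono[OF L2_onD(2)[OF QL[OF that]] Bochner_Integration.integrable_add[OF i]])
      fix x
      show "(Q \<tau> x)^2 \<le> 2 * (Q \<tau> x - d x)^2 + 2 * (d x)^2"
        using zero_le_power2[of "Q \<tau> x - 2 * d x"] by (simp add: power2_eq_square algebra_simps)
    qed
    also have "\<dots> = 2 * q \<tau> + D"
      unfolding Bochner_Integration.integral_add[OF i] integral_mult_right_zero by (simp add: q_def D_def)
    finally show ?thesis .
  qed
  have f2: "(\<integral>x. (f \<tau> x)^2 \<partial>?M) = (\<tau> - t)^2 * (\<integral>x. (Q \<tau> x)^2 \<partial>?M)" if "\<tau> \<noteq> t" for \<tau>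
  proof -
    have "(\<lambda>x. (f \<tau> x)^2) = (\<lambda>x. (\<tau> - t)^2 * (Q \<tau> x)^2)" using that by (auto simp: f_def Q_def power_divide)
    then show ?thesis by (simp only: integral_mult_right_zero)
  qed
  have flim: "((\<lambda>\<tau>. \<integral>x. (f \<tau> x)^2 \<partial>?M) \<longlongrightarrow> 0) ?S"
  proof (rule tendsto_sandwich[OF _ _ tendsto_const])
    show "\<forall>\<^sub>F \<tau> in ?S. (\<integral>x. (f \<tau> x)^2 \<partial>?M) \<le> (\<tau> - t)^2 * (2 * q \<tau> + D)"
      using inS by eventually_elim (simp add: f2 Q2 mult_left_mono)
    have "((\<lambda>\<tau>. (\<tau> - t)^2 * (2 * q \<tau> + D)) \<longlongrightarrow> (t - t)^2 * (2 * 0 + D)) ?S"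
      by (intro tendsto_intros qlim)
    then show "((\<lambda>\<tau>. (\<tau> - t)^2 * (2 * q \<tau> + D)) \<longlongrightarrow> 0) ?S" by simp
  qed simp
  have Plim: "(P \<longlongrightarrow> 0) ?S" unfolding P_def[abs_def]
  proof (rule bounded_L2_null_mult[OF L2_onD[OF \<eta>] _ flim, where B = "2 * b"])
    show "\<forall>\<^sub>F \<tau> in ?S. f \<tau> \<in> borel_measurable ?M \<and> integrable ?M (\<lambda>x. (f \<tau> x)^2) \<and> (AE x in ?M. \<bar>f \<tau> x\<bar> \<le> 2 * b)"
      using inS by eventually_elim (use L2_onD[OF fL] fB in auto)
  qed
  let ?F = "\<lambda>\<tau>. \<integral>x. \<eta> x * exp (h \<tau> x) \<partial>?M"
  let ?D = "\<integral>x. \<eta> x * (d x * exp (h t x)) \<partial>?M"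
  have deL: "L2_on \<Omega> (\<lambda>x. k x * exp (h t x))" if k: "L2_on \<Omega> k" for k
    unfolding L2_on_def
  proof
    note [measurable] = L2_onD(1)[OF k] L2_onD(1)[OF h[OF t]]
    show "(\<lambda>x. k x * exp (h t x)) \<in> borel_measurable ?M" by measurable
    show "integrable ?M (\<lambda>x. (k x * exp (h t x))^2)"
    proof (rule Bochner_Integration.integrable_bound)
      show "integrable ?M (\<lambda>x. (exp b)^2 * (k x)^2)" using L2_onD(2)[OF k] by (rule integrable_mult_right)
      show "AE x in ?M. norm ((k x * exp (h t x))^2) \<le> norm ((exp b)^2 * (k x)^2)"
        using hb[OF t]
      proof eventually_elim
        case (elim x)
        then have "(exp (h t x))^2 * (k x)^2 \<le> (exp b)^2 * (k x)^2"
          by (intro mult_right_mono power_mono) auto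
        then show ?case by (simp add: power_mult_distrib mult.commute)
      qed
    qed measurable
  qed
  have bound: "\<bar>(?F \<tau> - ?F t) / (\<tau> - t) - ?D\<bar> \<le> sqrt ((\<integral>x. (\<eta> x * exp (h t x))^2 \<partial>?M) * q \<tau>) + exp b * sqrt (P \<tau> * (2 * q \<tau> + D))"
    if \<tau>: "\<tau> \<in> S" "\<tau> \<noteq> t" for \<tau>
  proof -
    note QLt = QL[OF \<tau>(1)] and fLt = fL[OF \<tau>(1)]
    define r where "r x = (exp (h \<tau> x) - exp (h t x) - f \<tau> x * exp (h t x)) / (\<tau> - t)" for x
    have i1: "integrable ?M (\<lambda>x. \<eta> x * exp (h \<tau> x))" "integrable ?M (\<lambda>x. \<eta> x * exp (h t x))"
      by (intro L2_on_mult \<eta> eL \<tau> t)+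
    have i2: "integrable ?M (\<lambda>x. \<eta> x * (d x * exp (h t x)))" by (intro L2_on_mult \<eta> deL d)
    have i3: "integrable ?M (\<lambda>x. (\<eta> x * exp (h t x)) * (Q \<tau> x - d x))"
      by (intro L2_on_mult deL \<eta> L2_on_diff QLt d)
    have \<eta>f: "L2_on \<Omega> (\<lambda>x. \<eta> x * f \<tau> x)"
      unfolding L2_on_def
    proof
      note [measurable] = L2_onD(1)[OF \<eta>] L2_onD(1)[OF fLt]
      show "(\<lambda>x. \<eta> x * f \<tau> x) \<in> borel_measurable ?M" by measurable
      show "integrable ?M (\<lambda>x. (\<eta> x * f \<tau> x)^2)"
      proof (rule Bochner_Integration.integrable_bound)
        show "integrable ?M (\<lambda>x. (2 * b)^2 * (\<eta> x)^2)" using L2_onD(2)[OF \<eta>] by (rule integrable_mult_right)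
        show "AE x in ?M. norm ((\<eta> x * f \<tau> x)^2) \<le> norm ((2 * b)^2 * (\<eta> x)^2)"
          using fB[OF \<tau>(1)]
        proof eventually_elim
          case (elim x)
          then have "(f \<tau> x)^2 \<le> (2 * b)^2" by (metis abs_ge_zero power2_abs power_mono)
          then have "(f \<tau> x)^2 * (\<eta> x)^2 \<le> (2 * b)^2 * (\<eta> x)^2" by (rule mult_right_mono) simp
          then show ?case by (simp add: power_mult_distrib mult.commute)
        qed
      qed measurable
    qed
    have split: "(\<eta> x * exp (h \<tau> x) - \<eta> x * exp (h t x)) / (\<tau> - t) - \<eta> x * (d x * exp (h t x)) =
       (\<eta> x * exp (h t x)) * (Q \<tau> x - d x) + \<eta> x * r x" for x
      by (simp add: r_def Q_def f_def divide_inverse algebra_simps)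
    have iL: "integrable ?M (\<lambda>x. (\<eta> x * exp (h \<tau> x) - \<eta> x * exp (h t x)) / (\<tau> - t) - \<eta> x * (d x * exp (h t x)))"
      by (intro Bochner_Integration.integrable_diff integrable_divide_zero i1 i2)
    have i4: "integrable ?M (\<lambda>x. \<eta> x * r x)"
      using Bochner_Integration.integrable_diff[OF iL i3] unfolding split by simp
    have eq: "(?F \<tau> - ?F t) / (\<tau> - t) - ?D = (\<integral>x. (\<eta> x * exp (h t x)) * (Q \<tau> x - d x) \<partial>?M) + (\<integral>x. \<eta> x * r x \<partial>?M)"
    proof -
      have "(?F \<tau> - ?F t) / (\<tau> - t) - ?D = (\<integral>x. (\<eta> x * exp (h \<tau> x) - \<eta> x * exp (h t x)) / (\<tau> - t) - \<eta> x * (d x * exp (h t x)) \<partial>?M)"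
        using i1 i2 by (subst Bochner_Integration.integral_diff) (auto simp: Bochner_Integration.integral_diff)
      also have "\<dots> = (\<integral>x. (\<eta> x * exp (h t x)) * (Q \<tau> x - d x) \<partial>?M) + (\<integral>x. \<eta> x * r x \<partial>?M)"
        unfolding split by (rule Bochner_Integration.integral_add[OF i3 i4])
      finally show ?thesis .
    qed
    have "(\<integral>x. (\<eta> x * exp (h t x)) * (Q \<tau> x - d x) \<partial>?M)^2 \<le> (\<integral>x. (\<eta> x * exp (h t x))^2 \<partial>?M) * q \<tau>"
      unfolding q_def by (intro Cauchy_Schwarz_integral L2_onD deL \<eta> L2_on_diff QLt d)
    then have b1: "\<bar>\<integral>x. (\<eta> x * exp (h t x)) * (Q \<tau> x - d x) \<partial>?M\<bar> \<le> sqrt ((\<integral>x. (\<eta> x * exp (h t x))^2 \<partial>?M) * q \<tau>)"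
      by (intro real_le_rsqrt) simp
    have aL: "L2_on \<Omega> (\<lambda>x. \<bar>\<eta> x * f \<tau> x\<bar>)" "L2_on \<Omega> (\<lambda>x. \<bar>Q \<tau> x\<bar>)"
      using \<eta>f QLt by (auto simp: L2_on_def)
    have iab: "integrable ?M (\<lambda>x. \<bar>\<eta> x * f \<tau> x\<bar> * \<bar>Q \<tau> x\<bar>)" by (rule L2_on_mult[OF aL])
    have "\<bar>\<integral>x. \<eta> x * r x \<partial>?M\<bar> \<le> (\<integral>x. \<bar>\<eta> x * r x\<bar> \<partial>?M)" by (rule integral_abs_bound)
    also have "\<dots> \<le> (\<integral>x. exp b * (\<bar>\<eta> x * f \<tau> x\<bar> * \<bar>Q \<tau> x\<bar>) \<partial>?M)"
    proof (rule integral_mono_AE[OF integrable_abs[OF i4] integrable_mult_right[OF iab]])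
      show "AE x in ?M. \<bar>\<eta> x * r x\<bar> \<le> exp b * (\<bar>\<eta> x * f \<tau> x\<bar> * \<bar>Q \<tau> x\<bar>)"
        using hb[OF \<tau>(1)] hb[OF t]
      proof eventually_elim
        case (elim x)
        \<comment> \<open>The remainder is quadratic in \<open>f\<close>; dividing by
          \<open>\<tau> - t\<close> turns one of its two factors into \<open>Q\<close> and leaves
          the other to be paired with \<open>\<eta>\<close>.\<close>
        have "\<bar>r x\<bar> \<le> exp b * (f \<tau> x)^2 / \<bar>\<tau> - t\<bar>"
          unfolding r_def abs_divide f_def using exp_remainder_bound[OF elim] by (intro divide_right_mono) auto
        also have "\<dots> = exp b * (\<bar>f \<tau> x\<bar> * \<bar>Q \<tau> x\<bar>)"
          by (simp add: Q_def f_def abs_divide power2_eq_square flip: abs_mult)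
        finally have "\<bar>\<eta> x\<bar> * \<bar>r x\<bar> \<le> \<bar>\<eta> x\<bar> * (exp b * (\<bar>f \<tau> x\<bar> * \<bar>Q \<tau> x\<bar>))" by (rule mult_left_mono) simp
        then show ?case by (simp add: abs_mult ac_simps)
      qed
    qed
    also have "\<dots> = exp b * (\<integral>x. \<bar>\<eta> x * f \<tau> x\<bar> * \<bar>Q \<tau> x\<bar> \<partial>?M)" by (rule integral_mult_right_zero)
    also have "(\<integral>x. \<bar>\<eta> x * f \<tau> x\<bar> * \<bar>Q \<tau> x\<bar> \<partial>?M) \<le> sqrt (P \<tau> * (2 * q \<tau> + D))"
    proof (rule real_le_rsqrt)
      have "(\<integral>x. \<bar>\<eta> x * f \<tau> x\<bar> * \<bar>Q \<tau> x\<bar> \<partial>?M)^2 \<le> (\<integral>x. \<bar>\<eta> x * f \<tau> x\<bar>^2 \<partial>?M) * (\<integral>x. \<bar>Q \<tau> x\<bar>^2 \<partial>?M)"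
        by (intro Cauchy_Schwarz_integral L2_onD aL)
      also have "\<dots> = P \<tau> * (\<integral>x. (Q \<tau> x)^2 \<partial>?M)" by (simp add: P_def)
      also have "\<dots> \<le> P \<tau> * (2 * q \<tau> + D)" by (intro mult_left_mono Q2 \<tau>) (simp add: P_def)
      finally show "(\<integral>x. \<bar>\<eta> x * f \<tau> x\<bar> * \<bar>Q \<tau> x\<bar> \<partial>?M)^2 \<le> P \<tau> * (2 * q \<tau> + D)" .
    qed
    finally have b2: "\<bar>\<integral>x. \<eta> x * r x \<partial>?M\<bar> \<le> exp b * sqrt (P \<tau> * (2 * q \<tau> + D))" by simp
    show ?thesis unfolding eq using b1 b2 by linarith
  qed
  have "((\<lambda>\<tau>. (?F \<tau> - ?F t) / (\<tau> - t) - ?D) \<longlongrightarrow> 0) ?S"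
  proof (rule Lim_null_comparison)
    show "\<forall>\<^sub>F \<tau> in ?S. norm ((?F \<tau> - ?F t) / (\<tau> - t) - ?D) \<le> sqrt ((\<integral>x. (\<eta> x * exp (h t x))^2 \<partial>?M) * q \<tau>) + exp b * sqrt (P \<tau> * (2 * q \<tau> + D))"
      using inS
    proof eventually_elim
      case (elim \<tau>)
      then show ?case unfolding real_norm_def by (intro bound) auto
    qed
    have "((\<lambda>\<tau>. sqrt ((\<integral>x. (\<eta> x * exp (h t x))^2 \<partial>?M) * q \<tau>) + exp b * sqrt (P \<tau> * (2 * q \<tau> + D))) \<longlongrightarrow>
       sqrt ((\<integral>x. (\<eta> x * exp (h t x))^2 \<partial>?M) * 0) + exp b * sqrt (0 * (2 * 0 + D))) ?S"
      by (intro tendsto_intros qlim Plim)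
    then show "((\<lambda>\<tau>. sqrt ((\<integral>x. (\<eta> x * exp (h t x))^2 \<partial>?M) * q \<tau>) + exp b * sqrt (P \<tau> * (2 * q \<tau> + D))) \<longlongrightarrow> 0) ?S" by simp
  qed
  then show ?thesis unfolding has_field_derivative_iff by (simp add: LIM_zero_iff)
qed

text \<open>The empty list contributes the \<open>L2\<close> norm itself, and all remaining terms
  are nonnegative. Differentiability in \<open>Hs_norm\<close> is passed to \<open>L2\<close> in
  this way.\<close>

lemma L2_norm_le_Hs_norm:
  fixes \<Omega> :: "(real^'n) set"
  assumes \<Omega>: "open \<Omega>" "bounded \<Omega>" and v: "L2_on \<Omega> v"
  shows "(\<integral>x. (v x)^2 \<partial>lebesgue_on \<Omega>) \<le> (Hs_norm \<Omega> s v)^2"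
proof -
  let ?M = "lebesgue_on \<Omega>"
  let ?A = "\<Sum>is\<in>{is. length is \<le> sob_int s}. \<integral>x. (weakD \<Omega> is v x)^2 \<partial>?M"
  let ?B = "if sob_frac s > 0 then
        (\<Sum>is\<in>{is. length is = sob_int s}.
           \<integral>p. gagliardo_integrand (sob_frac s) (weakD \<Omega> is v) p
             \<partial>(?M \<Otimes>\<^sub>M ?M))
      else 0"
  have fin: "finite {is :: 'n list. length is \<le> sob_int s}"
    using finite_lists_length_le[of "UNIV :: 'n set" "sob_int s"] by simp
  have "(\<integral>x. (v x)^2 \<partial>?M) = (\<integral>x. (weakD \<Omega> [] v x)^2 \<partial>?M)"
  proof (rule integral_cong_AE)
    show "AE x in ?M. (v x)^2 = (weakD \<Omega> [] v x)^2"
      using weakD_AE_eq[OF \<Omega> v is_weak_deriv_Nil] by eventually_elim simp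
  qed (use L2_onD(2)[OF v] L2_onD(2)[OF weakD_props(1)[OF v is_weak_deriv_Nil]] in \<open>auto intro: borel_measurable_integrable\<close>)
  also have "\<dots> \<le> ?A"
    by (rule member_le_sum[where f = "\<lambda>is. \<integral>x. (weakD \<Omega> is v x)^2 \<partial>?M"]) (auto simp: fin)
  finally have A: "(\<integral>x. (v x)^2 \<partial>?M) \<le> ?A" .
  have B: "0 \<le> ?B" by (auto intro!: sum_nonneg integral_nonneg_AE simp: gagliardo_integrand_def)
  have "0 \<le> (\<integral>x. (v x)^2 \<partial>?M)" by simp
  then have "0 \<le> ?A + ?B" using A B by linarith
  then have "(Hs_norm \<Omega> s v)^2 = ?A + ?B" unfolding Hs_norm_def by (rule real_sqrt_pow2)
  then show ?thesis using A B by linarith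
qed

section \<open>The covariance formula and the continuity equation\<close>

lemma rho_int_eq:
  assumes "measure lebesgue \<Omega> > 0"
  shows "rho_int \<Omega> h f = (\<integral>x. f x * exp (h x) \<partial>lebesgue_on \<Omega>) / (\<integral>x. exp (h x) \<partial>lebesgue_on \<Omega>)"
proof -
  let ?k = "nu0_int \<Omega> (\<lambda>y. exp (h y))"
  have "rho_int \<Omega> h f = (\<integral>x. f x * (exp (h x) / ?k) \<partial>lebesgue_on \<Omega>) / measure lebesgue \<Omega>"
    unfolding rho_int_def wdens_def by (rule nu0_int_def)
  also have "\<dots> = (\<integral>x. f x * exp (h x) \<partial>lebesgue_on \<Omega>) / ?k / measure lebesgue \<Omega>"
    by (simp only: times_divide_eq_right integral_divide_zero)
  also have "\<dots> = (\<integral>x. f x * exp (h x) \<partial>lebesgue_on \<Omega>) / (\<integral>x. exp (h x) \<partial>lebesgue_on \<Omega>)"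
    using assms by (simp add: nu0_int_def)
  finally show ?thesis .
qed

text \<open>The covariance is written over the squared normalisation, exactly as the quotient rule
  will produce it.\<close>

lemma flux_eq_covariance:
  fixes \<Omega> :: "(real^'n) set"
  assumes \<Omega>: "open \<Omega>" "bounded \<Omega>" "\<Omega> \<noteq> {}" and \<psi>: "psi_sol \<Omega> h \<xi> \<psi>" and \<eta>: "\<eta> \<in> H1 \<Omega>"
    and \<xi>: "L2_on \<Omega> \<xi>" and e: "L2_on \<Omega> (\<lambda>x. exp (h x))"
    and \<xi>e: "L2_on \<Omega> (\<lambda>x. \<xi> x * exp (h x))" and Zpos: "(\<integral>x. exp (h x) \<partial>lebesgue_on \<Omega>) > 0"
  shows "rho_int \<Omega> h (\<lambda>x. wgrad \<Omega> \<eta> x \<bullet> wgrad \<Omega> \<psi> x) =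
    ((\<integral>x. \<eta> x * (\<xi> x * exp (h x)) \<partial>lebesgue_on \<Omega>) * (\<integral>x. exp (h x) \<partial>lebesgue_on \<Omega>)
     - (\<integral>x. \<eta> x * exp (h x) \<partial>lebesgue_on \<Omega>) * (\<integral>x. \<xi> x * exp (h x) \<partial>lebesgue_on \<Omega>))
    / ((\<integral>x. exp (h x) \<partial>lebesgue_on \<Omega>) * (\<integral>x. exp (h x) \<partial>lebesgue_on \<Omega>))"
proof -
  let ?M = "lebesgue_on \<Omega>"
  let ?Z = "\<integral>x. exp (h x) \<partial>?M"
  have V: "measure lebesgue \<Omega> > 0" by (rule measure_open_bounded_pos[OF \<Omega>])
  \<comment> \<open>The equation for \<open>\<psi>\<close> admits only test functions of Lebesgue
    mean zero, so this mean is subtracted; the gradient does not notice.\<close>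
  define m where "m = (\<integral>x. \<eta> x \<partial>?M) / measure lebesgue \<Omega>"
  define k where "k x = \<eta> x + (-1) * m" for x
  define E where "E = rho_int \<Omega> h \<xi>"
  note c = H1_const[OF \<Omega>(1,2), of m]
  have kH: "k \<in> H1 \<Omega>" unfolding k_def[abs_def] by (rule H1_comb(1)[OF \<Omega>(1,2) \<eta> c(1)])
  have gk: "AE x in ?M. wgrad \<Omega> k x = wgrad \<Omega> \<eta> x"
    using H1_comb(2)[OF \<Omega>(1,2) \<eta> c(1), of "-1"] c(2) unfolding k_def[abs_def] by eventually_elim simp
  note \<eta>L = H1_weakD(1)[OF \<eta>]
  have "(\<integral>x. k x \<partial>?M) = (\<integral>x. \<eta> x \<partial>?M) - (\<integral>x. m \<partial>?M)"
    using L2_on_integrable[OF \<Omega>(1,2) \<eta>L] L2_on_integrable[OF \<Omega>(1,2) L2_on_const[OF \<Omega>(1,2), of m]]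
    by (simp add: k_def)
  also have "\<dots> = 0" unfolding integral_lebesgue_on_const[OF \<Omega>(1)] using V by (simp add: m_def)
  finally have kD: "k \<in> H1_diamond \<Omega>" using kH by (simp add: H1_diamond_def)
  have \<psi>H: "\<psi> \<in> H1 \<Omega>" using \<psi> by (simp add: psi_sol_def H1_diamond_def)
  have em: "(\<lambda>x. exp (h x)) \<in> borel_measurable ?M" by (rule L2_onD(1)[OF e])
  have "(\<integral>x. (wgrad \<Omega> \<eta> x \<bullet> wgrad \<Omega> \<psi> x) * exp (h x) \<partial>?M) = (\<integral>x. (wgrad \<Omega> \<psi> x \<bullet> wgrad \<Omega> k x) * exp (h x) \<partial>?M)"
  proof (rule integral_cong_AE)
    show "AE x in ?M. (wgrad \<Omega> \<eta> x \<bullet> wgrad \<Omega> \<psi> x) * exp (h x) = (wgrad \<Omega> \<psi> x \<bullet> wgrad \<Omega> k x) * exp (h x)"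
      using gk by eventually_elim (simp add: inner_commute)
  qed (intro borel_measurable_times em borel_measurable_integrable[OF H1_grad_inner_integrable] \<eta> \<psi>H kH)+
  then have "rho_int \<Omega> h (\<lambda>x. wgrad \<Omega> \<eta> x \<bullet> wgrad \<Omega> \<psi> x) = rho_int \<Omega> h (\<lambda>x. wgrad \<Omega> \<psi> x \<bullet> wgrad \<Omega> k x)"
    by (simp only: rho_int_eq[OF V])
  also have "\<dots> = rho_int \<Omega> h (\<lambda>x. (\<xi> x - E) * k x)"
    using \<psi> kD by (simp add: psi_sol_def E_def)
  also have "\<dots> = (\<integral>x. (\<xi> x - E) * k x * exp (h x) \<partial>?M) / ?Z" by (rule rho_int_eq[OF V])
  also have "(\<integral>x. (\<xi> x - E) * k x * exp (h x) \<partial>?M) =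
     (\<integral>x. (\<eta> x * (\<xi> x * exp (h x)) - E * (\<eta> x * exp (h x))) - (m * (\<xi> x * exp (h x)) - m * E * exp (h x)) \<partial>?M)"
    by (simp add: k_def algebra_simps)
  also have "\<dots> = ((\<integral>x. \<eta> x * (\<xi> x * exp (h x)) \<partial>?M) - E * (\<integral>x. \<eta> x * exp (h x) \<partial>?M)) - (m * (\<integral>x. \<xi> x * exp (h x) \<partial>?M) - m * E * ?Z)"
  proof -
    have i: "integrable ?M (\<lambda>x. \<eta> x * (\<xi> x * exp (h x)))" "integrable ?M (\<lambda>x. E * (\<eta> x * exp (h x)))"
      "integrable ?M (\<lambda>x. m * (\<xi> x * exp (h x)))" "integrable ?M (\<lambda>x. m * E * exp (h x))"
      using L2_on_mult[OF \<eta>L \<xi>e] L2_on_mult[OF \<eta>L e] L2_on_mult[OF \<xi> e] L2_on_integrable[OF \<Omega>(1,2) e]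
      by (auto intro: integrable_mult_right)
    show ?thesis
      unfolding Bochner_Integration.integral_diff[OF Bochner_Integration.integrable_diff[OF i(1,2)] Bochner_Integration.integrable_diff[OF i(3,4)]]
        Bochner_Integration.integral_diff[OF i(1,2)] Bochner_Integration.integral_diff[OF i(3,4)] integral_mult_right_zero ..
  qed
  \<comment> \<open>With this value of \<open>E\<close> the two terms containing \<open>m\<close>
    cancel: the source \<open>\<xi> - E\<close> has mean zero under the weighted measure, although
    \<open>m\<close> is a mean under the unweighted one.\<close>
  also have "E = (\<integral>x. \<xi> x * exp (h x) \<partial>?M) / ?Z" unfolding E_def by (rule rho_int_eq[OF V])
  finally show ?thesis using Zpos by (simp add: field_simps)
qed

theorem mainTheorem8:
  fixes \<Omega> :: "(real^'n) set"
    and s c C T :: real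
    and Xad :: "(real^'n \<Rightarrow> real) set"
    and h hd :: "real \<Rightarrow> real^'n \<Rightarrow> real"
  assumes dom: "lipschitz_domain \<Omega>" "connected \<Omega>" "\<Omega> \<noteq> {}"
    and s: "s > max 1 (real CARD('n) / 2)"
    and Xad: "Xad \<subseteq> Hs_space \<Omega> s \<inter> L2_0 \<Omega>"
    and cC: "0 < c" "c < C"
    and wbd: "\<forall>g\<in>Xad. AE x in lebesgue_on \<Omega>. c \<le> wdens \<Omega> g x \<and> wdens \<Omega> g x \<le> C"
    and h_in: "\<forall>t\<in>{0..T}. h t \<in> Xad"
    and hd_in: "\<forall>t\<in>{0..T}. hd t \<in> Hs_space \<Omega> s \<inter> L2_0 \<Omega>"
    and h_deriv: "\<forall>t\<in>{0..T}. ((\<lambda>\<tau>. Hs_norm \<Omega> s (\<lambda>x. (h \<tau> x - h t x) / (\<tau> - t) - hd t x))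
                      \<longlongrightarrow> 0) (at t within {0..T})"
    and hd_cont: "\<forall>t\<in>{0..T}. ((\<lambda>\<tau>. Hs_norm \<Omega> s (\<lambda>x. hd \<tau> x - hd t x))
                      \<longlongrightarrow> 0) (at t within {0..T})"
  shows "\<forall>\<eta>\<in>H1 \<Omega>. \<forall>t\<in>{0..T}.
           ((\<lambda>\<tau>. rho_int \<Omega> (h \<tau>) \<eta>) has_real_derivative
              rho_int \<Omega> (h t) (\<lambda>x. wgrad \<Omega> \<eta> x \<bullet> Tmap \<Omega> (h t) (hd t) x))
           (at t within {0..T})"
proof (intro ballI)
  let ?M = "lebesgue_on \<Omega>"
  fix \<eta> t assume \<eta>: "\<eta> \<in> H1 \<Omega>" and t: "t \<in> {0..T}"
  have \<Omega>: "open \<Omega>" "bounded \<Omega>" using dom(1) by (auto simp: lipschitz_domain_def)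
  have V: "measure lebesgue \<Omega> > 0" by (rule measure_open_bounded_pos[OF \<Omega> dom(3)])
  let ?S = "{0..T}"
  define b where "b = ln (C / c)"
  have h0: "h \<tau> \<in> L2_0 \<Omega>" and hL: "L2_on \<Omega> (h \<tau>)" if "\<tau> \<in> ?S" for \<tau>
    using h_in Xad that by (auto simp: L2_0_def)
  have wb: "AE x in ?M. c \<le> wdens \<Omega> (h \<tau>) x \<and> wdens \<Omega> (h \<tau>) x \<le> C" if "\<tau> \<in> ?S" for \<tau>
    using wbd h_in that by blast
  have hb: "AE x in ?M. \<bar>h \<tau> x\<bar> \<le> b" if "\<tau> \<in> ?S" for \<tau>
    unfolding b_def by (rule potential_bounded[OF \<Omega> dom(3) h0[OF that] cC wb[OF that]])
  have dL: "L2_on \<Omega> (hd t)" using hd_in t by (auto simp: L2_0_def)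
  have \<eta>L: "L2_on \<Omega> \<eta>" by (rule H1_weakD(1)[OF \<eta>])
  \<comment> \<open>Domination by the squared Sobolev norm leaves the \<open>L2\<close> convergence
    that the differentiation lemma asks for.\<close>
  have lim: "((\<lambda>\<tau>. \<integral>x. ((h \<tau> x - h t x) / (\<tau> - t) - hd t x)^2 \<partial>?M) \<longlongrightarrow> 0) (at t within ?S)"
  proof (rule tendsto_sandwich[OF _ _ tendsto_const])
    have "L2_on \<Omega> (\<lambda>x. (h \<tau> x - h t x) / (\<tau> - t) - hd t x)" if "\<tau> \<in> ?S" for \<tau>
      using L2_on_diff[OF L2_on_cmult[OF L2_on_diff[OF hL[OF that] hL[OF t]], of "1 / (\<tau> - t)"] dL] by simp
    then show "\<forall>\<^sub>F \<tau> in at t within ?S. (\<integral>x. ((h \<tau> x - h t x) / (\<tau> - t) - hd t x)^2 \<partial>?M)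
        \<le> (Hs_norm \<Omega> s (\<lambda>x. (h \<tau> x - h t x) / (\<tau> - t) - hd t x))^2"
      by (auto simp: eventually_at_filter intro!: always_eventually L2_norm_le_Hs_norm[OF \<Omega>])
    show "((\<lambda>\<tau>. (Hs_norm \<Omega> s (\<lambda>x. (h \<tau> x - h t x) / (\<tau> - t) - hd t x))^2) \<longlongrightarrow> 0) (at t within ?S)"
      using tendsto_power[OF bspec[OF h_deriv t], of 2] by simp
  qed simp
  note der = integral_exp_has_derivative[OF \<Omega> t hL hb dL _ lim]
  have eL: "L2_on \<Omega> (\<lambda>x. exp (h t x))"
    using hb[OF t] L2_onD(1)[OF hL[OF t]]
    by (intro L2_on_bounded[OF \<Omega>, where M = "exp b"]) (auto elim!: eventually_mono)
  have Zpos: "(\<integral>x. exp (h t x) \<partial>?M) > 0"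
  proof -
    have "(\<integral>x. exp (- b) \<partial>?M) \<le> (\<integral>x. exp (h t x) \<partial>?M)"
      using hb[OF t]
      by (intro integral_mono_AE L2_on_integrable[OF \<Omega>] L2_on_const[OF \<Omega>] eL) (auto elim!: eventually_mono)
    then show ?thesis unfolding integral_lebesgue_on_const[OF \<Omega>(1)] using V by (smt (verit) exp_gt_zero mult_pos_pos)
  qed
  have \<xi>e: "L2_on \<Omega> (\<lambda>x. hd t x * exp (h t x))"
  proof (rule L2_on_weighted[OF L2_onD(1)[OF eL] exp_gt_zero _ dL])
    show "AE x in ?M. exp (- b) \<le> exp (h t x) \<and> exp (h t x) \<le> exp b"
      using hb[OF t] by eventually_elim auto
  qed
  \<comment> \<open>Existence makes the choice inside \<open>Tmap\<close> an actual solution, so its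
    defining equation may be used for whichever solution is chosen.\<close>
  obtain \<psi> where "psi_sol \<Omega> (h t) (hd t) \<psi>"
    using psi_sol_exists[OF dom hL[OF t] dL cC(1) wb[OF t]] by blast
  then have \<psi>: "psi_sol \<Omega> (h t) (hd t) (SOME \<psi>. psi_sol \<Omega> (h t) (hd t) \<psi>)" by (rule someI[of "psi_sol \<Omega> (h t) (hd t)"])
  have N': "((\<lambda>\<tau>. \<integral>x. \<eta> x * exp (h \<tau> x) \<partial>?M) has_real_derivative
     (\<integral>x. \<eta> x * (hd t x * exp (h t x)) \<partial>?M)) (at t within ?S)"
    by (rule der[OF _ _ \<eta>L])
  \<comment> \<open>The normalisation is the same integral with the weight 1 in place of
    \<open>\<eta>\<close>.\<close>
  have Z': "((\<lambda>\<tau>. \<integral>x. exp (h \<tau> x) \<partial>?M) has_real_derivative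
     (\<integral>x. hd t x * exp (h t x) \<partial>?M)) (at t within ?S)"
    using der[OF _ _ L2_on_const[OF \<Omega>, of 1]] by simp
  show "((\<lambda>\<tau>. rho_int \<Omega> (h \<tau>) \<eta>) has_real_derivative
              rho_int \<Omega> (h t) (\<lambda>x. wgrad \<Omega> \<eta> x \<bullet> Tmap \<Omega> (h t) (hd t) x)) (at t within ?S)"
    unfolding Tmap_def flux_eq_covariance[OF \<Omega> dom(3) \<psi> \<eta> dL eL \<xi>e Zpos]
    unfolding rho_int_eq[OF V]
    using Zpos by (intro DERIV_divide N' Z') simp
qed

end
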